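(* Let $q>2$ be a prime power. The Hermitian Singer differential code $C_{\Omega}(\mathtt{D},\mathtt{G})$ is a linear code over $\mathbb{F}_{q^2}$ with parameters $$\left[\,q(q^2-q+1),\ q^3-\tfrac32q^2+\tfrac32q-2,\ d\,\right]_{q^2}$$ (length, dimension, minimum distance), where $3\le d\le\tfrac12(q^2-q)+2$.
   Context: Let $q>2$ be a prime power and let $PG(2,q^6)$ have homogeneous coordinates $(X_1:X_2:X_0)$. Let $\Pi$ be the set of points $(\gamma:\gamma^{q^2+1}:1)$ with $\gamma\in\mathbb{F}_{q^6}$, $\gamma^{q^4+q^2+1}=1$, whose lines are the sections by the lines $sX_1+s^{q^2+1}X_2+X_0=0$ with $s^{q^4+q^2+1}=1$. $\Pi$ is a projective plane of order $q^2$, and there is a projectivity of $PG(2,q^6)$ mapping $\Pi$ onto $PG(2,q^2)$. The Frobenius collineation of $\Pi$, which fixes exactly the points of $\Pi$, is $\Phi_\Pi:(x_1:x_2:x_0)\mapsto(x_0^{q^2}:x_1^{q^2}:x_2^{q^2})$. A curve, divisor or rational function is "defined over $\mathbb{F}_{q^2}$" (equivalently, over $\Pi$) if it is so in the usual sense after applying a projectivity mapping $\Pi$ onto $PG(2,q^2)$. Let $\Gamma$ be the Singer subgroup: the cyclic group of order $q^2-q+1$ generated by the projectivity $(x_1:x_2:x_0)\mapsto(\beta x_1:\beta^{q}x_2:x_0)$, where $\beta$ is a primitive $(q^2-q+1)$-th root of unity in $\mathbb{F}_{q^6}$ (note $\beta^{q^2+1}=\beta^q$). It preserves $\Pi$ and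 every curve $H_t$: $tX_1X_2^q+t^{q^2+1}X_2X_0^q+X_0X_1^q=0$ with $t^{q^2+q+1}=1$. Each $H_t$ is a Hermitian curve of $\Pi$: it is non-singular of genus $\mathfrak{g}=\frac12(q^2-q)$, is defined over $\mathbb{F}_{q^2}$ (that is, in the usual sense after applying a projectivity mapping $\Pi$ onto $PG(2,q^2)$), and has exactly $q^3+1$ points in $\Pi$. These points are its $\mathbb{F}_{q^2}$-rational points. Fix $\tau$ with $\tau^{q^2+q+1}=1$. Let $G=\{P_1,\dots,P_N\}$, $N=q^2-q+1$, be the $\Gamma$-orbit of a point of $H_\tau\cap\Pi$, and put $\mathtt{G}=P_1+\cdots+P_N$. Let $D=\{Q_1,\dots,Q_n\}$ be the set of all other points of $H_\tau\cap\Pi$, so $n=q^3+1-(q^2-q+1)$, and put $\mathtt{D}=Q_1+\cdots+Q_n$. Let $\mathcal{L}(\mathtt{G})$ be the Riemann-Roch space over $\mathbb{F}_{q^2}$, i.e. the rational functions $f$ on $H_\tau$ defined over $\mathbb{F}_{q^2}$ with $f=0$ or $\mathrm{div}(f)+\mathtt{G}\succcurlyeq 0$. The Hermitian Singer functional code is $$C_{\mathcal{L}}(\mathtt{D},\mathtt{G})=\{(f(Q_1),\dots,f(Q_n)) : f\in\mathcal{L}(\mathtt{G})\}\subseteq\mathbb{F}_{q^2}^n .$$ The Hermitian Singer differential code $C_\Omega(\mathtt{D},\mathtt{G})$ is the dual code of $C_{\mathcal{L}}(\mathtt{D},\mathtt{G})$ in $\mathbb{F}_{q^2}^n$ with respect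 to the standard bilinear form. *)

theory Defs
  imports
    "HOL-Analysis.Analysis"
    "HOL-Algebra.Algebraic_Closure_Type"
    "HOL-Number_Theory.Prime_Powers"
begin

section \<open>Projective planes over subfields\<close>

text \<open>
  All geometry takes place in \<open>PG(2,K)\<close> with \<open>K\<close> an algebraically closed field. A point is the
  set of its homogeneous coordinate vectors, and homogeneous coordinates are written in
  the order \<open>(X\<^sub>1 : X\<^sub>2 : X\<^sub>0)\<close>, so that \<open>X\<^sub>0\<close> is the component \<open>x $ 3\<close>.
\<close>

type_synonym 'k point = "('k ^ 3) set"

definition pt :: "'k::field ^ 3 \<Rightarrow> 'k point" where
  "pt v = {c *s v | c. c \<noteq> 0}"

definition PG :: "'k::field set \<Rightarrow> 'k point set" where
  "PG S = {pt v | v. v \<noteq> 0 \<and> (\<forall>i. v $ i \<in> S)}"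

text \<open>If \<open>m\<close> is a power of the characteristic of the algebraically closed field \<open>K\<close>, this is
  the unique subfield of \<open>K\<close> with \<open>m\<close> elements.\<close>

definition GF :: "nat \<Rightarrow> 'k::field set" where
  "GF m = {x. x ^ m = x}"

definition proj_map :: "'k::field ^ 3 ^ 3 \<Rightarrow> 'k point \<Rightarrow> 'k point" where
  "proj_map M P = (\<lambda>v. M *v v) ` P"


section \<open>Function field of a plane curve\<close>

text \<open>
  Ternary forms of degree \<open>d\<close> with coefficients in \<open>S\<close>, as polynomial functions; as \<open>K\<close> is
  infinite, such a function determines its coefficients.
\<close>

definition forms :: "'k::field set \<Rightarrow> nat \<Rightarrow> ('k ^ 3 \<Rightarrow> 'k) set" where
  "forms S d = {\<lambda>x. \<Sum>i\<le>d. \<Sum>j\<le>d - i. c i j * x $ 1 ^ i * x $ 2 ^ j * x $ 3 ^ (d - i - j) | c.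
      \<forall>i j. c i j \<in> S}"

text \<open>
  An (irreducible) projective curve is given by its set \<open>C\<close> of points over the algebraically
  closed field \<open>K\<close>. The pairs below stand for the quotients \<open>A / B\<close> of forms of equal degree,
  \<open>B\<close> not vanishing identically on \<open>C\<close>; a rational function on \<open>C\<close> is the set of
  all pairs representing it.
\<close>

type_synonym 'k ratfun = "(('k ^ 3 \<Rightarrow> 'k) \<times> ('k ^ 3 \<Rightarrow> 'k)) set"

definition fractions :: "'k::field set \<Rightarrow> 'k point set \<Rightarrow> 'k ratfun" where
  "fractions S C = {(A, B). \<exists>d. A \<in> forms S d \<and> B \<in> forms S d \<and> (\<exists>x\<in>\<Union>C. B x \<noteq> 0)}"

definition frac :: "'k::field point set \<Rightarrow> ('k ^ 3 \<Rightarrow> 'k) \<Rightarrow> ('k ^ 3 \<Rightarrow> 'k) \<Rightarrow> 'k ratfun" where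
  "frac C A B = {(A', B') \<in> fractions UNIV C. \<forall>x\<in>\<Union>C. A x * B' x = A' x * B x}"

definition function_field :: "'k::field point set \<Rightarrow> 'k ratfun ring" where
  "function_field C = \<lparr>
     carrier = {frac C A B | A B. (A, B) \<in> fractions UNIV C},
     monoid.mult = (\<lambda>f g. {(A, B) \<in> fractions UNIV C. \<exists>(A1, B1)\<in>f. \<exists>(A2, B2)\<in>g.
        \<forall>x\<in>\<Union>C. A x * (B1 x * B2 x) = (A1 x * A2 x) * B x}),
     one = frac C (\<lambda>_. 1) (\<lambda>_. 1),
     ring.zero = frac C (\<lambda>_. 0) (\<lambda>_. 1),
     add = (\<lambda>f g. {(A, B) \<in> fractions UNIV C. \<exists>(A1, B1)\<in>f. \<exists>(A2, B2)\<in>g.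
        \<forall>x\<in>\<Union>C. A x * (B1 x * B2 x) = (A1 x * B2 x + A2 x * B1 x) * B x})\<rparr>"

definition local_ring :: "'k::field point set \<Rightarrow> 'k point \<Rightarrow> 'k ratfun set" where
  "local_ring C P = {f \<in> carrier (function_field C). \<exists>(A, B)\<in>f. \<forall>x\<in>P. B x \<noteq> 0}"

definition value_at :: "'k::field ratfun \<Rightarrow> 'k point \<Rightarrow> 'k" where
  "value_at f P = (THE c. \<exists>(A, B)\<in>f. \<forall>x\<in>P. B x \<noteq> 0 \<and> A x / B x = c)"

definition max_ideal :: "'k::field point set \<Rightarrow> 'k point \<Rightarrow> 'k ratfun set" where
  "max_ideal C P = {f \<in> local_ring C P. value_at f P = 0}"

definition uniformizer :: "'k::field point set \<Rightarrow> 'k point \<Rightarrow> 'k ratfun \<Rightarrow> bool" where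
  "uniformizer C P t \<longleftrightarrow> t \<in> max_ideal C P \<and>
     max_ideal C P = {t \<otimes>\<^bsub>function_field C\<^esub> h | h. h \<in> local_ring C P}"

text \<open>Order of a nonzero rational function at a non-singular point; the units of the local
  ring are its elements outside the maximal ideal.\<close>

definition ord_at :: "'k::field point set \<Rightarrow> 'k point \<Rightarrow> 'k ratfun \<Rightarrow> int" where
  "ord_at C P f = (THE n. \<exists>t u. uniformizer C P t \<and> u \<in> local_ring C P - max_ideal C P \<and>
     f = u \<otimes>\<^bsub>function_field C\<^esub> (t [^]\<^bsub>function_field C\<^esub> (n::int)))"

text \<open>Divisors are integer-valued functions on the points of \<open>C\<close> over \<open>K\<close>.\<close>

type_synonym 'k divisor = "'k point \<Rightarrow> int"

definition principal_divisor :: "'k::field point set \<Rightarrow> 'k ratfun \<Rightarrow> 'k divisor" where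
  "principal_divisor C f = (\<lambda>P. ord_at C P f)"

definition point_sum :: "'k point set \<Rightarrow> 'k divisor" where
  "point_sum Y = (\<lambda>P. if P \<in> Y then 1 else 0)"


section \<open>The plane $\Pi$, the Singer subgroup and the Hermitian curves\<close>

definition singer_plane :: "nat \<Rightarrow> 'k::field point set" where
  "singer_plane q = {pt (vector [\<gamma>, \<gamma> ^ (q^2 + 1), 1]) | \<gamma>.
     \<gamma> \<in> GF (q^6) \<and> \<gamma> ^ (q^4 + q^2 + 1) = 1}"

definition singer_group :: "nat \<Rightarrow> 'k::field \<Rightarrow> ('k point \<Rightarrow> 'k point) set" where
  "singer_group q \<beta> =
     {proj_map (vector [vector [\<beta>, 0, 0], vector [0, \<beta> ^ q, 0], vector [0, 0, 1]]) ^^ i | i::nat. True}"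

definition singer_orbit :: "nat \<Rightarrow> 'k::field \<Rightarrow> 'k point \<Rightarrow> 'k point set" where
  "singer_orbit q \<beta> P = {g P | g. g \<in> singer_group q \<beta>}"

definition hermitian_curve :: "nat \<Rightarrow> 'k::field \<Rightarrow> 'k point set" where
  "hermitian_curve q t = {pt x | x. x \<noteq> 0 \<and>
     t * x $ 1 * x $ 2 ^ q + t ^ (q^2 + 1) * x $ 2 * x $ 3 ^ q + x $ 3 * x $ 1 ^ q = 0}"

text \<open>
  A rational function on \<open>C\<close> is defined over $F_{q^2}$, relative to the plane $\Pi$, if it is the
  pull-back, under a projectivity mapping $\Pi$ onto \<open>PG(2,q\<^sup>2)\<close>, of a quotient of forms with
  coefficients in $F_{q^2}$ on the image curve.
\<close>

definition defined_over_plane :: "nat \<Rightarrow> 'k::field point set \<Rightarrow> 'k ratfun \<Rightarrow> bool" where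
  "defined_over_plane q C f \<longleftrightarrow>
     (\<exists>M. invertible M \<and> (\<forall>i j. M $ i $ j \<in> GF (q^6)) \<and>
        proj_map M ` singer_plane q = PG (GF (q^2)) \<and>
        (\<exists>(A, B) \<in> fractions (GF (q^2)) (proj_map M ` C).
           f = frac C (\<lambda>x. A (M *v x)) (\<lambda>x. B (M *v x))))"

definition riemann_roch_space ::
    "nat \<Rightarrow> 'k::field point set \<Rightarrow> 'k divisor \<Rightarrow> 'k ratfun set" where
  "riemann_roch_space q C E =
     {f \<in> carrier (function_field C). defined_over_plane q C f \<and>
        (f = \<zero>\<^bsub>function_field C\<^esub> \<or> (\<forall>P\<in>C. principal_divisor C f P + E P \<ge> 0))}"


section \<open>Codes\<close>

text \<open>
  The field \<open>'f\<close> is $F_{q^2}$ and \<open>K\<close> is its algebraic closure; words of length \<open>n\<close> are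
  vectors indexed by a type \<open>'n\<close> with \<open>n\<close> elements, which also indexes the evaluation points.
\<close>

definition functional_code ::
    "nat \<Rightarrow> 'f::{field,finite} alg_closure point set \<Rightarrow> ('n::finite \<Rightarrow> 'f alg_closure point) \<Rightarrow>
     'f alg_closure divisor \<Rightarrow> ('f ^ 'n) set" where
  "functional_code q C Q E =
     {w. \<exists>f \<in> riemann_roch_space q C E. \<forall>i. to_ac (w $ i) = value_at f (Q i)}"

definition dual_code :: "('f::field ^ 'n::finite) set \<Rightarrow> ('f ^ 'n) set" where
  "dual_code W = {v. \<forall>w\<in>W. (\<Sum>i\<in>UNIV. v $ i * w $ i) = 0}"

definition hermitian_singer_differential_code ::
    "nat \<Rightarrow> 'f::{field,finite} alg_closure \<Rightarrow> 'f alg_closure \<Rightarrow> 'f alg_closure point \<Rightarrow>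
     ('n::finite \<Rightarrow> 'f alg_closure point) \<Rightarrow> ('f ^ 'n) set" where
  "hermitian_singer_differential_code q \<tau> \<beta> P0 Q =
     dual_code (functional_code q (hermitian_curve q \<tau>) Q (point_sum (singer_orbit q \<beta> P0)))"

definition hamming_dist :: "'f ^ 'n::finite \<Rightarrow> 'f ^ 'n \<Rightarrow> nat" where
  "hamming_dist v w = card {i. v $ i \<noteq> w $ i}"

definition min_distance :: "('f ^ 'n::finite) set \<Rightarrow> nat" where
  "min_distance W = Min {hamming_dist v w | v w. v \<in> W \<and> w \<in> W \<and> v \<noteq> w}"

end

theory Submission
  imports Defs "HOL-Number_Theory.Residues"
begin

text \<open>
  Let \<open>E\<close> be a form in the span of $X_1X_2^q$, $X_2X_0^q$, $X_0X_1^q$ that is invariant under the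
  Frobenius collineation, vanishes at $P_1$ and does not vanish on $H_\tau$. Its divisor on $H_\tau$ is
  \<open>G\<close> plus \<open>q\<close> times the three vertices of the reference triangle. Hence \<open>L(G)\<close> consists of the
  quotients \<open>F / E\<close> where \<open>F\<close> has degree \<open>q + 1\<close> and vanishes to order \<open>q\<close> at the vertices; modulo
  the equation of the curve these \<open>F\<close> are the combinations of the $\frac12(q^2-q)$ monomials divisible
  by $X_0X_1X_2$ and of two of the three spanning monomials above. Over one Singer orbit the
  monomials restrict to distinct powers of \<open>\<gamma>\<close>, up to one coincidence that is
  resolved by a second orbit, and this gives the dimension. A dual word of weight at most two is
  excluded by $X_1X_2X_0^{q-1}$ and $X_1^2X_2X_0^{q-2}$, whose quotient \<open>\<gamma>\<close> separates the
  points. A dual word of weight at most $\frac12(q^2-q)+2$ is supported in a second orbit, on which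
  some nonzero word of the functional code vanishes.
\<close>

hide_const (open) Polynomials.degree Polynomials.lead_coeff Divisibility.prime Module.smult up_ring.monom up_ring.coeff
no_notation fps_nth (infixl \<open>$\<close> 75)

section \<open>Polynomials, power series and linear systems\<close>

text \<open>The hard inclusion, that \<open>L(G)\<close> holds nothing but these quotients, is
  obtained without Riemann-Roch or an intersection count. On the chart X_1 \<noteq> 0 put y = X_2 /
  X_1 and z = X_0 / X_1. The functions there form a free K[z]-module on 1, y, ..., y^(q-1), and at
  (1:0:0) y is a local parameter while z has order q. So f E becomes a polynomial, every y^j z^k has
  a known order at each vertex, and the vertex conditions turn into inequalities on exponents. A sum
  has larger order than its terms only if terms of least order cancel; as j < q, such ties are rare
  enough to be excluded combinatorially. The same expansion, injective into a ring of power series,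
  shows that the curve is irreducible. A cyclic permutation of coordinates moves each vertex to
  (1:0:0). Single monomials are not rational over \<Pi>; so dimension and orthogonality are treated
  over K, and the rational forms are traces over the Frobenius collineation. E is such a trace: its
  leading coefficient (w^(q^2) - w) / \<kappa> is chosen so that the value at P_1 telescopes to
  0.\<close>

lemma card_roots_separable:
  fixes p :: "'a::alg_closed_field poly"
  assumes "p \<noteq> 0" and sep: "\<And>x. poly p x = 0 \<Longrightarrow> poly (pderiv p) x \<noteq> 0"
  shows "card {x. poly p x = 0} = degree p"
proof -
  obtain A where A: "size A = degree p" "p = smult (lead_coeff p) (\<Prod>x\<in>#A. [:-x, 1:])"
    using alg_closed_imp_factorization[OF assms(1)] by blast
  have roots: "{x. poly p x = 0} = set_mset A"
    by (subst A(2)) (use assms(1) in \<open>auto simp: poly_prod_mset prod_mset_zero_iff\<close>)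
  \<comment> \<open>A factor occurring twice would survive differentiation, so that \<open>x\<close>
    would be a common root of \<open>p\<close> and its derivative.\<close>
  have "count A x = 1" if "x \<in># A" for x
  proof (rule ccontr)
    assume "count A x \<noteq> 1"
    moreover have "count A x \<ge> 1" using that by (simp add: Suc_le_eq)
    ultimately have "count A x \<ge> 2" by linarith
    then have "{#x, x#} \<subseteq># A" by (intro mset_subset_eqI) auto
    then obtain B where B: "A = {#x, x#} + B" by (metis subset_mset.add_diff_inverse)
    define r where "r = smult (lead_coeff p) (\<Prod>x\<in>#B. [:-x, 1:])"
    have p: "p = [:-x, 1:] * ([:-x, 1:] * r)"
      by (subst A(2)) (simp add: B r_def)
    have "poly (pderiv p) x = 0" by (subst p, subst pderiv_mult, simp)
    moreover have "poly p x = 0" by (subst p) simp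
    ultimately show False using sep by blast
  qed
  then have "size A = card (set_mset A)" by (simp add: size_multiset_overloaded_eq)
  with roots A(1) show ?thesis by simp
qed

text \<open>Over a finite field, the product of all \<open>[:-a, 1:]\<close> plus 1 is a nonconstant
  polynomial without roots.\<close>

lemma infinite_UNIV_alg_closed: "infinite (UNIV :: 'a::alg_closed_field set)"
proof
  assume fin: "finite (UNIV :: 'a set)"
  define p :: "'a poly" where "p = (\<Prod>a\<in>UNIV. [:-a, 1:])"
  have p0: "poly p x = 0" for x unfolding p_def poly_prod using fin by auto
  have d: "degree p = card (UNIV :: 'a set)"
    unfolding p_def by (subst degree_prod_eq_sum_degree) auto
  have "card (UNIV :: 'a set) > 0" using fin by (simp add: card_gt_0_iff)
  then have "degree (p + 1) > 0" by (subst degree_add_eq_left) (auto simp: d)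
  then obtain x where "poly (p + 1) x = 0" using alg_closed_imp_poly_has_root by blast
  then show False using p0 by simp
qed

lemma poly_eq_0_if_infinite_roots:
  fixes p :: "'a::idom poly"
  assumes "infinite {x. poly p x = 0}"
  shows "p = 0"
  using assms poly_roots_finite by blast

lemma polyfun_zero_coeffs:
  fixes a :: "nat \<Rightarrow> 'a::alg_closed_field"
  assumes "\<And>x. (\<Sum>i\<le>n. a i * x ^ i) = 0" and "i \<le> n"
  shows "a i = 0"
proof -
  define p where "p = (\<Sum>i\<le>n. monom (a i) i)"
  have "poly p x = 0" for x unfolding p_def using assms(1) by (simp add: poly_sum poly_monom)
  then have "p = 0" using infinite_UNIV_alg_closed by (intro poly_eq_0_if_infinite_roots) auto
  moreover have "coeff p i = a i" unfolding p_def using assms(2) by (simp add: coeff_sum)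
  ultimately show ?thesis by simp
qed

text \<open>Gaussian elimination without division: the coefficients will be polynomials in z, so
  rows are cross-multiplied by the pivot instead of being normalised.\<close>

lemma homogeneous_system_idom:
  fixes M :: "'i \<Rightarrow> 'j \<Rightarrow> 'a::idom"
  assumes "finite I" "finite J" "card I < card J"
  shows "\<exists>x. (\<exists>j\<in>J. x j \<noteq> 0) \<and> (\<forall>i\<in>I. (\<Sum>j\<in>J. M i j * x j) = 0)"
  using assms
proof (induction I arbitrary: J M rule: finite_induct)
  case empty
  then obtain j where "j \<in> J" by (metis card_gt_0_iff ex_in_conv card.empty)
  then show ?case by (intro exI[of _ "\<lambda>_. 1"]) auto
next
  case (insert r I)
  show ?case
  proof (cases "\<forall>j\<in>J. M r j = 0")
    case True
    have "card I < card J" using insert by simp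
    from insert.IH[OF insert.prems(1) this, of M] True show ?thesis by auto
  next
    case False
    then obtain k where k: "k \<in> J" "M r k \<noteq> 0" by blast
    define J' where "J' = J - {k}"
    have fJ': "finite J'" and kJ': "k \<notin> J'" and J: "J = insert k J'"
      using insert.prems k by (auto simp: J'_def)
    have "card I < card J'" using insert.hyps insert.prems k by (simp add: J'_def)
    from insert.IH[OF fJ' this, of "\<lambda>i j. M r k * M i j - M i k * M r j"]
    obtain x j0 where j0: "j0 \<in> J'" "x j0 \<noteq> 0"
      and x: "\<And>i. i \<in> I \<Longrightarrow> (\<Sum>j\<in>J'. (M r k * M i j - M i k * M r j) * x j) = 0" by blast
    \<comment> \<open>The pivot equation is solved for the unknown \<open>k\<close>; scaling the
      other unknowns by the pivot \<open>M r k\<close> avoids a denominator.\<close>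
    define x' where "x' j = (if j = k then - (\<Sum>j\<in>J'. M r j * x j) else M r k * x j)" for j
    have sum: "(\<Sum>j\<in>J. M i j * x' j) = (\<Sum>j\<in>J'. (M r k * M i j - M i k * M r j) * x j)" for i
    proof -
      have "(\<Sum>j\<in>J'. M i j * x' j) = (\<Sum>j\<in>J'. M r k * M i j * x j)"
        using kJ' by (intro sum.cong) (auto simp: x'_def)
      then show ?thesis unfolding J using fJ' kJ'
        by (simp add: x'_def sum_distrib_left algebra_simps sum_subtractf)
    qed
    have "\<forall>i\<in>insert r I. (\<Sum>j\<in>J. M i j * x' j) = 0"
    proof (intro ballI)
      fix i assume "i \<in> insert r I"
      then consider "i = r" | "i \<in> I" by blast
      then show "(\<Sum>j\<in>J. M i j * x' j) = 0"
        by cases (simp_all add: sum x)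
    qed
    moreover have "j0 \<in> J" "x' j0 \<noteq> 0" using j0 k kJ' J by (auto simp: x'_def)
    ultimately show ?thesis by blast
  qed
qed

text \<open>The Frobenius map on power series. Additivity of the q-th power covers finite sums, so
  the series is cut after degree \<open>n\<close>; the tail is a multiple of X^(n+1), and its power
  starts beyond degree \<open>n\<close>.\<close>

lemma fps_power_CHAR_nth:
  fixes f :: "'a::comm_ring_1 fps"
  assumes "prime CHAR('a)" and q: "q = CHAR('a) ^ e"
  shows "fps_nth (f ^ q) n = (if q dvd n then fps_nth f (n div q) ^ q else 0)"
proof -
  have pr: "prime CHAR('a fps)" using assms by simp
  have q': "q = CHAR('a fps) ^ e" using q by simp
  have q0: "q > 0" using assms by (simp add: prime_gt_0_nat)
  define m where "m = Suc n"
  have cut: "fps_cutoff m f = (\<Sum>i<m. fps_const (fps_nth f i) * fps_X ^ i)"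
    by (rule fps_ext) (simp add: fps_sum_nth fps_X_power_nth if_distrib[of "\<lambda>x. _ * x"] cong: if_cong)
  have "f = fps_shift m f * fps_X ^ m + fps_cutoff m f" by (simp add: fps_shift_cutoff)
  then have "f ^ q = (fps_shift m f * fps_X ^ m + fps_cutoff m f) ^ q" by simp
  also have "\<dots> = fps_shift m f ^ q * fps_X ^ (m * q) + (\<Sum>i<m. fps_const (fps_nth f i ^ q) * fps_X ^ (i * q))"
    by (subst freshmans_dream'[OF pr q'], subst cut, subst freshmans_dream_sum'[OF pr q'])
       (simp add: power_mult_distrib power_mult fps_const_power)
  finally have "fps_nth (f ^ q) n = fps_nth (fps_shift m f ^ q * fps_X ^ (m * q)) n + (\<Sum>i<m. if n = i * q then fps_nth f i ^ q else 0)"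
    by (simp add: fps_sum_nth fps_X_power_nth if_distrib[of "\<lambda>x. _ * x"] cong: if_cong)
  moreover have "n < m * q" using mult_le_mono2[of 1 q m] q0 by (simp add: m_def)
  then have "fps_nth (fps_shift m f ^ q * fps_X ^ (m * q)) n = 0" by (simp add: fps_X_power_mult_right_nth)
  moreover have "(\<Sum>i<m. if n = i * q then fps_nth f i ^ q else 0) = (if q dvd n then fps_nth f (n div q) ^ q else 0)"
  proof (cases "q dvd n")
    case True
    then obtain k where k: "n = k * q" by (metis dvd_def mult.commute)
    then have "(\<Sum>i<m. if n = i * q then fps_nth f i ^ q else 0) = (\<Sum>i<m. if i = k then fps_nth f i ^ q else 0)"
      using q0 by (intro sum.cong) auto
    also have "\<dots> = fps_nth f k ^ q" using k q0 by (simp add: m_def less_Suc_eq_le)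
    finally show ?thesis using k q0 by simp
  qed (auto intro!: sum.neutral)
  ultimately show ?thesis by simp
qed

section \<open>Ternary forms\<close>

text \<open>\<open>forms\<close> is given by coefficient arrays, on which products are awkward;
  generation by constants, sums and multiplication by a coordinate makes closure properties short
  inductions. The zero function is a form of every degree, so the degree is an index and not a
  function of the form.\<close>

inductive ternary_form :: "nat \<Rightarrow> ('k::field ^ 3 \<Rightarrow> 'k) \<Rightarrow> bool" where
  const: "ternary_form 0 (\<lambda>x. k)"
| add: "ternary_form d A \<Longrightarrow> ternary_form d B \<Longrightarrow> ternary_form d (\<lambda>x. A x + B x)"
| coord: "ternary_form d A \<Longrightarrow> ternary_form (Suc d) (\<lambda>x. x $ i * A x)"

lemma ternary_form_zero: "ternary_form d (\<lambda>x. 0)"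
proof (induction d)
  case (Suc d)
  from ternary_form.coord[OF Suc, of 1] show ?case by simp
qed (rule ternary_form.const)

lemma ternary_form_cmult: "ternary_form d A \<Longrightarrow> ternary_form d (\<lambda>x. k * A x)"
proof (induction rule: ternary_form.induct)
  case (const k') then show ?case by (rule ternary_form.const)
next
  case (add d A B) then show ?case using ternary_form.add by (simp add: distrib_left)
next
  case (coord d A i) then show ?case using ternary_form.coord[OF coord.IH, of i] by (simp add: mult.left_commute)
qed

lemma ternary_form_mult:
  "ternary_form d A \<Longrightarrow> ternary_form e B \<Longrightarrow> ternary_form (d + e) (\<lambda>x. A x * B x)"
proof (induction rule: ternary_form.induct)
  case (const k) then show ?case by (simp add: ternary_form_cmult)
next
  case (add d A B') then show ?case using ternary_form.add by (simp add: distrib_right)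
next
  case (coord d A i) then show ?case using ternary_form.coord by (simp add: mult.assoc)
qed

lemma ternary_form_minus: "ternary_form d A \<Longrightarrow> ternary_form d (\<lambda>x. - A x)"
  using ternary_form_cmult[of d A "-1"] by simp

lemma ternary_form_diff: "ternary_form d A \<Longrightarrow> ternary_form d B \<Longrightarrow> ternary_form d (\<lambda>x. A x - B x)"
  using ternary_form.add[OF _ ternary_form_minus] by force

lemma ternary_form_coord: "ternary_form 1 (\<lambda>x. x $ i)"
  using ternary_form.coord[OF ternary_form.const[of 1], of i] by simp

lemma ternary_form_power: "ternary_form d A \<Longrightarrow> ternary_form (d * n) (\<lambda>x. A x ^ n)"
  by (induction n) (auto intro: ternary_form.const ternary_form_mult)

lemma ternary_form_sum:
  "(\<And>i. i \<in> I \<Longrightarrow> ternary_form d (A i)) \<Longrightarrow> ternary_form d (\<lambda>x. \<Sum>i\<in>I. A i x)"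
  by (induction I rule: infinite_finite_induct) (auto intro: ternary_form_zero ternary_form.add)

lemma ternary_form_monomial:
  "d = i + j + k \<Longrightarrow> ternary_form d (\<lambda>x. x $ 1 ^ i * x $ 2 ^ j * x $ 3 ^ k)"
  using ternary_form_mult[OF ternary_form_mult[OF ternary_form_power[OF ternary_form_coord[of 1]]
      ternary_form_power[OF ternary_form_coord[of 2]]] ternary_form_power[OF ternary_form_coord[of 3]]]
  by simp

lemma ternary_form_homogeneous: "ternary_form d A \<Longrightarrow> A (c *s x) = c ^ d * A x"
  by (induction rule: ternary_form.induct) (auto simp: algebra_simps)

lemma ternary_form_compose:
  assumes "ternary_form d A" and L: "\<And>i. ternary_form 1 (\<lambda>x. L x $ i)"
  shows "ternary_form d (\<lambda>x. A (L x))"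
  using assms(1)
proof (induction rule: ternary_form.induct)
  case (coord d A i)
  from ternary_form_mult[OF L[of i] coord.IH] show ?case by simp
qed (auto intro: ternary_form.intros)

lemma ternary_form_linear: "ternary_form 1 (\<lambda>x. (M *v x) $ i)"
  unfolding matrix_vector_mult_def
  using ternary_form_sum[of UNIV 1 "\<lambda>j x. M $ i $ j * x $ j"] ternary_form_cmult[OF ternary_form_coord]
  by auto

lemma forms_iff_ternary_form: "A \<in> forms UNIV d \<longleftrightarrow> ternary_form d A"
proof
  assume "A \<in> forms UNIV d"
  then obtain c where A: "A = (\<lambda>x. \<Sum>i\<le>d. \<Sum>j\<le>d - i. c i j * x $ 1 ^ i * x $ 2 ^ j * x $ 3 ^ (d - i - j))"
    by (auto simp: forms_def)
  show "ternary_form d A"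
    unfolding A mult.assoc
    by (intro ternary_form_sum ternary_form_cmult)
       (simp add: ternary_form_monomial flip: mult.assoc)
next
  show "ternary_form d A \<Longrightarrow> A \<in> forms UNIV d"
  proof (induction rule: ternary_form.induct)
    case (const k)
    show ?case by (auto simp: forms_def intro!: exI[of _ "\<lambda>i j. k"])
  next
    case (add d A B)
    then obtain c c' where A: "A = (\<lambda>x. \<Sum>i\<le>d. \<Sum>j\<le>d - i. c i j * x $ 1 ^ i * x $ 2 ^ j * x $ 3 ^ (d - i - j))"
      and B: "B = (\<lambda>x. \<Sum>i\<le>d. \<Sum>j\<le>d - i. c' i j * x $ 1 ^ i * x $ 2 ^ j * x $ 3 ^ (d - i - j))"
      by (auto simp: forms_def)
    show ?case unfolding forms_def A B
      by (rule CollectI, rule exI[of _ "\<lambda>i j. c i j + c' i j"]) (simp add: sum.distrib distrib_right)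
  next
    case (coord d A m)
    then obtain c where A: "A = (\<lambda>x. \<Sum>i\<le>d. \<Sum>j\<le>d - i. c i j * x $ 1 ^ i * x $ 2 ^ j * x $ 3 ^ (d - i - j))"
      by (auto simp: forms_def)
    \<comment> \<open>Multiplying by a coordinate shifts the array. For the third coordinate nothing
      shifts, as its exponent is implicit, but entries with i + j = d + 1 enter the larger sum and
      have to be 0.\<close>
    define c1 where "c1 i j = (case i of 0 \<Rightarrow> 0 | Suc i \<Rightarrow> c i j)" for i j
    define c2 where "c2 i j = (case j of 0 \<Rightarrow> 0 | Suc j \<Rightarrow> if i \<le> d then c i j else 0)" for i j
    define c3 where "c3 i j = (if i + j \<le> d then c i j else 0)" for i j
    have e1: "(\<lambda>x. x $ 1 * A x) = (\<lambda>x. \<Sum>i\<le>Suc d. \<Sum>j\<le>Suc d - i. c1 i j * x $ 1 ^ i * x $ 2 ^ j * x $ 3 ^ (Suc d - i - j))"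
      by (rule ext) (simp add: sum.atMost_Suc_shift c1_def A sum_distrib_left mult_ac del: sum.atMost_Suc)
    have e2: "(\<lambda>x. x $ 2 * A x) = (\<lambda>x. \<Sum>i\<le>Suc d. \<Sum>j\<le>Suc d - i. c2 i j * x $ 1 ^ i * x $ 2 ^ j * x $ 3 ^ (Suc d - i - j))"
    proof
      fix x :: "'a ^ 3"
      have "(\<Sum>j\<le>Suc d - i. c2 i j * x $ 1 ^ i * x $ 2 ^ j * x $ 3 ^ (Suc d - i - j)) =
        (\<Sum>j\<le>d - i. x $ 2 * (c i j * x $ 1 ^ i * x $ 2 ^ j * x $ 3 ^ (d - i - j)))" if "i \<le> d" for i
        using that by (simp add: Suc_diff_le sum.atMost_Suc_shift c2_def mult_ac del: sum.atMost_Suc)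
      then show "x $ 2 * A x = (\<Sum>i\<le>Suc d. \<Sum>j\<le>Suc d - i. c2 i j * x $ 1 ^ i * x $ 2 ^ j * x $ 3 ^ (Suc d - i - j))"
        by (simp add: c2_def A sum_distrib_left)
    qed
    have e3: "(\<lambda>x. x $ 3 * A x) = (\<lambda>x. \<Sum>i\<le>Suc d. \<Sum>j\<le>Suc d - i. c3 i j * x $ 1 ^ i * x $ 2 ^ j * x $ 3 ^ (Suc d - i - j))"
    proof
      fix x :: "'a ^ 3"
      have "(\<Sum>j\<le>Suc d - i. c3 i j * x $ 1 ^ i * x $ 2 ^ j * x $ 3 ^ (Suc d - i - j)) =
        (\<Sum>j\<le>d - i. x $ 3 * (c i j * x $ 1 ^ i * x $ 2 ^ j * x $ 3 ^ (d - i - j)))" if "i \<le> d" for i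
      proof -
        have "c3 i j * x $ 1 ^ i * x $ 2 ^ j * x $ 3 ^ (Suc d - i - j) =
          x $ 3 * (c i j * x $ 1 ^ i * x $ 2 ^ j * x $ 3 ^ (d - i - j))" if "j \<le> d - i" for j
          using that \<open>i \<le> d\<close> by (simp add: c3_def Suc_diff_le mult_ac)
        then have "(\<Sum>j\<le>d - i. c3 i j * x $ 1 ^ i * x $ 2 ^ j * x $ 3 ^ (Suc d - i - j)) =
          (\<Sum>j\<le>d - i. x $ 3 * (c i j * x $ 1 ^ i * x $ 2 ^ j * x $ 3 ^ (d - i - j)))"
          by (intro sum.cong) auto
        moreover have "Suc d - i = Suc (d - i)" "c3 i (Suc (d - i)) = 0"
          using that by (auto simp: c3_def)
        ultimately show ?thesis by simp
      qed
      then show "x $ 3 * A x = (\<Sum>i\<le>Suc d. \<Sum>j\<le>Suc d - i. c3 i j * x $ 1 ^ i * x $ 2 ^ j * x $ 3 ^ (Suc d - i - j))"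
        by (simp add: c3_def A sum_distrib_left)
    qed
    from exhaust_3[of m] show ?case
      unfolding forms_def using e1 e2 e3 by blast
  qed
qed

text \<open>With the third coordinate set to 1, the form is a polynomial in t whose coefficients are
  polynomials in y. Uniqueness of coefficients is what Galois descent relies on later.\<close>

lemma form_coeffs_zero:
  fixes c :: "nat \<Rightarrow> nat \<Rightarrow> 'k::alg_closed_field"
  assumes "\<And>x :: 'k ^ 3. (\<Sum>i\<le>d. \<Sum>j\<le>d - i. c i j * x $ 1 ^ i * x $ 2 ^ j * x $ 3 ^ (d - i - j)) = 0"
    and "i + j \<le> d"
  shows "c i j = 0"
proof -
  have "(\<Sum>i\<le>d. (\<Sum>j\<le>d - i. c i j * y ^ j) * t ^ i) = 0" for t y
    using assms(1)[of "vector [t, y, 1]"] by (simp add: sum_distrib_left sum_distrib_right mult_ac)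
  then have "(\<Sum>j\<le>d - i. c i j * y ^ j) = 0" for y
    using polyfun_zero_coeffs[where n = d and a = "\<lambda>i. \<Sum>j\<le>d - i. c i j * y ^ j" and i = i] assms(2) by auto
  then show ?thesis using polyfun_zero_coeffs[where n = "d - i" and a = "c i" and i = j] assms(2) by auto
qed

section \<open>The affine chart of a curve $a X_1 X_2^q + b X_2 X_0^q + c X_0 X_1^q = 0$\<close>

text \<open>Multiplication by \<open>Y\<close> where Y^(m+1) = u Y + v. The ring is arbitrary
  because the same reduction is used twice, for the value y at a point of the curve and for the
  power series variable.\<close>

lemma times_reduced_sum:
  fixes P :: "nat \<Rightarrow> 'r::comm_ring_1"
  assumes "Y ^ Suc m = u * Y + v" and "m > 0"
  shows "Y * (\<Sum>j<Suc m. P j * Y ^ j) =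
    (\<Sum>j<Suc m. (case j of 0 \<Rightarrow> v * P m | Suc i \<Rightarrow> if i = 0 then P 0 + u * P m else P i) * Y ^ j)"
proof -
  obtain k where m: "m = Suc k" using assms(2) by (cases m) auto
  have Y: "Y * (Y * Y ^ k) = u * Y + v" using assms(1) m by simp
  have "(\<Sum>j<Suc m. (case j of 0 \<Rightarrow> v * P m | Suc i \<Rightarrow> if i = 0 then P 0 + u * P m else P i) * Y ^ j)
    = v * P m + ((P 0 + u * P m) * Y + (\<Sum>j<k. P (Suc j) * Y ^ Suc (Suc j)))"
    unfolding m sum.lessThan_Suc_shift by simp
  also have "\<dots> = P m * (Y * (Y * Y ^ k)) + P 0 * Y + (\<Sum>j<k. P (Suc j) * Y ^ Suc (Suc j))"
    unfolding Y by (simp add: algebra_simps)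
  also have "\<dots> = P m * (Y * Y ^ m) + Y * (P 0 + (\<Sum>j<k. P (Suc j) * Y ^ Suc j))"
    by (simp add: m algebra_simps sum_distrib_left)
  also have "P 0 + (\<Sum>j<k. P (Suc j) * Y ^ Suc j) = (\<Sum>j<m. P j * Y ^ j)"
    unfolding m sum.lessThan_Suc_shift by simp
  finally show ?thesis by (simp add: algebra_simps)
qed

text \<open>Three free coefficients, although the Hermitian curve has c = 1: the family is then
  stable under the cyclic permutation of coordinates, and local work is confined to one
  chart.\<close>

locale klein_curve =
  fixes q e :: nat and a b c :: "'k::alg_closed_field"
  assumes prime_CHAR: "prime CHAR('k)" and q_def: "q = CHAR('k) ^ e" and q_gt_2: "q > 2"
    and nz: "a \<noteq> 0" "b \<noteq> 0" "c \<noteq> 0"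
begin

lemma rotate: "klein_curve q e b c a"
  using prime_CHAR q_def q_gt_2 nz by unfold_locales auto

lemma q_pos: "q > 0" using q_gt_2 by simp

lemma of_nat_q: "of_nat q = (0::'k)"
proof -
  have "e \<noteq> 0" using q_def q_gt_2 by (cases e) auto
  then show ?thesis unfolding q_def by (simp add: of_nat_power of_nat_CHAR power_0_left)
qed

lemma frob_add: "(x + y :: 'k) ^ q = x ^ q + y ^ q"
  by (rule freshmans_dream'[OF prime_CHAR q_def])

lemma frob_diff: "(x - y :: 'k) ^ q = x ^ q - y ^ q"
  using frob_add[of "x - y" y] by (simp add: algebra_simps)

definition aff :: "'k \<Rightarrow> 'k \<Rightarrow> bool" where
  "aff y z \<longleftrightarrow> a * y ^ q + b * y * z ^ q + c * z = 0"

lemma aff_0: "aff y 0 \<longleftrightarrow> y = 0"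
  using nz q_pos by (auto simp: aff_def zero_power)

lemma aff_power: "aff y z \<Longrightarrow> y ^ q = - (b / a) * z ^ q * y + - (c / a) * z"
proof -
  assume "aff y z"
  then have "(a * y ^ q + b * y * z ^ q + c * z) - b * y * z ^ q - c * z = - (b * y * z ^ q) - c * z"
    by (simp add: aff_def)
  then have "a * y ^ q = - (b * y * z ^ q) - c * z" by simp
  also have "\<dots> = a * (- (b / a) * z ^ q * y + - (c / a) * z)"
    using nz by (simp add: field_simps)
  finally show ?thesis using nz by (metis mult_left_cancel)
qed

text \<open>As q = 0 in the field, the derivative of a y^q + b y z^q + c z with respect to y is the
  constant b z^q.\<close>

lemma card_fibre:
  assumes "z \<noteq> 0"
  shows "card {y. aff y z} = q"
proof -
  define p where "p = Polynomial.monom a q + [:c * z, b * z ^ q:]"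
  have pe: "poly p y = a * y ^ q + b * y * z ^ q + c * z" for y
    by (simp add: p_def poly_monom algebra_simps)
  have d: "degree p = q"
    unfolding p_def using q_gt_2 nz
    by (subst degree_add_eq_left) (auto simp: Polynomial.degree_monom_eq)
  have "pderiv p = [:b * z ^ q:]"
    unfolding p_def by (simp add: pderiv_add pderiv_monom of_nat_q pderiv_pCons)
  then have "card {y. poly p y = 0} = degree p"
    using assms nz d q_pos by (intro card_roots_separable) auto
  then show ?thesis by (simp add: pe d aff_def)
qed

lemma fibre_zero:
  assumes "z \<noteq> 0" and "\<And>y. aff y z \<Longrightarrow> (\<Sum>j<q. w j * y ^ j) = 0" and "j < q"
  shows "w j = 0"
proof -
  define p where "p = (\<Sum>j<q. Polynomial.monom (w j) j)"
  have "degree p \<le> q - 1"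
    unfolding p_def by (rule degree_sum_le) (auto intro: order.trans[OF Polynomial.degree_monom_le])
  then have d: "degree p < q" using q_pos by simp
  have "{y. aff y z} \<subseteq> {y. poly p y = 0}" using assms(2) by (auto simp: p_def poly_sum poly_monom)
  have "p = 0"
  proof (rule ccontr)
    assume "p \<noteq> 0"
    then have "card {y. aff y z} \<le> card {y. poly p y = 0}"
      using \<open>_ \<subseteq> _\<close> by (intro card_mono poly_roots_finite)
    also have "\<dots> \<le> degree p" using \<open>p \<noteq> 0\<close> by (rule card_poly_roots_bound)
    finally show False using d card_fibre[OF assms(1)] by simp
  qed
  moreover have "Polynomial.coeff p j = w j" unfolding p_def using assms(3) by (simp add: coeff_sum)
  ultimately show ?thesis by simp
qed

text \<open>By \<open>fibre_zero\<close> the coefficients vanish at almost all z. Hence 1, y, ...,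
  y^(q-1) are independent over K[z] as functions on the chart, even with finitely many fibres left
  out.\<close>

lemma reduced_zero:
  assumes "finite Z" and "\<And>y z. aff y z \<Longrightarrow> z \<notin> Z \<Longrightarrow> (\<Sum>j<q. poly (p j) z * y ^ j) = 0" and "j < q"
  shows "p j = 0"
proof -
  have "poly (p j) z = 0" if "z \<notin> insert 0 Z" for z
    using fibre_zero[of z "\<lambda>j. poly (p j) z", OF _ _ assms(3)] assms(2)[of _ z] that by auto
  then have "- insert 0 Z \<subseteq> {z. poly (p j) z = 0}" by auto
  moreover have "infinite (- insert 0 Z)"
    using assms(1) infinite_UNIV_alg_closed[where 'a = 'k] by (metis finite_compl finite_insert)
  ultimately show ?thesis using infinite_super by (intro poly_eq_0_if_infinite_roots) blast
qed

section \<open>Power series expansion at the vertex (1:0:0)\<close>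

text \<open>Coefficients of the solution of a X^q + b X zeta^q + c zeta = 0 without constant term:
  zeta^q has only exponents divisible by q, so the middle term contributes in degrees n with q
  dividing n - 1. The test n \<noteq> 0 guards against truncated subtraction, where the recursion
  would not descend.\<close>

function zcoeff :: "nat \<Rightarrow> 'k" where
  "zcoeff n = (if n = q then - (a / c)
     else if n \<noteq> 0 \<and> q dvd n - 1 then - (b / c) * zcoeff ((n - 1) div q) ^ q else 0)"
  by auto
termination
proof (relation "Wellfounded.measure id", goal_cases)
  case (2 n)
  then have "(n - 1) div q \<le> n - 1" "n - 1 < n" by auto
  then show ?case by (simp only: in_measure id_apply)
qed simp

declare zcoeff.simps [simp del]

text \<open>At $(1:0:0)$ the coordinate \<open>y = X\<^sub>2 / X\<^sub>1\<close> is a local parameter, and \<open>zeta\<close> is the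
  expansion of \<open>z = X\<^sub>0 / X\<^sub>1\<close>.\<close>

definition zeta :: "'k fps" where "zeta = Abs_fps zcoeff"

text \<open>Between 0 and q only n = 1 meets the recursive case, and it refers to the coefficient at
  0, which is 0. With \<open>zeta_q\<close>, z has order exactly q at (1:0:0).\<close>

lemma zeta_below: "n < q \<Longrightarrow> fps_nth zeta n = 0"
proof -
  assume n: "n < q"
  have 0: "zcoeff 0 = 0" using q_pos by (simp add: zcoeff.simps)
  have "n = 1" if "n \<noteq> 0" "q dvd n - 1" using that n by (metis One_nat_def Suc_pred diff_le_self dvd_imp_le le_antisym not_gr0 less_le_trans not_less)
  then show "fps_nth zeta n = 0" using n 0 q_pos by (auto simp: zeta_def zcoeff.simps[of n])
qed

lemma zeta_0: "fps_nth zeta 0 = 0" using zeta_below q_pos by simp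

lemma zeta_q: "fps_nth zeta q = - (a / c)"
  by (simp add: zeta_def zcoeff.simps)

lemma zeta_nz: "zeta \<noteq> 0" using zeta_q nz by auto

lemma subdegree_zeta: "subdegree zeta = q"
  using zeta_below zeta_q nz by (intro subdegreeI) auto

lemma zeta_eq: "fps_const a * fps_X ^ q + fps_const b * fps_X * zeta ^ q + fps_const c * zeta = 0"
proof (rule fps_ext)
  fix n
  have F: "fps_nth (zeta ^ q) k = (if q dvd k then zcoeff (k div q) ^ q else 0)" for k
    using fps_power_CHAR_nth[OF prime_CHAR q_def, of zeta k] by (simp add: zeta_def)
  \<comment> \<open>In degree q the term with zeta^q must not contribute, which the first case of
    the recursion presupposes.\<close>
  have "\<not> q dvd q - Suc 0" using q_gt_2 by (auto dest: dvd_imp_le)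
  then show "fps_nth (fps_const a * fps_X ^ q + fps_const b * fps_X * zeta ^ q + fps_const c * zeta) n = fps_nth 0 n"
  proof -
    consider "n = 0" | "n = q" | "n \<noteq> 0" "n \<noteq> q" by blast
    then show ?thesis
    proof cases
      case 1
      then show ?thesis using q_pos by (simp add: mult.assoc zeta_0 fps_X_power_nth)
    next
      case 2
      then show ?thesis using nz q_pos \<open>\<not> q dvd q - Suc 0\<close> by (simp add: mult.assoc zeta_q F)
    next
      case 3
      then have "fps_nth zeta n = (if q dvd n - 1 then - (b / c) * zcoeff ((n - 1) div q) ^ q else 0)"
        by (simp add: zeta_def zcoeff.simps[of n])
      then show ?thesis using 3 nz by (simp add: mult.assoc F fps_X_power_nth)
    qed
  qed
qed

lemma zeta_power: "fps_X ^ q = fps_const (- (b / a)) * zeta ^ q * fps_X + fps_const (- (c / a)) * zeta"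
proof -
  have "fps_const (1 / a) * (fps_const a * fps_X ^ q + fps_const b * fps_X * zeta ^ q + fps_const c * zeta) = 0"
    by (simp add: zeta_eq)
  then have "fps_X ^ q + (fps_const (b / a) * zeta ^ q * fps_X + fps_const (c / a) * zeta) = 0"
  proof -
    have "fps_const (1 / a) * fps_const a = 1" "fps_const (1 / a) * fps_const b = fps_const (b / a)"
      "fps_const (1 / a) * fps_const c = fps_const (c / a)" using nz by simp_all
    moreover assume "fps_const (1 / a) * (fps_const a * fps_X ^ q + fps_const b * fps_X * zeta ^ q + fps_const c * zeta) = 0"
    then have "(fps_const (1 / a) * fps_const a) * fps_X ^ q + ((fps_const (1 / a) * fps_const b) * zeta ^ q * fps_X
      + (fps_const (1 / a) * fps_const c) * zeta) = 0" by (simp only: algebra_simps)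
    ultimately show ?thesis by simp
  qed
  then have "fps_X ^ q = - (fps_const (b / a) * zeta ^ q * fps_X + fps_const (c / a) * zeta)"
    by (rule eq_neg_iff_add_eq_0[THEN iffD2])
  moreover have "fps_const (- k) = - fps_const k" for k :: 'k by simp
  ultimately show ?thesis by (simp only: minus_add_distrib mult_minus_left)
qed

definition at_zeta :: "'k poly \<Rightarrow> 'k fps" where
  "at_zeta p = fps_compose (fps_of_poly p) zeta"

lemma at_zeta_add: "at_zeta (p + r) = at_zeta p + at_zeta r"
  by (simp add: at_zeta_def fps_of_poly_add fps_compose_add_distrib)

lemma at_zeta_mult: "at_zeta (p * r) = at_zeta p * at_zeta r"
  by (simp add: at_zeta_def fps_of_poly_mult fps_compose_mult_distrib[OF zeta_0])

lemma at_zeta_const [simp]: "at_zeta [:k:] = fps_const k"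
  by (simp add: at_zeta_def fps_of_poly_const)

lemma at_zeta_0 [simp]: "at_zeta 0 = 0"
  by (simp add: at_zeta_def)

lemma at_zeta_1 [simp]: "at_zeta 1 = 1"
  by (simp add: at_zeta_def)

lemma at_zeta_X [simp]: "at_zeta [:0, 1:] = zeta"
  by (simp add: at_zeta_def fps_of_poly_pCons fps_compose_add_distrib fps_X_fps_compose_startby0 zeta_0)

lemma at_zeta_pCons: "at_zeta (pCons k r) = fps_const k + zeta * at_zeta r"
proof -
  have "pCons k r = [:k:] + [:0, 1:] * r" by simp
  then show ?thesis by (simp only: at_zeta_add at_zeta_mult at_zeta_const at_zeta_X)
qed

lemma at_zeta_power: "at_zeta (p ^ n) = at_zeta p ^ n"
  by (induction n) (simp_all add: at_zeta_mult)

lemma zeta_mult_nth: "k < q \<Longrightarrow> fps_nth (zeta * f) k = 0"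
  by (auto simp: fps_mult_nth zeta_below intro!: sum.neutral)

text \<open>Because zeta has order q, p(zeta) agrees with the constant p(0) modulo X^q.\<close>

lemma at_zeta_nth: "k < q \<Longrightarrow> fps_nth (at_zeta p) k = (if k = 0 then poly p 0 else 0)"
  by (cases p) (simp add: at_zeta_pCons zeta_mult_nth)

lemma reduced_fps_nth:
  assumes "n < q"
  shows "fps_nth (\<Sum>j<q. at_zeta (p j) * fps_X ^ j) n = poly (p n) 0"
proof -
  have "fps_nth (at_zeta (p j) * fps_X ^ j) n = (if j = n then poly (p n) 0 else 0)" if "j < q" for j
    using assms that by (auto simp: fps_X_power_mult_right_nth at_zeta_nth)
  then show ?thesis using assms by (simp add: fps_sum_nth)
qed

text \<open>Reduced sums expand injectively: the coefficients below degree q are the values p_j(0);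
  if these vanish, every p_j is divisible by z, the factor zeta cancels, and the degrees
  drop.\<close>

lemma reduced_fps_zero:
  assumes "(\<Sum>j<q. at_zeta (p j) * fps_X ^ j) = 0" and "j < q"
  shows "p j = 0"
proof -
  have "\<forall>j<q. p j = 0" if "\<forall>j<q. degree (p j) \<le> D" "(\<Sum>j<q. at_zeta (p j) * fps_X ^ j) = 0" for D
    using that
  proof (induction D arbitrary: p)
    case 0
    have "poly (p j) 0 = 0" if "j < q" for j using reduced_fps_nth[OF that, of p] 0 by simp
    with 0(1) show ?case by (metis degree_eq_zeroE le_zero_eq pCons_0_0 poly_const_conv)
  next
    case (Suc D)
    have 0: "poly (p j) 0 = 0" if "j < q" for j using reduced_fps_nth[OF that, of p] Suc by simp
    have "\<exists>r. p j = pCons 0 r" if "j < q" for j using 0[OF that] by (cases "p j") auto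
    then obtain r where r: "\<And>j. j < q \<Longrightarrow> p j = pCons 0 (r j)" by metis
    have "zeta * (\<Sum>j<q. at_zeta (r j) * fps_X ^ j) = (\<Sum>j<q. at_zeta (p j) * fps_X ^ j)"
      by (simp add: sum_distrib_left r at_zeta_pCons mult.assoc)
    then have "(\<Sum>j<q. at_zeta (r j) * fps_X ^ j) = 0" using Suc.prems(2) zeta_nz by simp
    moreover have "degree (r j) \<le> D" if "j < q" for j
      using Suc.prems(1) r[OF that] that by (cases "r j = 0") (auto split: if_splits)
    ultimately have "\<forall>j<q. r j = 0" by (intro Suc.IH) auto
    then show ?case using r by auto
  qed
  moreover have "\<exists>D. \<forall>j<q. degree (p j) \<le> D"
    by (rule exI[of _ "\<Sum>j<q. degree (p j)"]) (auto intro: member_le_sum)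
  ultimately show ?thesis using assms by blast
qed

section \<open>Functions on the chart compared with their power series\<close>

text \<open>A relation and not a map: \<open>\<phi>\<close> is a function of all pairs but matters
  only on the curve, and the same reduced coefficients have to produce its values and the series.
  The series is unique by \<open>expands_unique\<close>.\<close>

definition expands :: "('k \<Rightarrow> 'k \<Rightarrow> 'k) \<Rightarrow> 'k fps \<Rightarrow> bool" where
  "expands \<phi> s \<longleftrightarrow> (\<exists>p. (\<forall>y z. aff y z \<longrightarrow> \<phi> y z = (\<Sum>j<q. poly (p j) z * y ^ j)) \<and>
     s = (\<Sum>j<q. at_zeta (p j) * fps_X ^ j))"

lemma expands_cong: "expands \<phi> s \<Longrightarrow> (\<And>y z. aff y z \<Longrightarrow> \<phi> y z = \<psi> y z) \<Longrightarrow> expands \<psi> s"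
  unfolding expands_def by metis

lemma expands_poly: "expands (\<lambda>y z. poly r z) (at_zeta r)"
  unfolding expands_def
proof (intro exI[of _ "\<lambda>j. if j = 0 then r else 0"] conjI allI impI)
  fix y z
  show "poly r z = (\<Sum>j<q. poly (if j = 0 then r else 0) z * y ^ j)"
    using q_pos by (subst sum.remove[of _ 0]) auto
  show "at_zeta r = (\<Sum>j<q. at_zeta (if j = 0 then r else 0) * fps_X ^ j)"
    using q_pos by (subst sum.remove[of _ 0]) auto
qed

lemma expands_add: "expands \<phi> s \<Longrightarrow> expands \<psi> t \<Longrightarrow> expands (\<lambda>y z. \<phi> y z + \<psi> y z) (s + t)"
  unfolding expands_def
  by (elim exE conjE, rule_tac x = "\<lambda>j. p j + pa j" in exI)
     (simp add: sum.distrib distrib_right at_zeta_add)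

lemma expands_poly_mult: "expands \<phi> s \<Longrightarrow> expands (\<lambda>y z. poly r z * \<phi> y z) (at_zeta r * s)"
  unfolding expands_def
  by (elim exE conjE, rule_tac x = "\<lambda>j. r * p j" in exI)
     (simp add: sum_distrib_left mult.assoc at_zeta_mult)

text \<open>Only the top power y^(q-1) overflows; it is reduced by the curve equation, which holds
  with the same coefficients for (y, z) and for (X, zeta).\<close>

lemma expands_y_mult: "expands \<phi> s \<Longrightarrow> expands (\<lambda>y z. y * \<phi> y z) (fps_X * s)"
proof -
  assume "expands \<phi> s"
  then obtain p where \<phi>: "\<And>y z. aff y z \<Longrightarrow> \<phi> y z = (\<Sum>j<q. poly (p j) z * y ^ j)"
    and s: "s = (\<Sum>j<q. at_zeta (p j) * fps_X ^ j)" unfolding expands_def by blast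
  obtain m where m: "q = Suc m" "m > 0" using q_gt_2 by (cases q) auto
  define u where "u = [:- (b / a):] * [:0, 1:] ^ q"
  define v where "v = [:- (c / a):] * [:0, 1:]"
  define p' where "p' j = (case j of 0 \<Rightarrow> v * p m | Suc i \<Rightarrow> if i = 0 then p 0 + u * p m else p i)" for j
  have "y * \<phi> y z = (\<Sum>j<q. poly (p' j) z * y ^ j)" if "aff y z" for y z
  proof -
    have "y ^ Suc m = poly u z * y + poly v z"
      using aff_power[OF that] by (simp add: u_def v_def m mult_ac)
    note times_reduced_sum[OF this m(2), of "\<lambda>j. poly (p j) z"]
    also have "(\<lambda>j. case j of 0 \<Rightarrow> poly v z * poly (p m) z | Suc i \<Rightarrow>
      if i = 0 then poly (p 0) z + poly u z * poly (p m) z else poly (p i) z) = (\<lambda>j. poly (p' j) z)"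
      by (rule ext) (simp add: p'_def split: nat.split)
    finally show ?thesis unfolding \<phi>[OF that] m(1)[symmetric] .
  qed
  moreover have "fps_X * s = (\<Sum>j<q. at_zeta (p' j) * fps_X ^ j)"
  proof -
    have "fps_X ^ Suc m = at_zeta u * fps_X + at_zeta v"
      using zeta_power by (simp only: u_def v_def m(1)[symmetric] at_zeta_mult at_zeta_power at_zeta_const at_zeta_X)
    note times_reduced_sum[OF this m(2), of "\<lambda>j. at_zeta (p j)"]
    also have "(\<lambda>j. case j of 0 \<Rightarrow> at_zeta v * at_zeta (p m) | Suc i \<Rightarrow>
      if i = 0 then at_zeta (p 0) + at_zeta u * at_zeta (p m) else at_zeta (p i)) = (\<lambda>j. at_zeta (p' j))"
      by (rule ext) (simp add: p'_def at_zeta_add at_zeta_mult split: nat.split)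
    finally show ?thesis unfolding s m(1)[symmetric] .
  qed
  ultimately show ?thesis unfolding expands_def by blast
qed

lemma expands_sum:
  "(\<And>i. i \<in> I \<Longrightarrow> expands (\<phi> i) (s i)) \<Longrightarrow> expands (\<lambda>y z. \<Sum>i\<in>I. \<phi> i y z) (\<Sum>i\<in>I. s i)"
proof (induction I rule: infinite_finite_induct)
  case (insert x F) then show ?case by (simp add: expands_add)
qed (use expands_poly[of 0] in auto)

lemma expands_y_power_mult: "expands \<phi> s \<Longrightarrow> expands (\<lambda>y z. y ^ j * \<phi> y z) (fps_X ^ j * s)"
proof (induction j)
  case (Suc j)
  from expands_y_mult[OF Suc.IH[OF Suc.prems]] show ?case by (simp add: mult.assoc)
qed simp

lemma expands_mult:
  assumes "expands \<phi> s" "expands \<psi> t"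
  shows "expands (\<lambda>y z. \<phi> y z * \<psi> y z) (s * t)"
proof -
  obtain p where \<phi>: "\<And>y z. aff y z \<Longrightarrow> \<phi> y z = (\<Sum>j<q. poly (p j) z * y ^ j)"
    and s: "s = (\<Sum>j<q. at_zeta (p j) * fps_X ^ j)" using assms(1) unfolding expands_def by blast
  have "expands (\<lambda>y z. \<Sum>j<q. poly (p j) z * (y ^ j * \<psi> y z)) (\<Sum>j<q. at_zeta (p j) * (fps_X ^ j * t))"
    by (intro expands_sum expands_poly_mult expands_y_power_mult assms(2))
  then show ?thesis unfolding s sum_distrib_right mult.assoc
    by (rule expands_cong) (simp add: \<phi> sum_distrib_right mult.assoc)
qed

text \<open>Both sides say that all reduced coefficients are 0, for series by
  \<open>reduced_fps_zero\<close> and for functions by \<open>reduced_zero\<close>. So the functions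
  on the chart embed into an integral domain, which is the source of irreducibility.\<close>

lemma expands_zero_iff: "expands \<phi> s \<Longrightarrow> s = 0 \<longleftrightarrow> (\<forall>y z. aff y z \<longrightarrow> \<phi> y z = 0)"
proof -
  assume "expands \<phi> s"
  then obtain p where \<phi>: "\<And>y z. aff y z \<Longrightarrow> \<phi> y z = (\<Sum>j<q. poly (p j) z * y ^ j)"
    and s: "s = (\<Sum>j<q. at_zeta (p j) * fps_X ^ j)" unfolding expands_def by blast
  have "s = 0 \<longleftrightarrow> (\<forall>j<q. p j = 0)"
    using reduced_fps_zero[of p] by (auto simp: s)
  also have "\<dots> \<longleftrightarrow> (\<forall>y z. aff y z \<longrightarrow> \<phi> y z = 0)"
    using reduced_zero[of "{}" p] by (auto simp: \<phi>)
  finally show ?thesis .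
qed

lemma fps_const_minus_1: "fps_const (- 1 :: 'k) = - 1"
  using fps_const_neg[of "1 :: 'k"] unfolding fps_const_1_eq_1 by (rule sym)

lemma expands_unique: "expands \<phi> s \<Longrightarrow> expands \<phi> t \<Longrightarrow> s = t"
proof -
  assume s: "expands \<phi> s" and t: "expands \<phi> t"
  have "expands (\<lambda>y z. \<phi> y z + poly [:-1:] z * \<phi> y z) (s + at_zeta [:-1:] * t)"
    by (intro expands_add expands_poly_mult s t)
  then have "s + at_zeta [:-1:] * t = 0" using expands_zero_iff by fastforce
  then have "s + - t = 0" unfolding at_zeta_const fps_const_minus_1 by simp
  then show ?thesis by simp
qed

lemma expands_nth_0: "expands \<phi> s \<Longrightarrow> fps_nth s 0 = \<phi> 0 0"
proof -
  assume "expands \<phi> s"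
  then obtain p where \<phi>: "\<And>y z. aff y z \<Longrightarrow> \<phi> y z = (\<Sum>j<q. poly (p j) z * y ^ j)"
    and s: "s = (\<Sum>j<q. at_zeta (p j) * fps_X ^ j)" unfolding expands_def by blast
  have "\<phi> 0 0 = poly (p 0) 0" using \<phi>[of 0 0] q_pos aff_0 by (simp add: power_0_left if_distrib cong: if_cong)
  then show ?thesis using reduced_fps_nth[OF q_pos, of p] s by simp
qed

lemma aff_cofinite_zero:
  assumes "expands \<phi> s" "finite Z" "\<And>y z. aff y z \<Longrightarrow> z \<notin> Z \<Longrightarrow> \<phi> y z = 0" and "aff y z"
  shows "\<phi> y z = 0"
proof -
  obtain p where \<phi>: "\<And>y z. aff y z \<Longrightarrow> \<phi> y z = (\<Sum>j<q. poly (p j) z * y ^ j)"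
    using assms(1) unfolding expands_def by blast
  have "p j = 0" if "j < q" for j
    using reduced_zero[OF assms(2) _ that, of p] assms(3) \<phi> by auto
  then show ?thesis using \<phi>[OF assms(4)] by simp
qed

end

section \<open>The projective curve\<close>

text \<open>The degree is dropped where only homogeneity matters; \<open>form_degree_unique\<close>
  recovers it when two forms are to become numerator and denominator.\<close>

definition tform :: "('k::field ^ 3 \<Rightarrow> 'k) \<Rightarrow> bool" where
  "tform A \<longleftrightarrow> (\<exists>d. ternary_form d A)"

lemma tformI: "ternary_form d A \<Longrightarrow> tform A"
  by (auto simp: tform_def)

lemma tform_mult: "tform A \<Longrightarrow> tform B \<Longrightarrow> tform (\<lambda>x. A x * B x)"
  unfolding tform_def by (blast intro: ternary_form_mult)

lemma tform_const: "tform (\<lambda>x. k)"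
  unfolding tform_def by (blast intro: ternary_form.const)

lemma tform_coord: "tform (\<lambda>x. x $ i)"
  unfolding tform_def by (blast intro: ternary_form_coord)

lemma tform_power: "tform A \<Longrightarrow> tform (\<lambda>x. A x ^ n)"
  unfolding tform_def by (blast intro: ternary_form_power)

lemmas tform_intros = tform_mult tform_const tform_coord tform_power

lemma tform_scale_nz: "tform A \<Longrightarrow> k \<noteq> 0 \<Longrightarrow> A (k *s x) = 0 \<longleftrightarrow> A x = 0"
  unfolding tform_def by (auto simp: ternary_form_homogeneous)

definition rot :: "'k::field ^ 3 \<Rightarrow> 'k ^ 3" where
  "rot x = vector [x $ 3, x $ 1, x $ 2]"

lemma rot_nth [simp]: "rot x $ 1 = x $ 3" "rot x $ 2 = x $ 1" "rot x $ 3 = x $ 2"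
  by (simp_all add: rot_def)

lemma vec3_eq_iff: "(x :: 'k ^ 3) = y \<longleftrightarrow> x $ 1 = y $ 1 \<and> x $ 2 = y $ 2 \<and> x $ 3 = y $ 3"
  by (simp add: vec_eq_iff forall_3)

lemma rot_rot_rot [simp]: "rot (rot (rot x)) = x"
  by (simp add: vec3_eq_iff)

lemma rot_zero_iff [simp]: "rot x = 0 \<longleftrightarrow> x = 0"
  by (auto simp: vec3_eq_iff)

lemma ternary_form_rot: "ternary_form d A \<Longrightarrow> ternary_form d (\<lambda>x. A (rot x))"
proof (rule ternary_form_compose)
  show "ternary_form 1 (\<lambda>x. rot x $ i)" for i
    using exhaust_3[of i] by (elim disjE) (simp_all add: ternary_form_coord[unfolded One_nat_def])
qed

lemma tform_rot: "tform A \<Longrightarrow> tform (\<lambda>x. A (rot x))"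
  unfolding tform_def by (blast intro: ternary_form_rot)

context klein_curve
begin

text \<open>The affine cone without its apex: forms have values at vectors, whereas points are
  classes of vectors.\<close>

definition cone :: "('k ^ 3) set" where
  "cone = {x. x \<noteq> 0 \<and> a * x $ 1 * x $ 2 ^ q + b * x $ 2 * x $ 3 ^ q + c * x $ 3 * x $ 1 ^ q = 0}"

lemma cone_chart: "vector [1, y, z] \<in> cone \<longleftrightarrow> aff y z"
  by (auto simp: cone_def aff_def vec3_eq_iff)

lemma cone_scale: "k \<noteq> 0 \<Longrightarrow> k *s x \<in> cone \<longleftrightarrow> x \<in> cone"
proof -
  assume k: "k \<noteq> 0"
  have "a * (k * x $ 1) * (k * x $ 2) ^ q + b * (k * x $ 2) * (k * x $ 3) ^ q + c * (k * x $ 3) * (k * x $ 1) ^ q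
    = k ^ Suc q * (a * x $ 1 * x $ 2 ^ q + b * x $ 2 * x $ 3 ^ q + c * x $ 3 * x $ 1 ^ q)"
    by (simp add: power_mult_distrib algebra_simps)
  then show ?thesis using k by (simp add: cone_def vec3_eq_iff)
qed

lemma cone_chartE:
  assumes "x \<in> cone" "x $ 1 \<noteq> 0"
  obtains y z where "aff y z" "x = (x $ 1) *s vector [1, y, z]"
proof -
  have eq: "x = (x $ 1) *s vector [1, x $ 2 / x $ 1, x $ 3 / x $ 1]"
    using assms by (simp add: vec3_eq_iff)
  then have "vector [1, x $ 2 / x $ 1, x $ 3 / x $ 1] \<in> cone"
    using cone_scale[OF assms(2)] assms(1) by metis
  then show ?thesis using that eq unfolding cone_chart by blast
qed

definition psi :: "('k ^ 3 \<Rightarrow> 'k) \<Rightarrow> 'k fps" where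
  "psi A = (THE s. expands (\<lambda>y z. A (vector [1, y, z])) s)"

lemma psi_eqI: "expands (\<lambda>y z. A (vector [1, y, z])) s \<Longrightarrow> psi A = s"
  unfolding psi_def using expands_unique by blast

lemma expands_coord: "\<exists>s. expands (\<lambda>y z. vector [1, y, z] $ (i :: 3)) s"
proof -
  have "expands (\<lambda>y z. 1) 1" using expands_poly[of 1] by simp
  moreover have "expands (\<lambda>y z. y) (fps_X)" using expands_y_mult[OF expands_poly[of 1]] by simp
  moreover have "expands (\<lambda>y z. z) zeta" using expands_poly[of "[:0, 1:]"] by simp
  ultimately show ?thesis using exhaust_3[of i] by auto
qed

lemma expands_form_ex: "ternary_form d A \<Longrightarrow> \<exists>s. expands (\<lambda>y z. A (vector [1, y, z])) s"
proof (induction rule: ternary_form.induct)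
  case (const k)
  show ?case using expands_poly[of "[:k:]"] by auto
next
  case (add d A B)
  then show ?case using expands_add by blast
next
  case (coord d A i)
  then show ?case using expands_mult expands_coord[of i] by blast
qed

lemma expands_form: "tform A \<Longrightarrow> expands (\<lambda>y z. A (vector [1, y, z])) (psi A)"
  unfolding tform_def using expands_form_ex psi_eqI by metis

lemma psi_const: "psi (\<lambda>x. k) = fps_const k"
  using expands_poly[of "[:k:]"] by (intro psi_eqI) simp

lemma psi_coord: "psi (\<lambda>x. x $ 1) = 1" "psi (\<lambda>x. x $ 2) = fps_X" "psi (\<lambda>x. x $ 3) = zeta"
  using expands_poly[of 1] expands_y_mult[OF expands_poly[of 1]] expands_poly[of "[:0, 1:]"]
  by (auto intro!: psi_eqI)

lemma psi_mult: "tform A \<Longrightarrow> tform B \<Longrightarrow> psi (\<lambda>x. A x * B x) = psi A * psi B"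
  by (intro psi_eqI expands_mult expands_form)

lemma psi_add: "tform A \<Longrightarrow> tform B \<Longrightarrow> psi (\<lambda>x. A x + B x) = psi A + psi B"
  by (intro psi_eqI expands_add expands_form)

lemma psi_power: "tform A \<Longrightarrow> psi (\<lambda>x. A x ^ n) = psi A ^ n"
  by (induction n) (simp_all add: psi_const psi_mult tform_power)

lemma psi_sum: "(\<And>i. i \<in> I \<Longrightarrow> tform (A i)) \<Longrightarrow> psi (\<lambda>x. \<Sum>i\<in>I. A i x) = (\<Sum>i\<in>I. psi (A i))"
  by (intro psi_eqI expands_sum expands_form)

lemma psi_nth_0: "tform A \<Longrightarrow> fps_nth (psi A) 0 = A (vector [1, 0, 0])"
  using expands_nth_0 expands_form by blast

lemma psi_zero_iff_chart:
  assumes "tform A"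
  shows "psi A = 0 \<longleftrightarrow> (\<forall>x\<in>cone. x $ 1 \<noteq> 0 \<longrightarrow> A x = 0)"
proof -
  have "psi A = 0 \<longleftrightarrow> (\<forall>y z. aff y z \<longrightarrow> A (vector [1, y, z]) = 0)"
    using expands_zero_iff[OF expands_form[OF assms]] by simp
  also have "\<dots> \<longleftrightarrow> (\<forall>x\<in>cone. x $ 1 \<noteq> 0 \<longrightarrow> A x = 0)"
  proof (intro iffI ballI impI allI)
    fix x assume *: "\<forall>y z. aff y z \<longrightarrow> A (vector [1, y, z]) = 0" and x: "x \<in> cone" "x $ 1 \<noteq> 0"
    obtain y z where "aff y z" "x = x $ 1 *s vector [1, y, z]" using cone_chartE[OF x] .
    then show "A x = 0" using * tform_scale_nz[OF assms x(2)] by metis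
  next
    fix y z assume "\<forall>x\<in>cone. x $ 1 \<noteq> 0 \<longrightarrow> A x = 0" "aff y z"
    then show "A (vector [1, y, z]) = 0" using cone_chart by auto
  qed
  finally show ?thesis .
qed

lemma rot_cone: "rot x \<in> cone \<longleftrightarrow> x \<in> klein_curve.cone q b c a"
proof -
  interpret R: klein_curve q e b c a by (rule rotate)
  show ?thesis by (simp add: cone_def R.cone_def algebra_simps)
qed

lemma rot_rot_cone: "rot (rot x) \<in> cone \<longleftrightarrow> x \<in> klein_curve.cone q c a b"
proof -
  interpret R: klein_curve q e b c a by (rule rotate)
  show ?thesis by (simp add: rot_cone R.rot_cone)
qed

text \<open>Vanishing on the chart extends to the points with x_1 = 0: in a rotated chart the
  product of the form and the coordinate that was x_1 vanishes, and that coordinate has a nonzero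
  expansion.\<close>

lemma psi_zero_iff:
  assumes A: "tform A"
  shows "psi A = 0 \<longleftrightarrow> (\<forall>x\<in>cone. A x = 0)"
proof
  assume "\<forall>x\<in>cone. A x = 0" then show "psi A = 0" using psi_zero_iff_chart[OF A] by blast
next
  assume 0: "psi A = 0"
  interpret R: klein_curve q e b c a by (rule rotate)
  interpret R2: klein_curve q e c a b by (rule R.rotate)
  have 1: "A x = 0" if "x \<in> cone" "x $ 1 \<noteq> 0" for x
    using 0 psi_zero_iff_chart[OF A] that by blast
  note A' = tform_rot[OF A]
  note A'' = tform_rot[OF A']
  have "R.psi (\<lambda>x. x $ 3 * A (rot x)) = 0"
    unfolding R.psi_zero_iff_chart[OF tform_mult[OF tform_coord A']]
  proof (intro ballI impI)
    fix x assume "x \<in> R.cone"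
    then have "rot x \<in> cone" by (simp add: rot_cone)
    from 1[OF this] show "x $ 3 * A (rot x) = 0" by (cases "x $ 3 = 0") auto
  qed
  then have "R.psi (\<lambda>x. A (rot x)) = 0"
    using R.zeta_nz by (simp add: R.psi_mult R.psi_coord tform_coord A')
  then have 2: "A (rot x) = 0" if "rot x \<in> cone" "x $ 1 \<noteq> 0" for x
    using R.psi_zero_iff_chart[OF A'] that by (auto simp: rot_cone[symmetric])
  have "R2.psi (\<lambda>x. x $ 2 * A (rot (rot x))) = 0"
    unfolding R2.psi_zero_iff_chart[OF tform_mult[OF tform_coord A'']]
  proof (intro ballI impI)
    fix x assume "x \<in> R2.cone"
    then have "rot (rot x) \<in> cone" by (simp add: rot_rot_cone)
    from 1[OF this] show "x $ 2 * A (rot (rot x)) = 0" by (cases "x $ 2 = 0") auto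
  qed
  then have "R2.psi (\<lambda>x. A (rot (rot x))) = 0"
    by (simp add: R2.psi_mult R2.psi_coord tform_coord A'')
  then have 3: "A (rot (rot x)) = 0" if "rot (rot x) \<in> cone" "x $ 1 \<noteq> 0" for x
    using R2.psi_zero_iff_chart[OF A''] that by (auto simp: rot_rot_cone[symmetric])
  show "\<forall>x\<in>cone. A x = 0"
  proof
    fix x assume x: "x \<in> cone"
    then have "x \<noteq> 0" by (simp add: cone_def)
    then consider "x $ 1 \<noteq> 0" | "x $ 2 \<noteq> 0" | "x $ 3 \<noteq> 0" by (auto simp: vec3_eq_iff)
    then show "A x = 0"
      using 1[of x] 2[of "rot (rot x)"] 3[of "rot x"] x by cases auto
  qed
qed

text \<open>Irreducibility of the curve: \<open>psi\<close> is multiplicative with values in an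
  integral domain.\<close>

lemma cone_integral:
  assumes "tform A" "tform B" and "\<And>x. x \<in> cone \<Longrightarrow> A x * B x = 0"
  shows "(\<forall>x\<in>cone. A x = 0) \<or> (\<forall>x\<in>cone. B x = 0)"
  using psi_zero_iff[OF tform_mult[OF assms(1,2)]] assms(3) psi_mult[OF assms(1,2)]
    psi_zero_iff[OF assms(1)] psi_zero_iff[OF assms(2)] by auto

text \<open>The degrees of the two cofactors are not compared beforehand. If they differ, the
  difference is not a form, but then homogeneity under all scalars already forces both products to
  vanish on the curve.\<close>

lemma cone_cancel:
  assumes A: "tform A" "\<exists>x\<in>cone. A x \<noteq> 0" and B: "tform B" "tform B'"
    and eq: "\<And>x. x \<in> cone \<Longrightarrow> A x * B x = A x * B' x" and x: "x \<in> cone"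
  shows "B x = B' x"
proof -
  obtain d e1 e2 where d: "ternary_form d A" and e1: "ternary_form e1 B" and e2: "ternary_form e2 B'"
    using A B by (auto simp: tform_def)
  show ?thesis
  proof (cases "e1 = e2")
    case True
    have "tform (\<lambda>x. B x - B' x)" using ternary_form_diff e1 e2 True tformI by blast
    from cone_integral[OF A(1) this] show ?thesis using A(2) eq x by (auto simp: right_diff_distrib)
  next
    case False
    have 0: "A x * B x = 0" if x: "x \<in> cone" for x
    proof (rule ccontr)
      assume nz: "A x * B x \<noteq> 0"
      have "k ^ (d + e1) = k ^ (d + e2)" if "k \<noteq> 0" for k :: 'k
        using eq[of "k *s x"] eq[OF x] nz x cone_scale[OF that]
        by (simp add: ternary_form_homogeneous[OF d] ternary_form_homogeneous[OF e1]
            ternary_form_homogeneous[OF e2] power_add mult_ac)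
      then have "- {0} \<subseteq> {k :: 'k. poly (Polynomial.monom 1 (d + e1) - Polynomial.monom 1 (d + e2)) k = 0}"
        by (auto simp: poly_monom)
      moreover have "infinite (- {0::'k})"
        using infinite_UNIV_alg_closed[where 'a = 'k] by (metis finite_compl finite.emptyI finite_insert)
      ultimately have "Polynomial.monom (1::'k) (d + e1) - Polynomial.monom 1 (d + e2) = 0"
        by (intro poly_eq_0_if_infinite_roots) (rule infinite_super)
      then have "Polynomial.coeff (Polynomial.monom (1::'k) (d + e1)) (d + e1) =
        Polynomial.coeff (Polynomial.monom (1::'k) (d + e2)) (d + e1)" by simp
      then show False using False by simp
    qed
    then show ?thesis
      using cone_integral[OF A(1) B(1)] cone_integral[OF A(1) B(2)] A(2) eq x by auto
  qed
qed

text \<open>Counterpart of \<open>cone_cancel\<close> for functions on the chart, such as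
  polynomials in z, that are not given as forms.\<close>

lemma aff_cancel:
  assumes "expands \<theta> u" "u \<noteq> 0" "expands \<phi> s" "expands \<psi> t"
    and "\<And>y z. aff y z \<Longrightarrow> \<theta> y z * \<phi> y z = \<theta> y z * \<psi> y z" and "aff y z"
  shows "\<phi> y z = \<psi> y z"
proof -
  have "u * s = u * t"
    using expands_unique expands_cong[OF expands_mult[OF assms(1,3)] assms(5)] expands_mult[OF assms(1,4)] by blast
  then have "s = t" using assms(2) by simp
  have m: "expands (\<lambda>y z. poly [:-1:] z * \<psi> y z) (- t)"
    using expands_poly_mult[OF assms(4), of "[:-1:]"] by (simp add: fps_const_minus_1)
  have "expands (\<lambda>y z. \<phi> y z - \<psi> y z) (s + - t)"
    by (rule expands_cong[OF expands_add[OF assms(3) m]]) simp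
  then show ?thesis using \<open>s = t\<close> expands_zero_iff assms(6) by fastforce
qed

text \<open>Brings a function on the chart back to a form by filling up with powers of x_1; the
  degree \<open>D\<close> exceeds every j + k that occurs.\<close>

lemma homogenize:
  assumes "expands \<phi> s"
  obtains A where "tform A" "\<And>y z. aff y z \<Longrightarrow> A (vector [1, y, z]) = \<phi> y z"
proof -
  obtain p where \<phi>: "\<And>y z. aff y z \<Longrightarrow> \<phi> y z = (\<Sum>j<q. poly (p j) z * y ^ j)"
    using assms unfolding expands_def by blast
  define D where "D = q + (\<Sum>j<q. degree (p j))"
  define A where "A = (\<lambda>x :: 'k ^ 3. \<Sum>j<q. \<Sum>k\<le>degree (p j).
    Polynomial.coeff (p j) k * (x $ 1 ^ (D - j - k) * x $ 2 ^ j * x $ 3 ^ k))"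
  have D: "D = (D - j - k) + j + k" if "j < q" "k \<le> degree (p j)" for j k
    using that member_le_sum[of j "{..<q}" "\<lambda>j. degree (p j)"] by (simp add: D_def)
  have "ternary_form D A"
    unfolding A_def by (intro ternary_form_sum ternary_form_cmult ternary_form_monomial)
       (rule D, simp_all)
  moreover have "A (vector [1, y, z]) = \<phi> y z" if "aff y z" for y z
    unfolding \<phi>[OF that] A_def by (simp add: poly_altdef sum_distrib_left sum_distrib_right mult_ac)
  ultimately show ?thesis using that tformI by blast
qed

text \<open>A power of the function \<open>B\<close> is a combination of lower ones over \<open>K[z]\<close>, because there are
  \<open>q + 1\<close> powers in a module of rank \<open>q\<close>; so some nonzero polynomial in \<open>z\<close> is a multiple of \<open>B\<close>.\<close>

lemma norm_multiple:
  assumes B: "tform B" and nzB: "\<exists>x\<in>cone. B x \<noteq> 0"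
  obtains B' d where "tform B'" "d \<noteq> 0"
    "\<And>y z. aff y z \<Longrightarrow> B (vector [1, y, z]) * B' (vector [1, y, z]) = poly d z"
proof -
  define \<phi> where "\<phi> y z = B (vector [1, y, z])" for y z
  have ex: "expands \<phi> (psi B)" unfolding \<phi>_def by (rule expands_form[OF B])
  have s0: "psi B \<noteq> 0" using psi_zero_iff[OF B] nzB by blast
  have pow: "expands (\<lambda>y z. \<phi> y z ^ i) (psi B ^ i)" for i
  proof (induction i)
    case 0 show ?case using expands_poly[of 1] by simp
  next
    case (Suc i) then show ?case using expands_mult[OF ex] by simp
  qed
  then have "\<forall>i. \<exists>P. \<forall>y z. aff y z \<longrightarrow> \<phi> y z ^ i = (\<Sum>j<q. poly (P j) z * y ^ j)"
    unfolding expands_def by blast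
  then obtain P where P: "\<And>i y z. aff y z \<Longrightarrow> \<phi> y z ^ i = (\<Sum>j<q. poly (P i j) z * y ^ j)"
    by metis
  obtain x i1 where i1: "i1 \<le> q" "x i1 \<noteq> 0" and x: "\<And>j. j < q \<Longrightarrow> (\<Sum>i\<le>q. P i j * x i) = 0"
  proof -
    have "\<exists>x. (\<exists>i\<in>{..q}. x i \<noteq> 0) \<and> (\<forall>j\<in>{..<q}. (\<Sum>i\<le>q. P i j * x i) = 0)"
      by (rule homogeneous_system_idom) auto
    then show ?thesis using that by (metis atMost_iff lessThan_iff)
  qed
  \<comment> \<open>Splitting off the lowest term of the relation between the powers of
    \<open>\<phi>\<close> and cancelling \<phi>^i0 leaves x_i0 + \<phi> \<rho> = 0, so that the
    polynomial x_i0 is a multiple of \<open>\<phi>\<close>.\<close>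
  define i0 where "i0 = (LEAST i. x i \<noteq> 0)"
  have i0: "x i0 \<noteq> 0" unfolding i0_def using i1(2) by (rule LeastI)
  have "i0 \<le> i1" unfolding i0_def using i1(2) by (rule Least_le)
  with i1 have i0q: "i0 \<le> q" by simp
  have below: "x i = 0" if "i < i0" for i
    using not_less_Least[of i "\<lambda>i. x i \<noteq> 0"] that by (auto simp: i0_def)
  define \<rho> where "\<rho> y z = (\<Sum>i\<in>{Suc i0..q}. poly (x i) z * \<phi> y z ^ (i - Suc i0))" for y z
  have \<rho>: "expands \<rho> (\<Sum>i\<in>{Suc i0..q}. at_zeta (x i) * psi B ^ (i - Suc i0))"
    unfolding \<rho>_def by (intro expands_sum expands_poly_mult pow)
  have rel: "\<phi> y z ^ i0 * (poly (x i0) z + \<phi> y z * \<rho> y z) = \<phi> y z ^ i0 * 0" if "aff y z" for y z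
  proof -
    have "(\<Sum>i\<le>q. poly (x i) z * \<phi> y z ^ i) = (\<Sum>i\<le>q. \<Sum>j<q. poly (P i j * x i) z * y ^ j)"
      using P[OF that] by (simp add: sum_distrib_left mult_ac)
    also have "\<dots> = (\<Sum>j<q. poly (\<Sum>i\<le>q. P i j * x i) z * y ^ j)"
      by (subst sum.swap) (simp add: poly_sum sum_distrib_right)
    also have "\<dots> = 0" using x by simp
    finally have "0 = (\<Sum>i\<le>q. poly (x i) z * \<phi> y z ^ i)" by simp
    also have "\<dots> = (\<Sum>i\<in>{i0..q}. poly (x i) z * \<phi> y z ^ i)"
      by (rule sum.mono_neutral_right) (auto simp: below not_le)
    also have "{i0..q} = insert i0 {Suc i0..q}" using i0q by auto
    also have "(\<Sum>i\<in>insert i0 {Suc i0..q}. poly (x i) z * \<phi> y z ^ i) =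
      \<phi> y z ^ i0 * (poly (x i0) z + \<phi> y z * \<rho> y z)"
    proof -
      have "poly (x i) z * \<phi> y z ^ i = \<phi> y z ^ i0 * (\<phi> y z * (poly (x i) z * \<phi> y z ^ (i - Suc i0)))"
        if "i \<in> {Suc i0..q}" for i
      proof -
        have "\<phi> y z ^ i = \<phi> y z ^ i0 * (\<phi> y z * \<phi> y z ^ (i - Suc i0))"
          using that by (simp flip: power_add power_Suc)
        then show ?thesis by (simp add: mult_ac)
      qed
      then have "(\<Sum>i\<in>{Suc i0..q}. poly (x i) z * \<phi> y z ^ i) = \<phi> y z ^ i0 * (\<phi> y z * \<rho> y z)"
        unfolding \<rho>_def sum_distrib_left by (rule sum.cong[OF refl])
      then show ?thesis by (simp add: distrib_left mult_ac)
    qed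
    finally show ?thesis by simp
  qed
  have "poly (x i0) z + \<phi> y z * \<rho> y z = 0" if "aff y z" for y z
    by (rule aff_cancel[OF pow[of i0] _ expands_add[OF expands_poly expands_mult[OF ex \<rho>]] _ rel that, of "at_zeta 0"])
       (use s0 expands_poly[of 0] in auto)
  moreover obtain B' where "tform B'" "\<And>y z. aff y z \<Longrightarrow> B' (vector [1, y, z]) = \<rho> y z"
    using homogenize[OF \<rho>] by blast
  ultimately show ?thesis using i0 that[of B' "- x i0"]
    by (auto simp: \<phi>_def eq_neg_iff_add_eq_0 add.commute)
qed

end

section \<open>Local parameters\<close>

context klein_curve
begin

text \<open>Says with forms that the local ring at \<open>p\<close> is a discrete valuation ring:
  every form that is nonzero on the curve is T^n up to a quotient U / W of forms nonvanishing at
  \<open>p\<close>. With a linear form \<open>T\<close> no denominator has to be chosen yet.\<close>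

definition local_parameter :: "'k ^ 3 \<Rightarrow> ('k ^ 3 \<Rightarrow> 'k) \<Rightarrow> bool" where
  "local_parameter p T \<longleftrightarrow> ternary_form 1 T \<and> T p = 0 \<and> (\<exists>x\<in>cone. T x \<noteq> 0) \<and>
    (\<forall>A. tform A \<longrightarrow> (\<exists>x\<in>cone. A x \<noteq> 0) \<longrightarrow>
      (\<exists>n U W. tform U \<and> tform W \<and> U p \<noteq> 0 \<and> W p \<noteq> 0 \<and> (\<forall>x\<in>cone. A x * W x = T x ^ n * U x)))"

text \<open>Taylor expansion at (1:y0:z0). As q is a power of the characteristic, Y^q = x_2^q - y0^q
  x_1^q, so everything beyond the value at the point splits into a multiple of Y and one of Z. The
  coefficients are arbitrary because the second form of the pencil is expanded as well.\<close>

lemma curve_expansion: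
  fixes x :: "'k ^ 3" and y0 z0 a' b' c' :: 'k
  defines "Y \<equiv> x $ 2 - y0 * x $ 1" and "Z \<equiv> x $ 3 - z0 * x $ 1"
  shows "a' * x $ 1 * x $ 2 ^ q + b' * x $ 2 * x $ 3 ^ q + c' * x $ 3 * x $ 1 ^ q =
    (a' * y0 ^ q + b' * y0 * z0 ^ q + c' * z0) * x $ 1 ^ Suc q
    + Y * (a' * x $ 1 * Y ^ (q - 1) + b' * x $ 3 ^ q)
    + Z * (b' * y0 * x $ 1 * Z ^ (q - 1) + c' * x $ 1 ^ q)"
proof -
  have p: "w * w ^ (q - 1) = w ^ q" for w :: 'k using q_pos by (simp flip: power_Suc)
  have Y: "Y * Y ^ (q - 1) = x $ 2 ^ q - y0 ^ q * x $ 1 ^ q"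
    unfolding p by (simp add: Y_def frob_diff power_mult_distrib)
  have Z: "Z * Z ^ (q - 1) = x $ 3 ^ q - z0 ^ q * x $ 1 ^ q"
    unfolding p by (simp add: Z_def frob_diff power_mult_distrib)
  have 1: "Y * (a' * x $ 1 * Y ^ (q - 1) + b' * x $ 3 ^ q) = a' * x $ 1 * (Y * Y ^ (q - 1)) + b' * Y * x $ 3 ^ q"
    by (simp add: algebra_simps)
  have 2: "Z * (b' * y0 * x $ 1 * Z ^ (q - 1) + c' * x $ 1 ^ q) = b' * y0 * x $ 1 * (Z * Z ^ (q - 1)) + c' * Z * x $ 1 ^ q"
    by (simp add: algebra_simps)
  show ?thesis unfolding 1 2 Y Z by (simp add: Y_def Z_def algebra_simps)
qed

text \<open>Modulo Y and Z a form is its value at the point times a power of x_1. The extra factor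
  x_1 keeps the cofactors in degree d instead of d - 1, which would fail for constants.\<close>

lemma form_generated_at:
  fixes y0 z0 :: 'k
  assumes "ternary_form d A"
  shows "\<exists>A1 A2. ternary_form d A1 \<and> ternary_form d A2 \<and>
    (\<forall>x. x $ 1 * A x = x $ 1 ^ Suc d * A (vector [1, y0, z0])
      + (x $ 2 - y0 * x $ 1) * A1 x + (x $ 3 - z0 * x $ 1) * A2 x)"
  using assms
proof (induction rule: ternary_form.induct)
  case (const k)
  show ?case by (intro exI[of _ "\<lambda>x. 0"]) (auto intro: ternary_form_zero)
next
  case (add d A B)
  then obtain A1 A2 B1 B2 where "ternary_form d A1" "ternary_form d A2" "ternary_form d B1" "ternary_form d B2"
    and "\<forall>x. x $ 1 * A x = x $ 1 ^ Suc d * A (vector [1, y0, z0])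
      + (x $ 2 - y0 * x $ 1) * A1 x + (x $ 3 - z0 * x $ 1) * A2 x"
    and "\<forall>x. x $ 1 * B x = x $ 1 ^ Suc d * B (vector [1, y0, z0])
      + (x $ 2 - y0 * x $ 1) * B1 x + (x $ 3 - z0 * x $ 1) * B2 x" by blast
  then show ?case
    by (intro exI[of _ "\<lambda>x. A1 x + B1 x"] exI[of _ "\<lambda>x. A2 x + B2 x"])
       (auto intro!: ternary_form.add simp: distrib_left)
next
  case (coord d A i)
  let ?p = "vector [1, y0, z0] :: 'k ^ 3"
  from coord.IH obtain A1 A2 where A: "ternary_form d A1" "ternary_form d A2"
    and eq: "\<And>x. x $ 1 * A x = x $ 1 ^ Suc d * A ?p
      + (x $ 2 - y0 * x $ 1) * A1 x + (x $ 3 - z0 * x $ 1) * A2 x" by blast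
  \<comment> \<open>From x_i = p_i x_1 + (x_i - p_i x_1): the bracket is 0, Y or Z for i = 1, 2,
    3.\<close>
  define k2 k3 :: 'k where "k2 = (if i = 2 then A ?p else 0)" and "k3 = (if i = 3 then A ?p else 0)"
  have pw: "ternary_form (Suc d) (\<lambda>x. k * x $ 1 ^ Suc d)" for k :: 'k
    using ternary_form_cmult[OF ternary_form_power[OF ternary_form_coord[of 1], of "Suc d"]] by simp
  have "ternary_form (Suc d) (\<lambda>x. k2 * x $ 1 ^ Suc d + x $ i * A1 x)"
    "ternary_form (Suc d) (\<lambda>x. k3 * x $ 1 ^ Suc d + x $ i * A2 x)"
    using A by (intro ternary_form.add ternary_form.coord pw; simp)+
  moreover have "x $ 1 * (x $ i * A x) = x $ 1 ^ Suc (Suc d) * (?p $ i * A ?p)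
      + (x $ 2 - y0 * x $ 1) * (k2 * x $ 1 ^ Suc d + x $ i * A1 x)
      + (x $ 3 - z0 * x $ 1) * (k3 * x $ 1 ^ Suc d + x $ i * A2 x)" for x
  proof -
    have "x $ 1 * (x $ i * A x) = x $ i * (x $ 1 ^ Suc d * A ?p
      + (x $ 2 - y0 * x $ 1) * A1 x + (x $ 3 - z0 * x $ 1) * A2 x)"
      using eq[of x] by (metis mult.left_commute)
    then show ?thesis using exhaust_3[of i]
      by (elim disjE) (simp_all add: k2_def k3_def algebra_simps)
  qed
  ultimately show ?case by blast
qed

lemma linear_form_nz: "\<exists>x\<in>cone. x $ 2 - y0 * x $ 1 \<noteq> 0"
proof -
  have t: "tform (\<lambda>x :: 'k ^ 3. - y0 * x $ 1)" by (intro tform_intros)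
  have t': "tform (\<lambda>x :: 'k ^ 3. x $ 2 + - y0 * x $ 1)"
    using ternary_form.add[OF ternary_form_coord[of 2] ternary_form_cmult[OF ternary_form_coord[of 1]]] tformI by blast
  have "psi (\<lambda>x. x $ 2 + - y0 * x $ 1) = fps_X + fps_const (- y0)"
    by (subst psi_add[OF tform_coord t], subst psi_mult[OF tform_const tform_coord]) (simp only: psi_coord psi_const mult_1_right)
  moreover have "fps_nth (fps_X + fps_const (- y0)) 1 \<noteq> 0" by simp
  ultimately have "psi (\<lambda>x. x $ 2 + - y0 * x $ 1) \<noteq> 0" by (metis fps_zero_nth)
  then show ?thesis using psi_zero_iff[OF t'] by auto
qed

text \<open>The chart is smooth, since the z-derivative of the equation is c \<noteq> 0; so Z is
  locally a multiple of Y. Its exact order r is 1 for z0 \<noteq> 0, where the cofactor takes the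
  value - b z0^q, and q at (1:0:0). The last clause forgets the exact order but controls the
  degrees.\<close>

lemma local_equation:
  assumes "aff y0 z0"
  defines "p \<equiv> vector [1, y0, z0] :: 'k ^ 3"
  obtains r G V where "r > 0" "tform G" "tform V" "G p \<noteq> 0" "V p \<noteq> 0"
    "\<And>x. x \<in> cone \<Longrightarrow> (x $ 3 - z0 * x $ 1) * V x = (x $ 2 - y0 * x $ 1) ^ r * G x"
    and "\<exists>V G. ternary_form q V \<and> ternary_form q G \<and> V p \<noteq> 0 \<and>
      (\<forall>x\<in>cone. (x $ 3 - z0 * x $ 1) * V x = (x $ 2 - y0 * x $ 1) * G x)"
proof -
  define Y Z where "Y x = x $ 2 - y0 * x $ 1" and "Z x = x $ 3 - z0 * x $ 1" for x :: "'k ^ 3"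
  have Yf: "ternary_form 1 Y" and Zf: "ternary_form 1 Z"
    unfolding Y_def Z_def by (intro ternary_form_diff ternary_form_cmult ternary_form_coord)+
  define V where "V x = b * y0 * x $ 1 * Z x ^ (q - 1) + c * x $ 1 ^ q" for x
  define G where "G x = - (a * x $ 1 * Y x ^ (q - 1) + b * x $ 3 ^ q)" for x
  have e: "ternary_form q (\<lambda>x. k * x $ 1 * S x ^ (q - 1))" if "ternary_form 1 S" for S and k :: 'k
    using ternary_form_mult[OF ternary_form_cmult[OF ternary_form_coord[of 1], of k] ternary_form_power[OF that, of "q - 1"]] q_pos
    by simp
  have f: "ternary_form q (\<lambda>x :: 'k ^ 3. k * x $ i ^ q)" for k :: 'k and i
    using ternary_form_cmult[OF ternary_form_power[OF ternary_form_coord[of i], of q], of k] by simp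
  have Vf: "ternary_form q V" unfolding V_def by (intro ternary_form.add e f Zf)
  have Gf: "ternary_form q G" unfolding G_def by (intro ternary_form_minus ternary_form.add e f Yf)
  have "Y p = 0" "Z p = 0" by (simp_all add: Y_def Z_def p_def)
  then have Vp: "V p \<noteq> 0" and Gp: "G p = - b * z0 ^ q"
    using nz q_gt_2 by (simp_all add: V_def G_def p_def zero_power)
  have rel: "Z x * V x = Y x * G x" if "x \<in> cone" for x
  proof -
    have "0 = (a * y0 ^ q + b * y0 * z0 ^ q + c * z0) * x $ 1 ^ Suc q
      + Y x * (a * x $ 1 * Y x ^ (q - 1) + b * x $ 3 ^ q) + Z x * V x"
      using that curve_expansion[of a x b c y0 z0] by (simp add: cone_def Y_def Z_def V_def)
    also have "a * y0 ^ q + b * y0 * z0 ^ q + c * z0 = 0" using assms(1) by (simp add: aff_def)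
    finally have "Y x * (a * x $ 1 * Y x ^ (q - 1) + b * x $ 3 ^ q) + Z x * V x = 0" by simp
    then have "Z x * V x = - (Y x * (a * x $ 1 * Y x ^ (q - 1) + b * x $ 3 ^ q))"
      by (simp only: add_eq_0_iff)
    then show ?thesis unfolding G_def by (simp only: mult_minus_right)
  qed
  have rel': "\<exists>V G. ternary_form q V \<and> ternary_form q G \<and> V p \<noteq> 0 \<and>
      (\<forall>x\<in>cone. (x $ 3 - z0 * x $ 1) * V x = (x $ 2 - y0 * x $ 1) * G x)"
    using Vf Gf Vp rel unfolding Y_def Z_def by blast
  show ?thesis
  proof (cases "z0 = 0")
    case False
    then have "G p \<noteq> 0" using Gp nz by simp
    then show ?thesis using that[of 1 G V] tformI[OF Gf] tformI[OF Vf] Vp rel rel' by (simp add: Y_def Z_def)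
  next
    case True
    then have y0: "y0 = 0" using assms(1) aff_0 by simp
    have Zx: "Z x = x $ 3" and Yx: "Y x = x $ 2" for x by (simp_all add: Y_def Z_def True y0)
    have p: "w * w ^ (q - 1) = w ^ q" for w :: 'k using q_pos by (simp flip: power_Suc)
    \<comment> \<open>At the vertex the curve equation reads x_3 (c x_1^q + b x_2 x_3^(q-1)) = - a
      x_1 x_2^q, and the bracket is a unit there.\<close>
    define V' where "V' x = V x + b * (x $ 2 * x $ 3 ^ (q - 1))" for x
    have "ternary_form q (\<lambda>x. b * (x $ 2 * x $ 3 ^ (q - 1)))"
      using ternary_form_cmult[OF ternary_form_mult[OF ternary_form_coord[of 2]
        ternary_form_power[OF ternary_form_coord[of 3], of "q - 1"]], of b] q_pos by simp
    then have V'f: "tform V'" unfolding V'_def using ternary_form.add[OF Vf] tformI by blast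
    have V'p: "V' p \<noteq> 0" using Vp by (simp add: V'_def p_def y0)
    have "x $ 3 * V' x = x $ 2 ^ q * (- a * x $ 1)" if "x \<in> cone" for x
    proof -
      have "x $ 3 * V' x = Y x * G x + b * x $ 2 * (x $ 3 * x $ 3 ^ (q - 1))"
        using rel[OF that] by (simp add: V'_def Zx algebra_simps)
      also have "\<dots> = - a * x $ 1 * (x $ 2 * x $ 2 ^ (q - 1)) + b * x $ 2 * (x $ 3 * x $ 3 ^ (q - 1) - x $ 3 ^ q)"
        by (simp add: G_def Yx algebra_simps)
      also have "\<dots> = - a * x $ 1 * (x $ 2 * x $ 2 ^ (q - 1))"
        unfolding p by simp
      also have "\<dots> = x $ 2 ^ q * (- a * x $ 1)"
        by (subst p) (simp only: mult.commute)
      finally show ?thesis .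
    qed
    moreover have "tform (\<lambda>x :: 'k ^ 3. - a * x $ 1)" by (intro tform_intros)
    ultimately show ?thesis
      using that[of q "\<lambda>x. - a * x $ 1" V'] V'f V'p nz q_pos rel'
      by (simp add: True y0 p_def)
  qed
qed

text \<open>A form vanishing at the point lies locally in the ideal of Y and Z, which
  \<open>local_equation\<close> makes the ideal of Y.\<close>

lemma divide_local:
  assumes "aff y0 z0" and A: "tform A" "A (vector [1, y0, z0]) = 0"
  obtains U W where "tform U" "tform W" "W (vector [1, y0, z0]) \<noteq> 0"
    "\<And>x. x \<in> cone \<Longrightarrow> A x * W x = (x $ 2 - y0 * x $ 1) * U x"
proof -
  obtain d where d: "ternary_form d A" using A by (auto simp: tform_def)
  obtain A1 A2 where A12: "ternary_form d A1" "ternary_form d A2"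
    and eq: "\<And>x. x $ 1 * A x = (x $ 2 - y0 * x $ 1) * A1 x + (x $ 3 - z0 * x $ 1) * A2 x"
    using form_generated_at[OF d, of y0 z0] A(2) by auto
  obtain V G where VG: "ternary_form q V" "ternary_form q G" "V (vector [1, y0, z0]) \<noteq> 0"
    and rel: "\<And>x. x \<in> cone \<Longrightarrow> (x $ 3 - z0 * x $ 1) * V x = (x $ 2 - y0 * x $ 1) * G x"
    using local_equation[OF assms(1)] by metis
  have "tform (\<lambda>x. A1 x * V x + A2 x * G x)"
    using ternary_form.add[OF ternary_form_mult[OF A12(1) VG(1)] ternary_form_mult[OF A12(2) VG(2)]] tformI by blast
  moreover have "tform (\<lambda>x. x $ 1 * V x)" using VG(1) by (intro tform_intros) (auto intro: tformI)
  moreover have "A x * (x $ 1 * V x) = (x $ 2 - y0 * x $ 1) * (A1 x * V x + A2 x * G x)" if "x \<in> cone" for x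
  proof -
    have "A x * (x $ 1 * V x) = (x $ 2 - y0 * x $ 1) * A1 x * V x + A2 x * ((x $ 3 - z0 * x $ 1) * V x)"
    proof -
      have "A x * (x $ 1 * V x) = (x $ 1 * A x) * V x" by (simp add: mult_ac)
      then show ?thesis unfolding eq by (simp add: algebra_simps)
    qed
    then show ?thesis unfolding rel[OF that] by (simp add: algebra_simps)
  qed
  moreover have "(vector [1, y0, z0] :: 'k ^ 3) $ 1 * V (vector [1, y0, z0]) \<noteq> 0" using VG(3) by simp
  ultimately show ?thesis using that by blast
qed

text \<open>If no power of Y were exact, \<open>A\<close> would be divisible by all of them. But
  \<open>A\<close> divides a nonzero polynomial d(z), whose order at the point is finite: it is r k
  for a zero of order k at z0, z - z0 having order r.\<close>

lemma local_parameter_chart: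
  assumes aff: "aff y0 z0"
  shows "local_parameter (vector [1, y0, z0]) (\<lambda>x. x $ 2 - y0 * x $ 1)"
  unfolding local_parameter_def
proof (intro conjI allI impI)
  let ?p = "vector [1, y0, z0] :: 'k ^ 3"
  define Y where "Y x = x $ 2 - y0 * x $ 1" for x :: "'k ^ 3"
  show Y1: "ternary_form 1 (\<lambda>x :: 'k ^ 3. x $ 2 - y0 * x $ 1)"
    by (intro ternary_form_diff ternary_form_cmult ternary_form_coord)
  show "\<exists>x\<in>cone. x $ 2 - y0 * x $ 1 \<noteq> 0" by (rule linear_form_nz)
  show "?p $ 2 - y0 * ?p $ 1 = 0" by simp
  fix A assume A: "tform A" "\<exists>x\<in>cone. A x \<noteq> 0"
  have Yt: "tform Y" using Y1 tformI unfolding Y_def by blast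
  have Ynz: "\<exists>x\<in>cone. Y x \<noteq> 0" unfolding Y_def by (rule linear_form_nz)
  let ?goal = "\<exists>n U W. tform U \<and> tform W \<and> U ?p \<noteq> 0 \<and> W ?p \<noteq> 0 \<and> (\<forall>x\<in>cone. A x * W x = Y x ^ n * U x)"
  have "?goal"
  proof (rule ccontr)
    assume inf: "\<not> ?goal"
    have all: "\<exists>U W. tform U \<and> tform W \<and> W ?p \<noteq> 0 \<and> (\<forall>x\<in>cone. A x * W x = Y x ^ n * U x)" for n
    proof (induction n)
      case 0 show ?case using A by (intro exI[of _ A] exI[of _ "\<lambda>x. 1"]) (auto intro: tform_const)
    next
      case (Suc n)
      then obtain U W where UW: "tform U" "tform W" "W ?p \<noteq> 0" "\<And>x. x \<in> cone \<Longrightarrow> A x * W x = Y x ^ n * U x" by blast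
      then have "U ?p = 0" using inf by blast
      obtain U' W' where UW': "tform U'" "tform W'" "W' ?p \<noteq> 0" "\<And>x. x \<in> cone \<Longrightarrow> U x * W' x = Y x * U' x"
        using divide_local[OF aff UW(1) \<open>U ?p = 0\<close>] unfolding Y_def by metis
      have "A x * (W x * W' x) = Y x ^ Suc n * U' x" if "x \<in> cone" for x
      proof -
        have "A x * (W x * W' x) = (A x * W x) * W' x" by (simp add: mult_ac)
        also have "\<dots> = Y x ^ n * (U x * W' x)" unfolding UW(4)[OF that] by (simp add: mult_ac)
        finally show ?thesis unfolding UW'(4)[OF that] by (simp add: mult_ac)
      qed
      then show ?case using UW UW'
        by (intro exI[of _ U'] exI[of _ "\<lambda>x. W x * W' x"]) (auto intro: tform_mult)
    qed
    obtain B' d where B': "tform B'" "d \<noteq> 0"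
      "\<And>y z. aff y z \<Longrightarrow> A (vector [1, y, z]) * B' (vector [1, y, z]) = poly d z"
      using norm_multiple[OF A] by metis
    obtain e' where d: "d = [:- z0, 1:] ^ Polynomial.order z0 d * e'" and e': "\<not> [:- z0, 1:] dvd e'"
      using order_decomp[OF B'(2)] by blast
    then have e'0: "poly e' z0 \<noteq> 0" by (simp add: poly_eq_0_iff_dvd)
    define k where "k = Polynomial.order z0 d"
    have dz: "poly d z = (z - z0) ^ k * poly e' z" for z
      by (subst d) (simp add: k_def poly_power)
    obtain r G V where G: "r > 0" "tform G" "tform V" "G ?p \<noteq> 0" "V ?p \<noteq> 0"
      and rel: "\<And>x. x \<in> cone \<Longrightarrow> (x $ 3 - z0 * x $ 1) * V x = Y x ^ r * G x"
      unfolding Y_def using local_equation[OF aff] by metis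
    \<comment> \<open>One factor Y more than the order r k of d(z) gives the contradiction.\<close>
    obtain U W where UW: "tform U" "tform W" "W ?p \<noteq> 0" "\<And>x. x \<in> cone \<Longrightarrow> A x * W x = Y x ^ (r * k + 1) * U x"
      using all[of "r * k + 1"] by blast
    let ?x = "\<lambda>y z. vector [1, y, z] :: 'k ^ 3"
    have L: "expands (\<lambda>y z. Y (?x y z) * (U (?x y z) * B' (?x y z) * V (?x y z) ^ k))
       (psi (\<lambda>x. Y x * (U x * B' x * V x ^ k)))"
      by (rule expands_form) (intro tform_intros Yt UW B' G)
    have R: "expands (\<lambda>y z. poly e' z * (G (?x y z) ^ k * W (?x y z)))
       (at_zeta e' * psi (\<lambda>x. G x ^ k * W x))"
      by (intro expands_poly_mult) (rule expands_form, intro tform_intros G UW)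
    have T: "expands (\<lambda>y z. Y (?x y z) ^ (r * k)) (psi (\<lambda>x. Y x ^ (r * k)))"
      by (rule expands_form) (intro tform_intros Yt)
    have T0: "psi (\<lambda>x. Y x ^ (r * k)) \<noteq> 0"
      using psi_zero_iff[OF Yt] Ynz by (simp add: psi_power[OF Yt])
    have "Y ?p * (U ?p * B' ?p * V ?p ^ k) = poly e' z0 * (G ?p ^ k * W ?p)"
    proof (rule aff_cancel[OF T T0 L R _ aff])
      fix y z assume yz: "aff y z"
      then have x: "?x y z \<in> cone" by (simp add: cone_chart)
      have "Y (?x y z) ^ (r * k) * (Y (?x y z) * (U (?x y z) * B' (?x y z) * V (?x y z) ^ k))
        = (Y (?x y z) ^ (r * k + 1) * U (?x y z)) * B' (?x y z) * V (?x y z) ^ k" by (simp add: mult_ac)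
      also have "\<dots> = (A (?x y z) * B' (?x y z)) * W (?x y z) * V (?x y z) ^ k"
        unfolding UW(4)[OF x, symmetric] by (simp add: mult_ac)
      also have "\<dots> = ((z - z0) * V (?x y z)) ^ k * poly e' z * W (?x y z)"
        unfolding B'(3)[OF yz] dz by (simp add: power_mult_distrib mult_ac)
      also have "(z - z0) * V (?x y z) = Y (?x y z) ^ r * G (?x y z)" using rel[OF x] by simp
      finally show "Y (?x y z) ^ (r * k) * (Y (?x y z) * (U (?x y z) * B' (?x y z) * V (?x y z) ^ k)) =
        Y (?x y z) ^ (r * k) * (poly e' z * (G (?x y z) ^ k * W (?x y z)))"
        by (simp add: power_mult_distrib mult_ac flip: power_mult)
    qed
    moreover have "Y ?p = 0" by (simp add: Y_def)
    ultimately show False using e'0 G UW by simp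
  qed
  then show "\<exists>n U W. tform U \<and> tform W \<and> U ?p \<noteq> 0 \<and> W ?p \<noteq> 0 \<and>
      (\<forall>x\<in>cone. A x * W x = (x $ 2 - y0 * x $ 1) ^ n * U x)"
    unfolding Y_def .
qed

lemma local_parameter_scale:
  assumes "local_parameter p T" "k \<noteq> 0"
  shows "local_parameter (k *s p) T"
proof -
  have "T (k *s p) = 0" using assms tform_scale_nz[of T k p] tformI by (auto simp: local_parameter_def)
  then show ?thesis using assms tform_scale_nz[OF _ assms(2), of _ p]
    unfolding local_parameter_def by metis
qed

lemma local_parameter_exists_chart:
  assumes "p \<in> cone" "p $ 1 \<noteq> 0"
  shows "\<exists>T. local_parameter p T"
proof -
  obtain y z where aff: "aff y z" and p: "p = p $ 1 *s vector [1, y, z]" using cone_chartE[OF assms] .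
  show ?thesis
    by (subst p) (rule exI, rule local_parameter_scale[OF local_parameter_chart[OF aff] assms(2)])
qed

lemma local_parameter_rot:
  assumes "klein_curve.local_parameter q b c a p T"
  shows "local_parameter (rot p) (\<lambda>x. T (rot (rot x)))"
proof -
  interpret R: klein_curve q e b c a by (rule rotate)
  have c: "rot (rot x) \<in> R.cone \<longleftrightarrow> x \<in> cone" for x using rot_cone[of "rot (rot x)"] by simp
  from assms have T: "ternary_form 1 T" "T p = 0" "\<exists>x\<in>R.cone. T x \<noteq> 0"
    and main: "\<And>A. tform A \<Longrightarrow> (\<exists>x\<in>R.cone. A x \<noteq> 0) \<Longrightarrow>
      (\<exists>n U W. tform U \<and> tform W \<and> U p \<noteq> 0 \<and> W p \<noteq> 0 \<and> (\<forall>x\<in>R.cone. A x * W x = T x ^ n * U x))"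
    unfolding R.local_parameter_def by blast+
  show ?thesis unfolding local_parameter_def
  proof (intro conjI allI impI)
    show "ternary_form 1 (\<lambda>x. T (rot (rot x)))" by (intro ternary_form_rot T)
    show "T (rot (rot (rot p))) = 0" using T by simp
    show "\<exists>x\<in>cone. T (rot (rot x)) \<noteq> 0" using T(3) rot_cone by (metis rot_rot_rot)
    fix A assume A: "tform A" "\<exists>x\<in>cone. A x \<noteq> 0"
    then have "\<exists>x\<in>R.cone. A (rot x) \<noteq> 0" using c by (metis rot_rot_rot)
    from main[OF tform_rot[OF A(1)] this] obtain n U W where
      "tform U" "tform W" "U p \<noteq> 0" "W p \<noteq> 0" and eq: "\<And>x. x \<in> R.cone \<Longrightarrow> A (rot x) * W x = T x ^ n * U x" by blast
    then show "\<exists>n U W. tform U \<and> tform W \<and> U (rot p) \<noteq> 0 \<and> W (rot p) \<noteq> 0 \<and>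
      (\<forall>x\<in>cone. A x * W x = T (rot (rot x)) ^ n * U x)"
      using c eq[of "rot (rot _)"]
      by (intro exI[of _ n] exI[of _ "\<lambda>x. U (rot (rot x))"] exI[of _ "\<lambda>x. W (rot (rot x))"])
         (auto intro: tform_rot)
  qed
qed

lemma local_parameter_exists:
  assumes "p \<in> cone"
  shows "\<exists>T. local_parameter p T"
proof -
  interpret R: klein_curve q e b c a by (rule rotate)
  interpret R2: klein_curve q e c a b by (rule R.rotate)
  have "p \<noteq> 0" using assms by (simp add: cone_def)
  then consider "p $ 1 \<noteq> 0" | "p $ 2 \<noteq> 0" | "p $ 3 \<noteq> 0" by (auto simp: vec3_eq_iff)
  then show ?thesis
  proof cases
    case 1 then show ?thesis using local_parameter_exists_chart assms by blast
  next
    case 2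
    have "rot (rot p) \<in> R.cone" using assms rot_cone[of "rot (rot p)"] by simp
    then obtain T where "R.local_parameter (rot (rot p)) T"
      using R.local_parameter_exists_chart 2 by fastforce
    from local_parameter_rot[OF this] show ?thesis by auto
  next
    case 3
    have "rot p \<in> R2.cone" using assms rot_rot_cone[of "rot p"] by simp
    then obtain T where "R2.local_parameter (rot p) T"
      using R2.local_parameter_exists_chart 3 by fastforce
    from local_parameter_rot[OF R.local_parameter_rot[OF this]] show ?thesis by auto
  qed
qed

end

section \<open>The function field and its valuations\<close>

lemma mem_pt: "x \<in> pt p \<longleftrightarrow> (\<exists>k. k \<noteq> 0 \<and> x = k *s p)"
  by (auto simp: pt_def)

lemma self_mem_pt: "p \<in> pt p"
  unfolding mem_pt by (intro exI[of _ 1]) simp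

context klein_curve
begin

definition curve :: "'k point set" where
  "curve = {pt x | x. x \<in> cone}"

lemma Union_curve: "\<Union>curve = cone"
proof
  show "\<Union>curve \<subseteq> cone" by (auto simp: curve_def mem_pt cone_scale)
  show "cone \<subseteq> \<Union>curve" using self_mem_pt by (auto simp: curve_def)
qed

text \<open>A nonzero common value scales by both powers of k, for infinitely many k.\<close>

lemma form_degree_unique:
  assumes "ternary_form d A" "ternary_form e' B" and eq: "\<And>x. x \<in> cone \<Longrightarrow> A x = B x" and nz: "\<exists>x\<in>cone. A x \<noteq> 0"
  shows "d = e'"
proof (rule ccontr)
  assume ne: "d \<noteq> e'"
  obtain x where x: "x \<in> cone" "A x \<noteq> 0" using nz by blast
  have "k ^ d = k ^ e'" if "k \<noteq> 0" for k :: 'k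
    using eq[of "k *s x"] eq[OF x(1)] x cone_scale[OF that]
    by (simp add: ternary_form_homogeneous[OF assms(1)] ternary_form_homogeneous[OF assms(2)])
  then have "- {0} \<subseteq> {k :: 'k. poly (Polynomial.monom 1 d - Polynomial.monom 1 e') k = 0}"
    by (auto simp: poly_monom)
  moreover have "infinite (- {0::'k})"
    using infinite_UNIV_alg_closed[where 'a = 'k] by (metis finite_compl finite.emptyI finite_insert)
  ultimately have "Polynomial.monom (1::'k) d - Polynomial.monom 1 e' = 0"
    by (intro poly_eq_0_if_infinite_roots) (rule infinite_super)
  then have "Polynomial.coeff (Polynomial.monom (1::'k) d) d = Polynomial.coeff (Polynomial.monom (1::'k) e') d" by simp
  then show False using ne by simp
qed

lemma cone_mult_nz:
  assumes "tform A" "tform B" "\<exists>x\<in>cone. A x \<noteq> 0" "\<exists>x\<in>cone. B x \<noteq> 0"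
  shows "\<exists>x\<in>cone. A x * B x \<noteq> 0"
  using cone_integral[OF assms(1,2)] assms(3,4) by blast

definition fpair :: "('k ^ 3 \<Rightarrow> 'k) \<Rightarrow> ('k ^ 3 \<Rightarrow> 'k) \<Rightarrow> bool" where
  "fpair A B \<longleftrightarrow> (\<exists>d. ternary_form d A \<and> ternary_form d B) \<and> (\<exists>x\<in>cone. B x \<noteq> 0)"

lemma fractions_iff: "(A, B) \<in> fractions UNIV curve \<longleftrightarrow> fpair A B"
  by (auto simp: fractions_def fpair_def Union_curve forms_iff_ternary_form)

lemma fpair_tform: "fpair A B \<Longrightarrow> tform A" "fpair A B \<Longrightarrow> tform B" "fpair A B \<Longrightarrow> \<exists>x\<in>cone. B x \<noteq> 0"
  by (auto simp: fpair_def tform_def)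

lemma fpair_mult:
  assumes "fpair A B" "fpair A' B'"
  shows "fpair (\<lambda>x. A x * A' x) (\<lambda>x. B x * B' x)"
proof -
  have "\<exists>x\<in>cone. B x * B' x \<noteq> 0"
    by (rule cone_mult_nz) (use fpair_tform assms in blast)+
  then show ?thesis using assms ternary_form_mult unfolding fpair_def by blast
qed

lemma fpair_swap: "fpair A B \<Longrightarrow> \<exists>x\<in>cone. A x \<noteq> 0 \<Longrightarrow> fpair B A"
  by (auto simp: fpair_def)

lemma cone_ex: "\<exists>x. x \<in> cone"
  using linear_form_nz by blast

lemma fpair_const: "k \<noteq> 0 \<Longrightarrow> fpair (\<lambda>x. k') (\<lambda>x. k)"
  using cone_ex ternary_form.const by (auto simp: fpair_def)

lemma fpair_power: "fpair A B \<Longrightarrow> fpair (\<lambda>x. A x ^ n) (\<lambda>x. B x ^ n)"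
  by (induction n) (simp_all add: fpair_const fpair_mult)

abbreviation "fr \<equiv> frac curve"
abbreviation "FF \<equiv> function_field curve"

lemma mem_fr: "(A', B') \<in> fr A B \<longleftrightarrow> fpair A' B' \<and> (\<forall>x\<in>cone. A x * B' x = A' x * B x)"
  by (simp add: frac_def Union_curve fractions_iff)

text \<open>Transitivity of cross-multiplication: the denominator in the middle is cancelled by
  irreducibility.\<close>

lemma fr_eq_iff:
  assumes "fpair A B" "fpair A' B'"
  shows "fr A B = fr A' B' \<longleftrightarrow> (\<forall>x\<in>cone. A x * B' x = A' x * B x)"
proof
  assume "fr A B = fr A' B'"
  moreover have "(A', B') \<in> fr A' B'" using assms by (simp add: mem_fr)
  ultimately have "(A', B') \<in> fr A B" by simp
  then show "\<forall>x\<in>cone. A x * B' x = A' x * B x" by (simp add: mem_fr)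
next
  assume eq: "\<forall>x\<in>cone. A x * B' x = A' x * B x"
  have sub: "fr A B \<subseteq> fr A' B'" if f: "fpair A B" "fpair A' B'" and eq: "\<forall>x\<in>cone. A x * B' x = A' x * B x" for A B A' B'
  proof clarify
    fix A2 B2 assume "(A2, B2) \<in> fr A B"
    then have 2: "fpair A2 B2" "\<And>x. x \<in> cone \<Longrightarrow> A x * B2 x = A2 x * B x" by (auto simp: mem_fr)
    have "A' x * B2 x = A2 x * B' x" if "x \<in> cone" for x
    proof (rule cone_cancel[OF fpair_tform(2,3)[OF f(1)] _ _ _ that])
      show "tform (\<lambda>x. A' x * B2 x)" "tform (\<lambda>x. A2 x * B' x)"
        using f 2 fpair_tform by (auto intro: tform_mult)
      show "B x * (A' x * B2 x) = B x * (A2 x * B' x)" if "x \<in> cone" for x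
      proof -
        have "B x * (A' x * B2 x) = (A' x * B x) * B2 x" by (simp add: mult_ac)
        also have "\<dots> = (A x * B2 x) * B' x" using eq that by (simp add: mult_ac flip: eq[rule_format])
        also have "\<dots> = B x * (A2 x * B' x)" using 2(2)[OF that] by (simp add: mult_ac)
        finally show ?thesis .
      qed
    qed
    then show "(A2, B2) \<in> fr A' B'" using 2 by (simp add: mem_fr)
  qed
  show "fr A B = fr A' B'"
    using sub[OF assms eq] sub[OF assms(2,1)] eq by (simp add: subset_antisym)
qed

lemma FF_simps: "carrier FF = {fr A B | A B. fpair A B}" "\<one>\<^bsub>FF\<^esub> = fr (\<lambda>_. 1) (\<lambda>_. 1)"
  "\<zero>\<^bsub>FF\<^esub> = fr (\<lambda>_. 0) (\<lambda>_. 1)"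
  by (simp_all add: function_field_def fractions_iff)

lemma fr_zero_iff: "fpair A B \<Longrightarrow> fr A B = \<zero>\<^bsub>FF\<^esub> \<longleftrightarrow> (\<forall>x\<in>cone. A x = 0)"
  unfolding FF_simps by (subst fr_eq_iff) (auto simp: fpair_const)

text \<open>\<open>function_field\<close> multiplies classes by running over all representatives;
  the content is independence of their choice.\<close>

lemma fr_mult:
  assumes f: "fpair A1 B1" and g: "fpair A2 B2"
  shows "fr A1 B1 \<otimes>\<^bsub>FF\<^esub> fr A2 B2 = fr (\<lambda>x. A1 x * A2 x) (\<lambda>x. B1 x * B2 x)"
proof -
  have "(A, B) \<in> fr A1 B1 \<otimes>\<^bsub>FF\<^esub> fr A2 B2 \<longleftrightarrow> (A, B) \<in> fr (\<lambda>x. A1 x * A2 x) (\<lambda>x. B1 x * B2 x)" for A B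
  proof
    assume "(A, B) \<in> fr A1 B1 \<otimes>\<^bsub>FF\<^esub> fr A2 B2"
    then obtain A1' B1' A2' B2' where AB: "fpair A B" and 1: "(A1', B1') \<in> fr A1 B1" and 2: "(A2', B2') \<in> fr A2 B2"
      and eq: "\<And>x. x \<in> cone \<Longrightarrow> A x * (B1' x * B2' x) = (A1' x * A2' x) * B x"
      by (auto simp: function_field_def fractions_iff Union_curve)
    note 1 = 1[unfolded mem_fr] note 2 = 2[unfolded mem_fr]
    have "fr (\<lambda>x. A1 x * A2 x) (\<lambda>x. B1 x * B2 x) = fr (\<lambda>x. A1' x * A2' x) (\<lambda>x. B1' x * B2' x)"
      using 1 2 by (subst fr_eq_iff[OF fpair_mult[OF f g]]) (auto simp: fpair_mult algebra_simps)
    moreover have "(A, B) \<in> fr (\<lambda>x. A1' x * A2' x) (\<lambda>x. B1' x * B2' x)"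
      unfolding mem_fr using AB eq by simp
    ultimately show "(A, B) \<in> fr (\<lambda>x. A1 x * A2 x) (\<lambda>x. B1 x * B2 x)" by simp
  next
    assume "(A, B) \<in> fr (\<lambda>x. A1 x * A2 x) (\<lambda>x. B1 x * B2 x)"
    then have "fpair A B" "\<forall>x\<in>cone. A x * (B1 x * B2 x) = (A1 x * A2 x) * B x" by (simp_all add: mem_fr)
    moreover have "(A1, B1) \<in> fr A1 B1" "(A2, B2) \<in> fr A2 B2" using f g by (auto simp: mem_fr)
    ultimately show "(A, B) \<in> fr A1 B1 \<otimes>\<^bsub>FF\<^esub> fr A2 B2"
      by (auto simp: function_field_def fractions_iff Union_curve)
  qed
  then show ?thesis by auto
qed

text \<open>The integer powers in \<open>ord_at\<close> go through inverses in this monoid.\<close>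

lemma FF_monoid: "Group.monoid FF"
proof (rule monoidI)
  fix x y z assume "x \<in> carrier FF" "y \<in> carrier FF" "z \<in> carrier FF"
  then obtain A B A' B' A'' B'' where *: "x = fr A B" "fpair A B" "y = fr A' B'" "fpair A' B'" "z = fr A'' B''" "fpair A'' B''"
    by (auto simp: FF_simps)
  show "x \<otimes>\<^bsub>FF\<^esub> y \<in> carrier FF"
    unfolding *(1,3) fr_mult[OF *(2,4)] FF_simps using fpair_mult[OF *(2,4)] by blast
  show "x \<otimes>\<^bsub>FF\<^esub> y \<otimes>\<^bsub>FF\<^esub> z = x \<otimes>\<^bsub>FF\<^esub> (y \<otimes>\<^bsub>FF\<^esub> z)"
    using * by (simp add: fr_mult fpair_mult mult.assoc)
next
  show "\<one>\<^bsub>FF\<^esub> \<in> carrier FF" unfolding FF_simps using fpair_const[OF one_neq_zero] by blast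
  fix x assume "x \<in> carrier FF"
  then obtain A B where "x = fr A B" "fpair A B" by (auto simp: FF_simps)
  then show "\<one>\<^bsub>FF\<^esub> \<otimes>\<^bsub>FF\<^esub> x = x" "x \<otimes>\<^bsub>FF\<^esub> \<one>\<^bsub>FF\<^esub> = x"
    unfolding FF_simps by (simp_all add: fr_mult fpair_const)
qed

lemma fr_power: "fpair A B \<Longrightarrow> fr A B [^]\<^bsub>FF\<^esub> (n::nat) = fr (\<lambda>x. A x ^ n) (\<lambda>x. B x ^ n)"
proof (induction n)
  case 0 show ?case by (simp add: Group.monoid.nat_pow_0[OF FF_monoid] FF_simps)
next
  case (Suc n)
  then show ?case
    by (simp add: Group.monoid.nat_pow_Suc[OF FF_monoid] fr_mult fpair_power mult.commute)
qed

lemma fr_inv: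
  assumes "fpair A B" "fpair B A"
  shows "inv\<^bsub>FF\<^esub> (fr A B) = fr B A"
proof (rule Group.monoid.inv_unique'[OF FF_monoid, symmetric])
  show "fr A B \<in> carrier FF" "fr B A \<in> carrier FF" using assms by (auto simp: FF_simps)
  show "fr A B \<otimes>\<^bsub>FF\<^esub> fr B A = \<one>\<^bsub>FF\<^esub>" "fr B A \<otimes>\<^bsub>FF\<^esub> fr A B = \<one>\<^bsub>FF\<^esub>"
    unfolding FF_simps fr_mult[OF assms] fr_mult[OF assms(2,1)]
      fr_eq_iff[OF fpair_mult[OF assms] fpair_const[OF one_neq_zero]]
      fr_eq_iff[OF fpair_mult[OF assms(2,1)] fpair_const[OF one_neq_zero]]
    by (simp_all add: mult.commute)
qed

lemma fr_int_power:
  assumes "fpair A B" "fpair B A"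
  shows "fr A B [^]\<^bsub>FF\<^esub> (n::int) =
    (if n < 0 then fr (\<lambda>x. B x ^ nat (- n)) (\<lambda>x. A x ^ nat (- n)) else fr (\<lambda>x. A x ^ nat n) (\<lambda>x. B x ^ nat n))"
  unfolding int_pow_def2 fr_power[OF assms(1)] fr_inv[OF fpair_power[OF assms(1)] fpair_power[OF assms(2)]]
  by (rule refl)

lemma value_at_fr:
  assumes "fpair A B" "p \<in> cone" "B p \<noteq> 0"
  shows "value_at (fr A B) (pt p) = A p / B p"
  unfolding value_at_def
proof (rule the_equality)
  obtain d where d: "ternary_form d A" "ternary_form d B" using assms by (auto simp: fpair_def)
  have "\<forall>x\<in>pt p. B x \<noteq> 0 \<and> A x / B x = A p / B p"
    using assms(3) by (auto simp: mem_pt ternary_form_homogeneous[OF d(1)] ternary_form_homogeneous[OF d(2)])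
  then show "\<exists>(A', B')\<in>fr A B. \<forall>x\<in>pt p. B' x \<noteq> 0 \<and> A' x / B' x = A p / B p"
    using assms by (intro bexI[of _ "(A, B)"]) (auto simp: mem_fr)
next
  fix v assume "\<exists>(A', B')\<in>fr A B. \<forall>x\<in>pt p. B' x \<noteq> 0 \<and> A' x / B' x = v"
  then obtain A' B' where "(A', B') \<in> fr A B" and *: "\<forall>x\<in>pt p. B' x \<noteq> 0 \<and> A' x / B' x = v" by blast
  then have "A p * B' p = A' p * B p" using assms by (simp add: mem_fr)
  moreover have "B' p \<noteq> 0" "A' p / B' p = v" using * self_mem_pt by auto
  ultimately show "v = A p / B p" using assms by (auto simp: field_simps)
qed

lemma local_ring_iff:
  assumes "p \<in> cone"
  shows "f \<in> local_ring curve (pt p) \<longleftrightarrow> (\<exists>A B. fpair A B \<and> B p \<noteq> 0 \<and> f = fr A B)"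
proof
  assume "f \<in> local_ring curve (pt p)"
  then obtain A B A' B' where "f = fr A B" "fpair A B" "(A', B') \<in> f" "\<forall>x\<in>pt p. B' x \<noteq> 0"
    by (auto simp: local_ring_def FF_simps)
  moreover have "fr A B = fr A' B'" if "(A', B') \<in> fr A B" "fpair A B"
    using that by (subst fr_eq_iff) (auto simp: mem_fr)
  ultimately show "\<exists>A B. fpair A B \<and> B p \<noteq> 0 \<and> f = fr A B"
    using self_mem_pt[of p] by (intro exI[of _ A'] exI[of _ B']) (auto simp: mem_fr)
next
  assume "\<exists>A B. fpair A B \<and> B p \<noteq> 0 \<and> f = fr A B"
  then obtain A B where AB: "fpair A B" "B p \<noteq> 0" "f = fr A B" by blast
  then have "\<forall>x\<in>pt p. B x \<noteq> 0" using tform_scale_nz[OF fpair_tform(2)[OF AB(1)]] by (auto simp: mem_pt)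
  moreover have "(A, B) \<in> f" using AB by (simp add: mem_fr)
  ultimately show "f \<in> local_ring curve (pt p)" using AB by (auto simp: local_ring_def FF_simps)
qed

lemma max_ideal_iff:
  assumes "p \<in> cone"
  shows "f \<in> max_ideal curve (pt p) \<longleftrightarrow> (\<exists>A B. fpair A B \<and> B p \<noteq> 0 \<and> A p = 0 \<and> f = fr A B)"
  using value_at_fr[OF _ assms] by (force simp: max_ideal_def local_ring_iff[OF assms])

text \<open>Exponents of \<open>T\<close> on both sides of the fraction cover zeros and poles alike
  and make products and inverses immediate; only their difference counts.\<close>

definition has_order :: "('k ^ 3 \<Rightarrow> 'k) \<Rightarrow> 'k ^ 3 \<Rightarrow> 'k ratfun \<Rightarrow> int \<Rightarrow> bool" where
  "has_order T p f n \<longleftrightarrow> (\<exists>U W i j. U p \<noteq> 0 \<and> W p \<noteq> 0 \<and> tform U \<and> tform W \<and>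
     fpair (\<lambda>x. T x ^ i * U x) (\<lambda>x. T x ^ j * W x) \<and>
     f = fr (\<lambda>x. T x ^ i * U x) (\<lambda>x. T x ^ j * W x) \<and> n = int i - int j)"

context
  fixes p T
  assumes p: "p \<in> cone" and T: "local_parameter p T"
begin

lemma T_props: "ternary_form 1 T" "tform T" "T p = 0" "\<exists>x\<in>cone. T x \<noteq> 0" "\<exists>x\<in>cone. T x ^ n \<noteq> 0"
  using T unfolding local_parameter_def by (auto intro: tformI)

lemma T_order:
  assumes "tform A" "\<exists>x\<in>cone. A x \<noteq> 0"
  shows "\<exists>n U W. tform U \<and> tform W \<and> U p \<noteq> 0 \<and> W p \<noteq> 0 \<and> (\<forall>x\<in>cone. A x * W x = T x ^ n * U x)"
  using T assms unfolding local_parameter_def by simp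

lemma has_order_mult:
  assumes "has_order T p f n" "has_order T p g m"
  shows "has_order T p (f \<otimes>\<^bsub>FF\<^esub> g) (n + m)"
proof -
  from assms(1) obtain U W i j where f: "U p \<noteq> 0" "W p \<noteq> 0" "tform U" "tform W"
    "fpair (\<lambda>x. T x ^ i * U x) (\<lambda>x. T x ^ j * W x)" "f = fr (\<lambda>x. T x ^ i * U x) (\<lambda>x. T x ^ j * W x)" "n = int i - int j"
    unfolding has_order_def by blast
  from assms(2) obtain U' W' i' j' where g: "U' p \<noteq> 0" "W' p \<noteq> 0" "tform U'" "tform W'"
    "fpair (\<lambda>x. T x ^ i' * U' x) (\<lambda>x. T x ^ j' * W' x)" "g = fr (\<lambda>x. T x ^ i' * U' x) (\<lambda>x. T x ^ j' * W' x)" "m = int i' - int j'"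
    unfolding has_order_def by blast
  have e: "(\<lambda>x. T x ^ i * U x * (T x ^ i' * U' x)) = (\<lambda>x. T x ^ (i + i') * (U x * U' x))"
    "(\<lambda>x. T x ^ j * W x * (T x ^ j' * W' x)) = (\<lambda>x. T x ^ (j + j') * (W x * W' x))"
    by (auto simp: power_add mult_ac)
  show ?thesis unfolding has_order_def
  proof (intro exI conjI)
    show "fpair (\<lambda>x. T x ^ (i + i') * (U x * U' x)) (\<lambda>x. T x ^ (j + j') * (W x * W' x))"
      using fpair_mult[OF f(5) g(5)] unfolding e .
    show "f \<otimes>\<^bsub>FF\<^esub> g = fr (\<lambda>x. T x ^ (i + i') * (U x * U' x)) (\<lambda>x. T x ^ (j + j') * (W x * W' x))"
      unfolding f(6) g(6) fr_mult[OF f(5) g(5)] e ..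
    show "tform (\<lambda>x. U x * U' x)" "tform (\<lambda>x. W x * W' x)" using f g by (auto intro: tform_mult)
  qed (use f g in auto)
qed

text \<open>Two different exponents of \<open>T\<close> in a cross-multiplied identity would make a
  form that is nonzero at \<open>p\<close> equal to a multiple of \<open>T\<close>.\<close>

lemma has_order_unique:
  assumes "has_order T p f n" "has_order T p f m"
  shows "n = m"
proof -
  from assms(1) obtain U W i j where f: "U p \<noteq> 0" "W p \<noteq> 0" "tform U" "tform W"
    "fpair (\<lambda>x. T x ^ i * U x) (\<lambda>x. T x ^ j * W x)" "f = fr (\<lambda>x. T x ^ i * U x) (\<lambda>x. T x ^ j * W x)" "n = int i - int j"
    unfolding has_order_def by blast
  from assms(2) obtain U' W' i' j' where g: "U' p \<noteq> 0" "W' p \<noteq> 0" "tform U'" "tform W'"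
    "fpair (\<lambda>x. T x ^ i' * U' x) (\<lambda>x. T x ^ j' * W' x)" "f = fr (\<lambda>x. T x ^ i' * U' x) (\<lambda>x. T x ^ j' * W' x)" "m = int i' - int j'"
    unfolding has_order_def by blast
  have eq: "T x ^ (i + j') * (U x * W' x) = T x ^ (i' + j) * (U' x * W x)" if "x \<in> cone" for x
    using f(6) g(6) that unfolding g(6) fr_eq_iff[OF g(5) f(5)] by (simp add: power_add mult_ac)
  have False if "k < l" and eq: "\<And>x. x \<in> cone \<Longrightarrow> T x ^ k * A x = T x ^ l * B x"
    and t: "tform A" "tform B" "A p \<noteq> 0" for k l A B
  proof -
    have "A p = T p ^ (l - k) * B p"
    proof (rule cone_cancel[OF tform_power[OF T_props(2)] T_props(5) t(1) _ _ p])
      show "tform (\<lambda>x. T x ^ (l - k) * B x)" by (intro tform_intros t T_props)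
      show "T x ^ k * A x = T x ^ k * (T x ^ (l - k) * B x)" if "x \<in> cone" for x
        using eq[OF that] \<open>k < l\<close> by (simp flip: mult.assoc power_add)
    qed
    then show False using t T_props(3) \<open>k < l\<close> by (simp add: zero_power)
  qed
  note no = this
  have t: "tform (\<lambda>x. U x * W' x)" "tform (\<lambda>x. U' x * W x)" "U p * W' p \<noteq> 0" "U' p * W p \<noteq> 0"
    using f g by (auto intro: tform_mult)
  have "\<not> i + j' < i' + j" using no[OF _ eq t(1,2,3)] by blast
  moreover have "\<not> i' + j < i + j'" using no[OF _ eq[symmetric] t(2,1,4)] by blast
  ultimately show ?thesis using f(7) g(7) by simp
qed

lemma has_order_exists:
  assumes f: "fpair A B" and nz: "\<exists>x\<in>cone. A x \<noteq> 0"
  shows "\<exists>n. has_order T p (fr A B) n"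
proof -
  from T_order[OF fpair_tform(1)[OF f] nz] obtain n U W
    where A: "tform U" "tform W" "U p \<noteq> 0" "W p \<noteq> 0" and A5: "\<forall>x\<in>cone. A x * W x = T x ^ n * U x"
    by (elim exE conjE)
  from T_order[OF fpair_tform(2)[OF f] fpair_tform(3)[OF f]] obtain m U2 W2
    where B: "tform U2" "tform W2" "U2 p \<noteq> 0" "W2 p \<noteq> 0" and B5: "\<forall>x\<in>cone. B x * W2 x = T x ^ m * U2 x"
    by (elim exE conjE)
  obtain d where d: "ternary_form d A" "ternary_form d B" using f by (auto simp: fpair_def)
  obtain dU dW dV dX where dd: "ternary_form dU U" "ternary_form dW W" "ternary_form dV U2" "ternary_form dX W2"
    using A(1,2) B(1,2) by (auto simp: tform_def)
  have nzAW: "\<exists>x\<in>cone. A x * W x \<noteq> 0"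
    using cone_mult_nz[OF fpair_tform(1)[OF f] A(2) nz] A(4) p by blast
  have nzBX: "\<exists>x\<in>cone. B x * W2 x \<noteq> 0"
    using cone_mult_nz[OF fpair_tform(2)[OF f] B(2) fpair_tform(3)[OF f]] B(4) p by blast
  have tn: "ternary_form k (\<lambda>x. T x ^ k)" for k using ternary_form_power[OF T_props(1), of k] by simp
  have "d + dW = n + dU"
    by (rule form_degree_unique[OF ternary_form_mult[OF d(1) dd(2)] ternary_form_mult[OF tn dd(1)] bspec[OF A5] nzAW])
  moreover have "d + dX = m + dV"
    by (rule form_degree_unique[OF ternary_form_mult[OF d(2) dd(4)] ternary_form_mult[OF tn dd(3)] bspec[OF B5] nzBX])
  \<comment> \<open>The two degree balances make the new numerator and denominator forms of equal
    degree.\<close>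
  ultimately have deg: "n + (dU + dX) = m + (dV + dW)" by simp
  have F: "fpair (\<lambda>x. T x ^ n * (U x * W2 x)) (\<lambda>x. T x ^ m * (U2 x * W x))"
    unfolding fpair_def
  proof
    show "\<exists>d. ternary_form d (\<lambda>x. T x ^ n * (U x * W2 x)) \<and> ternary_form d (\<lambda>x. T x ^ m * (U2 x * W x))"
      using ternary_form_mult[OF tn[of n] ternary_form_mult[OF dd(1,4)]] ternary_form_mult[OF tn[of m] ternary_form_mult[OF dd(3,2)]]
      unfolding deg by blast
    show "\<exists>x\<in>cone. T x ^ m * (U2 x * W x) \<noteq> 0"
    proof (rule cone_mult_nz[OF tform_power[OF T_props(2)] tform_mult[OF B(1) A(2)] T_props(5)])
      show "\<exists>x\<in>cone. U2 x * W x \<noteq> 0" using A B p by (intro bexI[of _ p]) auto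
    qed
  qed
  have "fr A B = fr (\<lambda>x. T x ^ n * (U x * W2 x)) (\<lambda>x. T x ^ m * (U2 x * W x))"
    unfolding fr_eq_iff[OF f F]
  proof
    fix x assume x: "x \<in> cone"
    have "A x * (T x ^ m * (U2 x * W x)) = (T x ^ m * U2 x) * (A x * W x)" by (simp add: mult_ac)
    also have "\<dots> = (B x * W2 x) * (T x ^ n * U x)" using bspec[OF A5 x] bspec[OF B5 x] by simp
    finally show "A x * (T x ^ m * (U2 x * W x)) = T x ^ n * (U x * W2 x) * B x" by (simp add: mult_ac)
  qed
  note eq = this
  have "has_order T p (fr A B) (int n - int m)"
    unfolding has_order_def
  proof (intro exI conjI)
    show "tform (\<lambda>x. U x * W2 x)" "tform (\<lambda>x. U2 x * W x)" using A B by (auto intro: tform_mult)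
    show "U p * W2 p \<noteq> 0" "U2 p * W p \<noteq> 0" using A B by auto
  qed (rule F eq refl)+
  then show ?thesis by blast
qed

lemma has_order_nonneg:
  assumes "has_order T p f n" "n \<ge> 0"
  obtains U W where "U p \<noteq> 0" "W p \<noteq> 0" "tform U" "tform W" "fpair (\<lambda>x. T x ^ nat n * U x) W" "f = fr (\<lambda>x. T x ^ nat n * U x) W"
proof -
  from assms(1) obtain U W i j where f: "U p \<noteq> 0" "W p \<noteq> 0" "tform U" "tform W"
    "fpair (\<lambda>x. T x ^ i * U x) (\<lambda>x. T x ^ j * W x)" "f = fr (\<lambda>x. T x ^ i * U x) (\<lambda>x. T x ^ j * W x)" "n = int i - int j"
    unfolding has_order_def by blast
  have i: "i = nat n + j" using f(7) assms(2) by simp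
  obtain dU dW where dd: "ternary_form dU U" "ternary_form dW W" using f(3,4) by (auto simp: tform_def)
  have tn: "ternary_form k (\<lambda>x. T x ^ k)" for k using ternary_form_power[OF T_props(1), of k] by simp
  have nzW: "\<exists>x\<in>cone. T x ^ j * W x \<noteq> 0" and nzU: "\<exists>x\<in>cone. T x ^ i * U x \<noteq> 0"
    using cone_mult_nz[OF tform_power[OF T_props(2)] f(4) T_props(5)]
      cone_mult_nz[OF tform_power[OF T_props(2)] f(3) T_props(5)] f p by blast+
  obtain d where d: "ternary_form d (\<lambda>x. T x ^ i * U x)" "ternary_form d (\<lambda>x. T x ^ j * W x)"
    using f(5) by (auto simp: fpair_def)
  have "d = i + dU" by (rule form_degree_unique[OF d(1) ternary_form_mult[OF tn dd(1)] refl nzU])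
  moreover have "d = j + dW" by (rule form_degree_unique[OF d(2) ternary_form_mult[OF tn dd(2)] refl nzW])
  ultimately have dW: "dW = nat n + dU" using i by simp
  have F: "fpair (\<lambda>x. T x ^ nat n * U x) W"
    unfolding fpair_def using ternary_form_mult[OF tn[of "nat n"] dd(1)] dd(2) f(2) p unfolding dW by blast
  have "f = fr (\<lambda>x. T x ^ nat n * U x) W"
    unfolding f(6) fr_eq_iff[OF f(5) F] by (simp add: i power_add mult_ac)
  then show ?thesis using that f F by blast
qed

text \<open>Membership in the local ring excludes a pole: for negative order, clearing denominators
  leaves a factor \<open>T\<close> on one side and gives U(p) B(p) = 0.\<close>

lemma has_order_one_iff: "f \<in> local_ring curve (pt p) \<Longrightarrow> has_order T p f n \<Longrightarrow> n \<ge> 0"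
proof (rule ccontr)
  assume f: "f \<in> local_ring curve (pt p)" and o: "has_order T p f n" and n: "\<not> n \<ge> 0"
  obtain A B where AB: "fpair A B" "B p \<noteq> 0" "f = fr A B" using f local_ring_iff[OF p] by blast
  from o obtain U W i j where g: "U p \<noteq> 0" "W p \<noteq> 0" "tform U" "tform W"
    "fpair (\<lambda>x. T x ^ i * U x) (\<lambda>x. T x ^ j * W x)" "f = fr (\<lambda>x. T x ^ i * U x) (\<lambda>x. T x ^ j * W x)" "n = int i - int j"
    unfolding has_order_def by blast
  have ij: "j = i + Suc (j - i - 1)" using n g(7) by simp
  have "U p * B p = A p * (T p ^ Suc (j - i - 1) * W p)"
  proof (rule cone_cancel[OF tform_power[OF T_props(2)] T_props(5) _ _ _ p])
    show "tform (\<lambda>x. U x * B x)" "tform (\<lambda>x. A x * (T x ^ Suc (j - i - 1) * W x))"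
      by (intro tform_intros g T_props fpair_tform[OF AB(1)])+
    fix x assume "x \<in> cone"
    then have "T x ^ i * U x * B x = A x * (T x ^ j * W x)"
      using g(6) unfolding AB(3) using fr_eq_iff[OF AB(1) g(5)] by simp
    also have "T x ^ j = T x ^ i * T x ^ Suc (j - i - 1)" by (subst ij) (rule power_add)
    finally show "T x ^ i * (U x * B x) = T x ^ i * (A x * (T x ^ Suc (j - i - 1) * W x))" by (simp add: mult_ac)
  qed
  then show False using g AB T_props by simp
qed

end

end

section \<open>Uniformizers and the identification of \<open>ord_at\<close>\<close>

context klein_curve
begin

context
  fixes p T
  assumes p: "p \<in> cone" and T: "local_parameter p T"
begin

lemmas Tp = T_props[OF p T]

lemma coord_nz: "\<exists>i. p $ i \<noteq> 0"
  using p by (auto simp: cone_def vec_eq_iff)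

text \<open>A coordinate that is nonzero at \<open>p\<close>; dividing the linear form
  \<open>T\<close> by it gives an element of the function field.\<close>

definition param_coord :: 3 where "param_coord = (SOME i. p $ i \<noteq> 0)"

abbreviation "L \<equiv> (\<lambda>x :: 'k ^ 3. x $ param_coord)"

lemma L_p: "L p \<noteq> 0"
  unfolding param_coord_def using coord_nz by (rule someI_ex)

lemma L_nz: "\<exists>x\<in>cone. L x \<noteq> 0" using L_p p by blast

lemma param_pairs: "fpair T L" "fpair L T"
  unfolding fpair_def using Tp ternary_form_coord[of param_coord] L_nz by auto

abbreviation "param \<equiv> fr T L"

lemma has_order_param: "has_order T p param 1"
  unfolding has_order_def
proof (intro exI conjI)
  show "tform (\<lambda>x. 1)" "tform L" by (rule tform_const tform_coord)+
  show "fpair (\<lambda>x. T x ^ 1 * 1) (\<lambda>x. T x ^ 0 * L x)" using param_pairs by simp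
  show "param = fr (\<lambda>x. T x ^ 1 * 1) (\<lambda>x. T x ^ 0 * L x)" by simp
  show "L p \<noteq> 0" by (rule L_p)
qed simp_all

lemma has_order_nonneg_local:
  assumes "has_order T p f n" "n \<ge> 0"
  shows "f \<in> local_ring curve (pt p)" "f \<in> max_ideal curve (pt p) \<longleftrightarrow> n > 0"
proof -
  obtain U W where UW: "U p \<noteq> 0" "W p \<noteq> 0" "tform U" "tform W"
    and F: "fpair (\<lambda>x. T x ^ nat n * U x) W" and f: "f = fr (\<lambda>x. T x ^ nat n * U x) W"
    by (rule has_order_nonneg[OF p T assms]) (rule that)
  show 1: "f \<in> local_ring curve (pt p)" unfolding local_ring_iff[OF p] using F f UW(2) by blast
  have "value_at f (pt p) = T p ^ nat n * U p / W p" unfolding f by (rule value_at_fr[OF F p UW(2)])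
  then show "f \<in> max_ideal curve (pt p) \<longleftrightarrow> n > 0"
    using 1 UW Tp(3) assms(2) by (auto simp: max_ideal_def zero_power)
qed

lemma carrier_cases:
  assumes "f \<in> carrier FF"
  obtains "f = \<zero>\<^bsub>FF\<^esub>" | n where "f \<noteq> \<zero>\<^bsub>FF\<^esub>" "has_order T p f n"
proof -
  obtain A B where AB: "f = fr A B" "fpair A B" using assms by (auto simp: FF_simps)
  then show ?thesis using that fr_zero_iff[OF AB(2)] has_order_exists[OF p T AB(2)] by metis
qed

lemma has_order_nonzero: "has_order T p f n \<Longrightarrow> f \<noteq> \<zero>\<^bsub>FF\<^esub>"
proof
  assume "has_order T p f n" and z: "f = \<zero>\<^bsub>FF\<^esub>"
  then obtain U W i j where f: "U p \<noteq> 0" "tform U" "fpair (\<lambda>x. T x ^ i * U x) (\<lambda>x. T x ^ j * W x)"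
    "f = fr (\<lambda>x. T x ^ i * U x) (\<lambda>x. T x ^ j * W x)"
    unfolding has_order_def by blast
  have "\<exists>x\<in>cone. T x ^ i * U x \<noteq> 0"
    using cone_mult_nz[OF tform_power[OF Tp(2)] f(2) Tp(5)] f(1) p by blast
  then show False using z fr_zero_iff[OF f(3)] f(4) by auto
qed

lemma max_ideal_carrier: "f \<in> max_ideal curve (pt p) \<Longrightarrow> f \<in> local_ring curve (pt p)"
  by (simp add: max_ideal_def)

lemma local_ring_carrier: "f \<in> local_ring curve (pt p) \<Longrightarrow> f \<in> carrier FF"
  by (simp add: local_ring_def)

lemma max_ideal_order_pos:
  assumes "f \<in> max_ideal curve (pt p)" "has_order T p f n"
  shows "n > 0"
  using has_order_one_iff[OF p T max_ideal_carrier[OF assms(1)] assms(2)] has_order_nonneg_local(2)[OF assms(2)] assms(1)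
  by blast

lemma zero_mult: "f \<in> carrier FF \<Longrightarrow> f \<otimes>\<^bsub>FF\<^esub> \<zero>\<^bsub>FF\<^esub> = \<zero>\<^bsub>FF\<^esub>" "f \<in> carrier FF \<Longrightarrow> \<zero>\<^bsub>FF\<^esub> \<otimes>\<^bsub>FF\<^esub> f = \<zero>\<^bsub>FF\<^esub>"
proof -
  assume "f \<in> carrier FF"
  then obtain A B where f: "f = fr A B" "fpair A B" by (auto simp: FF_simps)
  have z: "fpair (\<lambda>_. 0) (\<lambda>_. 1)" by (rule fpair_const) simp
  show "f \<otimes>\<^bsub>FF\<^esub> \<zero>\<^bsub>FF\<^esub> = \<zero>\<^bsub>FF\<^esub>"
    unfolding f(1) FF_simps(3) fr_mult[OF f(2) z] fr_eq_iff[OF fpair_mult[OF f(2) z] z] by simp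
  show "\<zero>\<^bsub>FF\<^esub> \<otimes>\<^bsub>FF\<^esub> f = \<zero>\<^bsub>FF\<^esub>"
    unfolding f(1) FF_simps(3) fr_mult[OF z f(2)] fr_eq_iff[OF fpair_mult[OF z f(2)] z] by simp
qed

lemma zero_local: "\<zero>\<^bsub>FF\<^esub> \<in> local_ring curve (pt p)"
  unfolding local_ring_iff[OF p] FF_simps(3) using fpair_const[OF one_neq_zero] by force

text \<open>An element of positive order has a factor \<open>T\<close> in its numerator; the
  coordinate \<open>L\<close> is put in its place to keep the degrees equal.\<close>

lemma param_uniformizer: "uniformizer curve (pt p) param"
  unfolding uniformizer_def
proof
  show m: "param \<in> max_ideal curve (pt p)" using has_order_nonneg_local(2)[OF has_order_param] by simp
  show "max_ideal curve (pt p) = {param \<otimes>\<^bsub>FF\<^esub> h | h. h \<in> local_ring curve (pt p)}"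
  proof (intro subset_antisym subsetI)
    fix f assume f: "f \<in> max_ideal curve (pt p)"
    then have "f \<in> carrier FF" by (simp add: max_ideal_carrier local_ring_carrier)
    then show "f \<in> {param \<otimes>\<^bsub>FF\<^esub> h | h. h \<in> local_ring curve (pt p)}"
    proof (cases rule: carrier_cases)
      case 1
      then show ?thesis using zero_mult(1)[OF local_ring_carrier[OF max_ideal_carrier[OF m]]] zero_local by force
    next
      case (2 n)
      then have n: "n > 0" using max_ideal_order_pos f by blast
      obtain U W where UW: "U p \<noteq> 0" "W p \<noteq> 0" "tform U" "tform W"
        and F: "fpair (\<lambda>x. T x ^ nat n * U x) W" and f: "f = fr (\<lambda>x. T x ^ nat n * U x) W"
        by (rule has_order_nonneg[OF p T 2(2) less_imp_le[OF n]]) (rule that)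
      have nn: "nat n = Suc (nat n - 1)" using n by simp
      obtain d where d: "ternary_form d (\<lambda>x. T x ^ nat n * U x)" "ternary_form d W" using F by (auto simp: fpair_def)
      obtain dU where dU: "ternary_form dU U" using UW(3) by (auto simp: tform_def)
      have tn: "ternary_form k (\<lambda>x. T x ^ k)" for k using ternary_form_power[OF Tp(1), of k] by simp
      have nzU: "\<exists>x\<in>cone. T x ^ nat n * U x \<noteq> 0"
        using cone_mult_nz[OF tform_power[OF Tp(2)] UW(3) Tp(5)] UW(1) p by blast
      have "d = nat n + dU" by (rule form_degree_unique[OF d(1) ternary_form_mult[OF tn dU] refl nzU])
      then have deg: "d = (nat n - 1) + (dU + 1)" using nn by simp
      have H: "fpair (\<lambda>x. T x ^ (nat n - 1) * (U x * L x)) W"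
        unfolding fpair_def
        using ternary_form_mult[OF tn[of "nat n - 1"] ternary_form_mult[OF dU ternary_form_coord[of param_coord]]] d(2) UW(2) p
        unfolding deg by blast
      have "f = param \<otimes>\<^bsub>FF\<^esub> fr (\<lambda>x. T x ^ (nat n - 1) * (U x * L x)) W"
        unfolding f fr_mult[OF param_pairs(1) H] fr_eq_iff[OF F fpair_mult[OF param_pairs(1) H]]
        by (subst nn) (simp add: mult_ac)
      moreover have "fr (\<lambda>x. T x ^ (nat n - 1) * (U x * L x)) W \<in> local_ring curve (pt p)"
        unfolding local_ring_iff[OF p] using H UW(2) by blast
      ultimately show ?thesis by blast
    qed
  next
    fix f assume "f \<in> {param \<otimes>\<^bsub>FF\<^esub> h | h. h \<in> local_ring curve (pt p)}"
    then obtain A B where AB: "fpair A B" "B p \<noteq> 0" "f = param \<otimes>\<^bsub>FF\<^esub> fr A B"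
      using local_ring_iff[OF p] by auto
    show "f \<in> max_ideal curve (pt p)"
      unfolding max_ideal_iff[OF p] AB(3) fr_mult[OF param_pairs(1) AB(1)]
      using fpair_mult[OF param_pairs(1) AB(1)] AB(2) L_p Tp(3)
      by (intro exI[of _ "\<lambda>x. T x * A x"] exI[of _ "\<lambda>x. L x * B x"]) auto
  qed
qed

text \<open>\<open>param\<close> is a multiple of \<open>t\<close>, so two orders n > 0 and m \<ge>
  0 add up to 1.\<close>

lemma uniformizer_order:
  assumes "uniformizer curve (pt p) t"
  shows "has_order T p t 1"
proof -
  have t: "t \<in> max_ideal curve (pt p)" using assms unfolding uniformizer_def by (rule conjunct1)
  have "param \<in> max_ideal curve (pt p)" using param_uniformizer unfolding uniformizer_def by (rule conjunct1)
  then obtain h where h: "h \<in> local_ring curve (pt p)" "param = t \<otimes>\<^bsub>FF\<^esub> h"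
  proof -
    have "max_ideal curve (pt p) = {t \<otimes>\<^bsub>FF\<^esub> h | h. h \<in> local_ring curve (pt p)}"
      using assms by (simp add: uniformizer_def)
    with \<open>param \<in> max_ideal curve (pt p)\<close> show ?thesis using that by blast
  qed
  have tc: "t \<in> carrier FF" and hc: "h \<in> carrier FF" using t h by (simp_all add: max_ideal_carrier local_ring_carrier)
  have pn: "param \<noteq> \<zero>\<^bsub>FF\<^esub>" using has_order_nonzero[OF has_order_param] .
  have tn: "t \<noteq> \<zero>\<^bsub>FF\<^esub>" and hn: "h \<noteq> \<zero>\<^bsub>FF\<^esub>" using pn h(2) zero_mult tc hc by auto
  obtain n where n: "has_order T p t n" using tc tn by (cases rule: carrier_cases) auto
  obtain m where m: "has_order T p h m" using hc hn by (cases rule: carrier_cases) auto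
  have "n + m = 1"
    using has_order_unique[OF p T has_order_mult[OF p T n m]] has_order_param h(2) by simp
  moreover have "n > 0" using max_ideal_order_pos t n by blast
  moreover have "m \<ge> 0" using has_order_one_iff[OF p T h(1) m] .
  ultimately have "n = 1" by simp
  then show ?thesis using n by simp
qed

lemma has_order_int_power:
  assumes "has_order T p t 1"
  shows "has_order T p (t [^]\<^bsub>FF\<^esub> (n::int)) n"
proof -
  obtain U W i j where t: "U p \<noteq> 0" "W p \<noteq> 0" "tform U" "tform W"
    "fpair (\<lambda>x. T x ^ i * U x) (\<lambda>x. T x ^ j * W x)"
    "t = fr (\<lambda>x. T x ^ i * U x) (\<lambda>x. T x ^ j * W x)" "1 = int i - int j"
    using assms unfolding has_order_def by blast
  have nz: "\<exists>x\<in>cone. T x ^ i * U x \<noteq> 0"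
    using cone_mult_nz[OF tform_power[OF Tp(2)] t(3) Tp(5)] t(1) p by blast
  note t' = fpair_swap[OF t(5) nz]
  define m where "m = nat \<bar>n\<bar>"
  have e: "(\<lambda>x. (T x ^ k * A x) ^ m) = (\<lambda>x. T x ^ (k * m) * A x ^ m)" for k A
    by (simp add: power_mult_distrib power_mult)
  note P1 = fpair_power[OF t(5), of m, unfolded e]
  note P2 = fpair_power[OF t', of m, unfolded e]
  show ?thesis
  proof (cases "n < 0")
    case True
    then have m: "nat (- n) = m" by (simp add: m_def)
    have "t [^]\<^bsub>FF\<^esub> n = fr (\<lambda>x. T x ^ (j * m) * W x ^ m) (\<lambda>x. T x ^ (i * m) * U x ^ m)"
      unfolding t(6) fr_int_power[OF t(5) t'] m e using True by simp
    moreover have "n = int (j * m) - int (i * m)"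
    proof -
      have "int (j * m) - int (i * m) = - int m * (int i - int j)" by (simp add: algebra_simps)
      then show ?thesis using t(7) True by (simp add: m_def)
    qed
    ultimately show ?thesis unfolding has_order_def
      using t(1-4) P2 by (intro exI conjI) (auto intro: tform_power)
  next
    case False
    then have m: "nat n = m" by (simp add: m_def)
    have "t [^]\<^bsub>FF\<^esub> n = fr (\<lambda>x. T x ^ (i * m) * U x ^ m) (\<lambda>x. T x ^ (j * m) * W x ^ m)"
      unfolding t(6) fr_int_power[OF t(5) t'] m e using False by simp
    moreover have "n = int (i * m) - int (j * m)"
    proof -
      have "int (i * m) - int (j * m) = int m * (int i - int j)" by (simp add: algebra_simps)
      then show ?thesis using t(7) False by (simp add: m_def)
    qed
    ultimately show ?thesis unfolding has_order_def
      using t(1-4) P1 by (intro exI conjI) (auto intro: tform_power)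
  qed
qed

lemma param_int_power: "param [^]\<^bsub>FF\<^esub> n \<in> carrier FF"
  "param [^]\<^bsub>FF\<^esub> (- n :: int) \<otimes>\<^bsub>FF\<^esub> param [^]\<^bsub>FF\<^esub> n = \<one>\<^bsub>FF\<^esub>"
proof -
  have P: "fpair (\<lambda>x. T x ^ k) (\<lambda>x. L x ^ k)" "fpair (\<lambda>x. L x ^ k) (\<lambda>x. T x ^ k)" for k
    by (rule fpair_power[OF param_pairs(1)], rule fpair_power[OF param_pairs(2)])
  show "param [^]\<^bsub>FF\<^esub> n \<in> carrier FF"
    unfolding fr_int_power[OF param_pairs] FF_simps using P by (auto split: if_splits)
  have "fr (\<lambda>x. T x ^ k) (\<lambda>x. L x ^ k) \<otimes>\<^bsub>FF\<^esub> fr (\<lambda>x. L x ^ k) (\<lambda>x. T x ^ k) = \<one>\<^bsub>FF\<^esub>"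
    "fr (\<lambda>x. L x ^ k) (\<lambda>x. T x ^ k) \<otimes>\<^bsub>FF\<^esub> fr (\<lambda>x. T x ^ k) (\<lambda>x. L x ^ k) = \<one>\<^bsub>FF\<^esub>" for k
    unfolding fr_mult[OF P] fr_mult[OF P(2,1)] FF_simps
      fr_eq_iff[OF fpair_mult[OF P] fpair_const[OF one_neq_zero]]
      fr_eq_iff[OF fpair_mult[OF P(2,1)] fpair_const[OF one_neq_zero]]
    by (simp_all add: mult.commute)
  moreover have "\<one>\<^bsub>FF\<^esub> \<otimes>\<^bsub>FF\<^esub> \<one>\<^bsub>FF\<^esub> = \<one>\<^bsub>FF\<^esub>"
    by (rule Group.monoid.l_one[OF FF_monoid Group.monoid.one_closed[OF FF_monoid]])
  moreover have "n = 0 \<or> n < 0 \<or> n > 0" by auto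
  ultimately show "param [^]\<^bsub>FF\<^esub> (- n :: int) \<otimes>\<^bsub>FF\<^esub> param [^]\<^bsub>FF\<^esub> n = \<one>\<^bsub>FF\<^esub>"
    unfolding fr_int_power[OF param_pairs] by (auto simp flip: FF_simps)
qed

text \<open>Existence uses \<open>param\<close>; uniqueness holds since every admissible uniformizer
  has order 1 and every admissible unit has order 0.\<close>

lemma ord_at_eq:
  assumes f: "f \<in> carrier FF" "has_order T p f n"
  shows "ord_at curve (pt p) f = n"
  unfolding ord_at_def
proof (rule the_equality)
  let ?u = "f \<otimes>\<^bsub>FF\<^esub> param [^]\<^bsub>FF\<^esub> (- n)"
  have u: "has_order T p ?u 0"
    using has_order_mult[OF p T f(2) has_order_int_power[OF has_order_param, of "- n"]] by simp
  have "?u \<in> local_ring curve (pt p) - max_ideal curve (pt p)"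
    using has_order_nonneg_local[OF u] by simp
  moreover have "f = ?u \<otimes>\<^bsub>FF\<^esub> param [^]\<^bsub>FF\<^esub> n"
    using f(1) param_int_power[of "- n"] param_int_power[of n]
    by (simp add: Group.monoid.m_assoc[OF FF_monoid] Group.monoid.r_one[OF FF_monoid])
  ultimately show "\<exists>t u. uniformizer curve (pt p) t \<and> u \<in> local_ring curve (pt p) - max_ideal curve (pt p) \<and>
     f = u \<otimes>\<^bsub>FF\<^esub> (t [^]\<^bsub>FF\<^esub> n)"
    using param_uniformizer by blast
next
  fix m :: int assume "\<exists>t u. uniformizer curve (pt p) t \<and> u \<in> local_ring curve (pt p) - max_ideal curve (pt p) \<and>
     f = u \<otimes>\<^bsub>FF\<^esub> (t [^]\<^bsub>FF\<^esub> m)"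
  then obtain t u where tu: "uniformizer curve (pt p) t" "u \<in> local_ring curve (pt p)" "u \<notin> max_ideal curve (pt p)"
    "f = u \<otimes>\<^bsub>FF\<^esub> (t [^]\<^bsub>FF\<^esub> m)" by blast
  have un: "u \<noteq> \<zero>\<^bsub>FF\<^esub>"
  proof
    assume z: "u = \<zero>\<^bsub>FF\<^esub>"
    have "value_at (fr (\<lambda>_. 0) (\<lambda>_. 1)) (pt p) = 0"
      using value_at_fr[OF fpair_const[OF one_neq_zero] p, of 0] by simp
    then show False using tu z zero_local by (simp add: max_ideal_def FF_simps(3))
  qed
  obtain k where k: "has_order T p u k"
    by (rule carrier_cases[OF local_ring_carrier[OF tu(2)]]) (use un in auto)
  have "k \<ge> 0" using has_order_one_iff[OF p T tu(2) k] .
  then have "k = 0" using has_order_nonneg_local(2)[OF k] tu(3) by simp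
  then show "m = n"
    using has_order_unique[OF p T f(2)]
      has_order_mult[OF p T k has_order_int_power[OF uniformizer_order[OF tu(1)], of m]] tu(4)
    by simp
qed

text \<open>The pole of a quotient is at most the zero of its denominator, here of order
  \<open>k\<close>.\<close>

lemma ord_at_ge:
  assumes AE: "fpair A E" and A: "\<exists>x\<in>cone. A x \<noteq> 0"
    and UW: "tform U" "tform W" "U p \<noteq> 0" "W p \<noteq> 0" and E: "\<And>x. x \<in> cone \<Longrightarrow> E x * W x = T x ^ k * U x"
  shows "ord_at curve (pt p) (fr A E) \<ge> - int k"
proof -
  obtain n where n: "has_order T p (fr A E) n" using has_order_exists[OF p T AE A] by blast
  then obtain U' W' i j where f: "U' p \<noteq> 0" "W' p \<noteq> 0" "tform U'" "tform W'"
    "fpair (\<lambda>x. T x ^ i * U' x) (\<lambda>x. T x ^ j * W' x)"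
    "fr A E = fr (\<lambda>x. T x ^ i * U' x) (\<lambda>x. T x ^ j * W' x)" "n = int i - int j"
    unfolding has_order_def by blast
  have "\<not> i + k < j"
  proof
    assume "i + k < j"
    then have j: "j = (i + k) + Suc (j - i - k - 1)" by simp
    have "A p * (T p ^ Suc (j - i - k - 1) * (W' p * W p)) = U' p * U p"
    proof (rule cone_cancel[OF tform_power[OF Tp(2)] Tp(5) _ _ _ p])
      show "tform (\<lambda>x. A x * (T x ^ Suc (j - i - k - 1) * (W' x * W x)))" "tform (\<lambda>x. U' x * U x)"
        by (intro tform_intros UW f Tp fpair_tform(1)[OF AE])+
      fix x assume x: "x \<in> cone"
      have "T x ^ (i + k) * (A x * (T x ^ Suc (j - i - k - 1) * (W' x * W x))) = (A x * (T x ^ j * W' x)) * W x"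
        by (subst (2) j) (simp only: power_add mult_ac)
      also have "A x * (T x ^ j * W' x) = T x ^ i * U' x * E x"
        using f(6) x unfolding fr_eq_iff[OF AE f(5)] by blast
      also have "T x ^ i * U' x * E x * W x = T x ^ i * U' x * (E x * W x)" by (simp add: mult_ac)
      finally show "T x ^ (i + k) * (A x * (T x ^ Suc (j - i - k - 1) * (W' x * W x))) = T x ^ (i + k) * (U' x * U x)"
        unfolding E[OF x] by (simp add: power_add mult_ac)
    qed
    then show False using f UW Tp(3) by simp
  qed
  moreover have "fr A E \<in> carrier FF" using AE by (auto simp: FF_simps)
  ultimately show ?thesis using ord_at_eq[OF _ n] f(7) by simp
qed

text \<open>If f has no pole at \<open>p\<close>, or at most a simple one at a zero of
  \<open>E\<close>, then f E is regular there; \<open>E\<close> enters through the order m \<ge> 1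
  of its zero.\<close>

lemma regular_of_ord:
  assumes AB: "fpair A B" and A: "\<exists>x\<in>cone. A x \<noteq> 0" and E: "tform E"
    and o: "ord_at curve (pt p) (fr A B) \<ge> 0 \<or> ord_at curve (pt p) (fr A B) \<ge> - 1 \<and> E p = 0"
  shows "\<exists>U W. tform U \<and> tform W \<and> W p \<noteq> 0 \<and> (\<forall>x\<in>cone. A x * E x * W x = B x * U x)"
proof (cases "\<forall>x\<in>cone. E x = 0")
  case True
  then show ?thesis using tform_const[of 0] tform_const[of 1]
    by (intro exI[of _ "\<lambda>_. 0"] exI[of _ "\<lambda>_. 1"]) auto
next
  case False
  then obtain m U2 W2 where E2: "tform U2" "tform W2" "U2 p \<noteq> 0" "W2 p \<noteq> 0"
    and E: "\<forall>x\<in>cone. E x * W2 x = T x ^ m * U2 x" using T_order[OF p T E] by auto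
  have m: "m \<ge> 1" if "E p = 0" using bspec[OF E p] that E2 by (cases m) auto
  obtain n where n: "has_order T p (fr A B) n" using has_order_exists[OF p T AB A] by blast
  then obtain U W i j where f: "U p \<noteq> 0" "W p \<noteq> 0" "tform U" "tform W"
    "fpair (\<lambda>x. T x ^ i * U x) (\<lambda>x. T x ^ j * W x)"
    "fr A B = fr (\<lambda>x. T x ^ i * U x) (\<lambda>x. T x ^ j * W x)" "n = int i - int j"
    unfolding has_order_def by blast
  have "fr A B \<in> carrier FF" using AB by (auto simp: FF_simps)
  then have "ord_at curve (pt p) (fr A B) = n" using ord_at_eq n by blast
  then have jm: "j \<le> i + m" using o f(7) m by auto
  have "A x * E x * (W x * W2 x) = B x * (T x ^ (i + m - j) * (U x * U2 x))" if "x \<in> cone" for x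
  proof (rule cone_cancel[OF tform_power[OF Tp(2)] Tp(5) _ _ _ that])
    show "tform (\<lambda>x. A x * E x * (W x * W2 x))" "tform (\<lambda>x. B x * (T x ^ (i + m - j) * (U x * U2 x)))"
      by (intro tform_intros assms(3) f E2 Tp fpair_tform[OF AB])+
    fix x assume x: "x \<in> cone"
    have "T x ^ j * (A x * E x * (W x * W2 x)) = (A x * (T x ^ j * W x)) * (E x * W2 x)" by (simp add: mult_ac)
    also have "A x * (T x ^ j * W x) = T x ^ i * U x * B x"
      using f(6) x unfolding fr_eq_iff[OF AB f(5)] by blast
    also have "T x ^ i * U x * B x * (E x * W2 x) = T x ^ (i + m) * (B x * (U x * U2 x))"
      unfolding bspec[OF E x] by (simp add: power_add mult_ac)
    also have "T x ^ (i + m) = T x ^ j * T x ^ (i + m - j)" using jm by (simp flip: power_add)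
    finally show "T x ^ j * (A x * E x * (W x * W2 x)) = T x ^ j * (B x * (T x ^ (i + m - j) * (U x * U2 x)))"
      by (simp add: mult_ac)
  qed
  moreover have "tform (\<lambda>x. T x ^ (i + m - j) * (U x * U2 x))" "tform (\<lambda>x. W x * W2 x)"
    by (intro tform_intros f E2 Tp)+
  moreover have "W p * W2 p \<noteq> 0" using f E2 by simp
  ultimately show ?thesis by blast
qed

end

end

section \<open>Functions with prescribed poles\<close>

lemma fps_X_power_dvd_iff: "fps_X ^ m dvd (f :: 'a::field fps) \<longleftrightarrow> (\<forall>i<m. fps_nth f i = 0)"
proof
  assume "fps_X ^ m dvd f"
  then obtain g where "f = fps_X ^ m * g" by (auto simp: dvd_def)
  then show "\<forall>i<m. fps_nth f i = 0" by (simp add: fps_X_power_mult_nth)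
next
  assume 0: "\<forall>i<m. fps_nth f i = 0"
  have "f = fps_X ^ m * fps_shift m f"
    by (rule fps_ext) (use 0 in \<open>auto simp: fps_X_power_mult_nth\<close>)
  then show "fps_X ^ m dvd f" by (metis dvd_triv_left)
qed

lemma dvd_cancel_unit_fps:
  assumes "fps_X ^ m dvd f * w" and "fps_nth (w :: 'a::field fps) 0 \<noteq> 0"
  shows "fps_X ^ m dvd f"
proof -
  have "w * inverse w = 1" using assms(2) by (simp add: inverse_mult_eq_1')
  then have "f = (f * w) * inverse w" by (simp add: mult.assoc)
  then show ?thesis using assms(1) by (metis dvd_mult2)
qed

text \<open>A unique term of least order cannot be cancelled.\<close>

lemma fps_sum_unique_least_order:
  fixes f :: "'i \<Rightarrow> 'a::field fps"
  assumes "finite S" "s \<in> S" "k s \<noteq> 0" and f: "\<And>t. t \<in> S \<Longrightarrow> f t \<noteq> 0"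
    and least: "\<And>t. t \<in> S \<Longrightarrow> t \<noteq> s \<Longrightarrow> subdegree (f s) < subdegree (f t)"
    and dvd: "fps_X ^ m dvd (\<Sum>t\<in>S. fps_const (k t) * f t)"
  shows "m \<le> subdegree (f s)"
proof (rule ccontr)
  assume "\<not> m \<le> subdegree (f s)"
  then have "fps_nth (\<Sum>t\<in>S. fps_const (k t) * f t) (subdegree (f s)) = 0"
    using dvd by (simp add: fps_X_power_dvd_iff)
  moreover have "fps_nth (\<Sum>t\<in>S. fps_const (k t) * f t) (subdegree (f s)) = k s * fps_nth (f s) (subdegree (f s))"
  proof -
    have "fps_nth (fps_const (k t) * f t) (subdegree (f s)) = 0" if "t \<in> S - {s}" for t
      using nth_less_subdegree_zero[OF least[of t]] that by simp
    then show ?thesis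
      unfolding fps_sum_nth by (subst sum.remove[OF assms(1,2)], subst sum.neutral) auto
  qed
  ultimately show False using assms(3) f[OF assms(2)] by simp
qed

section \<open>Exponents permitted by the orders at the vertices\<close>

text \<open>\<open>S\<close> will be the set of exponents of y^j z^k in f E. The numbers
  \<open>\<alpha>\<close> = q j + (q-1) k and \<open>\<beta>\<close> = k - (q-1) j measure the pole
  of a monomial at (0:1:0) and (0:0:1), with permitted maxima q^2 and 1; \<open>al\<close> and
  \<open>be\<close> say that a violating term is matched by another one at least as bad. Both maxima
  are shown to bound every term, and what remains is a search for lattice points.\<close>

lemma monomial_support:
  fixes q :: nat and S :: "(nat \<times> nat) set"
  assumes q: "q > 2" and fin: "finite S"
    and range: "\<And>j k. (j, k) \<in> S \<Longrightarrow> j < q \<and> k \<ge> 1"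
    and al: "\<And>j k. (j, k) \<in> S \<Longrightarrow> q * j + (q - 1) * k > q ^ 2 \<Longrightarrow>
      \<exists>j' k'. (j', k') \<in> S \<and> (j', k') \<noteq> (j, k) \<and> q * j' + (q - 1) * k' \<ge> q * j + (q - 1) * k"
    and be: "\<And>j k. (j, k) \<in> S \<Longrightarrow> k > (q - 1) * j + 1 \<Longrightarrow>
      \<exists>j' k'. (j', k') \<in> S \<and> (j', k') \<noteq> (j, k) \<and> k' + (q - 1) * j \<ge> k + (q - 1) * j'"
    and jk: "(j, k) \<in> S"
  shows "j \<ge> 1 \<and> k \<ge> 1 \<and> j + k \<le> q \<or> j = 0 \<and> k = 1 \<or> j = 1 \<and> k = q"
proof -
  define \<alpha> where "\<alpha> s = q * fst s + (q - 1) * snd s" for s :: "nat \<times> nat"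
  define \<beta> where "\<beta> s = int (snd s) - int ((q - 1) * fst s)" for s :: "nat \<times> nat"
  obtain m where m: "q = Suc (Suc (Suc m))" using q by (metis add_2_eq_Suc less_imp_Suc_add)
  text \<open>Two terms with the same (maximal) \<open>\<beta>\<close> force one with \<open>j > 0\<close>, hence a large \<open>\<alpha>\<close>.\<close>
  have beta: "\<exists>j k. (j, k) \<in> S \<and> j \<ge> 1 \<and> int k \<ge> \<beta> s + int ((q - 1) * j)" if s: "s \<in> S" "\<beta> s > 1" for s
  proof -
    define B where "B = Max (\<beta> ` S)"
    have "B \<in> \<beta> ` S" unfolding B_def using s fin by (intro Max_in) auto
    then obtain j1 k1 where 1: "(j1, k1) \<in> S" "\<beta> (j1, k1) = B" by force
    have max: "t \<in> S \<Longrightarrow> \<beta> t \<le> B" for t unfolding B_def using fin by auto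
    have "B > 1" using max[OF s(1)] s(2) by simp
    moreover have "int k1 = B + int ((q - 1) * j1)" using 1(2) by (simp add: \<beta>_def del: of_nat_mult)
    ultimately have "k1 > (q - 1) * j1 + 1" by linarith
    from be[OF 1(1) this] obtain j2 k2 where 2: "(j2, k2) \<in> S" "(j2, k2) \<noteq> (j1, k1)"
      "k2 + (q - 1) * j1 \<ge> k1 + (q - 1) * j2" by blast
    have "int k2 + int ((q - 1) * j1) \<ge> int k1 + int ((q - 1) * j2)" using 2(3) by linarith
    then have "\<beta> (j2, k2) = B" using max[OF 2(1)] 1(2) by (simp add: \<beta>_def)
    then have e: "int k2 = B + int ((q - 1) * j2)" "int k1 = B + int ((q - 1) * j1)"
      using 1 by (simp_all add: \<beta>_def)
    then have "j1 \<noteq> j2" using 2(2) by auto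
    then have "j1 \<ge> 1 \<or> j2 \<ge> 1" by auto
    then show ?thesis using e 1(1) 2(1) max[OF s(1)] by (metis add_mono_thms_linordered_semiring(3))
  qed
  have alpha: "\<alpha> s \<le> q ^ 2" if "s \<in> S" for s
  proof (rule ccontr)
    assume big: "\<not> \<alpha> s \<le> q ^ 2"
    define A where "A = Max (\<alpha> ` S)"
    have "A \<in> \<alpha> ` S" unfolding A_def using that fin by (intro Max_in) auto
    then obtain j1 k1 where 1: "(j1, k1) \<in> S" "\<alpha> (j1, k1) = A" by force
    have max: "t \<in> S \<Longrightarrow> \<alpha> t \<le> A" for t unfolding A_def using fin by auto
    have "A > q ^ 2" using max[OF that] big by simp
    with 1 have "q * j1 + (q - 1) * k1 > q ^ 2" by (simp add: \<alpha>_def)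
    from al[OF 1(1) this] obtain j2 k2 where 2: "(j2, k2) \<in> S" "(j2, k2) \<noteq> (j1, k1)"
      "q * j2 + (q - 1) * k2 \<ge> q * j1 + (q - 1) * k1" by blast
    have eq: "q * j2 + (q - 1) * k2 = q * j1 + (q - 1) * k1"
      using 2 max[OF 2(1)] 1(2) by (simp add: \<alpha>_def)
    \<comment> \<open>A tie in \<open>\<alpha>\<close> means that q times a difference of the j is q
      - 1 times a difference of the k, so q - 1 divides a positive difference below q: the tie is
      between j = 0 and j = q - 1, and the term with j = 0 has k \<ge> q.\<close>
    have zero: "\<exists>k. (0, k) \<in> S \<and> k \<ge> q \<and> \<alpha> (0, k) = A"
      if S1: "(i1, l1) \<in> S" "\<alpha> (i1, l1) = A" and S2: "(i2, l2) \<in> S" and lt: "i1 < i2"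
        and e: "q * i2 + (q - 1) * l2 = q * i1 + (q - 1) * l1" for i1 l1 i2 l2
    proof -
      obtain d where d: "i2 = i1 + d" "d > 0" using lt less_imp_add_positive by blast
      have "q * d + (q - 1) * l2 = (q - 1) * l1" using e by (simp add: d algebra_simps)
      then have e2: "(q - 1) * d + d + (q - 1) * l2 = (q - 1) * l1" using m by simp
      have "(q - 1) dvd (q - 1) * (d + l2) + d" using e2 by (metis add.assoc add.commute distrib_left dvd_triv_left)
      then have "(q - 1) dvd d" by (simp add: dvd_add_right_iff)
      moreover have "i2 < q" using range[OF S2] by simp
      ultimately have d': "d = q - 1" using d by (metis add.commute dvd_imp_le le_add2 le_antisym less_Suc_eq_le m diff_Suc_1 le_trans)
      then have i1: "i1 = 0" using d \<open>i2 < q\<close> by simp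
      have "(q - 1) * (q + l2) = (q - 1) * l1" using e2 d' m by (simp add: algebra_simps)
      then have "q + l2 = l1 \<or> q - 1 = 0" by (simp only: mult_cancel1)
      then have "l1 = q + l2" using q by auto
      then show ?thesis using S1 i1 by (intro exI[of _ l1]) simp
    qed
    have "j1 \<noteq> j2"
    proof
      assume "j1 = j2"
      then have "(q - 1) * k2 = (q - 1) * k1" using eq by simp
      then have "k2 = k1 \<or> q - 1 = 0" by (simp only: mult_cancel1)
      then show False using 2(2) q \<open>j1 = j2\<close> by auto
    qed
    then obtain k0 where k0: "(0, k0) \<in> S" "k0 \<ge> q" "\<alpha> (0, k0) = A"
      using zero[OF 1 2(1) _ eq] zero[OF 2(1) _ 1(1) _ eq[symmetric]] eq 1(2)
      by (metis \<alpha>_def fst_conv linorder_neqE_nat snd_conv)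
    \<comment> \<open>Such a term violates the bound on \<open>\<beta>\<close>, which produces a
      term with j \<ge> 1 and larger k, hence with \<open>\<alpha>\<close> above the
      maximum.\<close>
    have "\<beta> (0, k0) > 1" using k0 q by (simp add: \<beta>_def)
    from beta[OF k0(1) this] obtain j3 k3 where 3: "(j3, k3) \<in> S" "j3 \<ge> 1" "int k3 \<ge> int k0 + int ((q - 1) * j3)"
      by (auto simp: \<beta>_def)
    then have "k3 \<ge> k0" by linarith
    then have "(q - 1) * k0 \<le> (q - 1) * k3" by (rule mult_le_mono2)
    moreover have "q * j3 > 0" using 3(2) q by simp
    moreover have "\<alpha> (j3, k3) = q * j3 + (q - 1) * k3" "\<alpha> (0, k0) = (q - 1) * k0" by (simp_all add: \<alpha>_def)
    ultimately have "\<alpha> (j3, k3) > \<alpha> (0, k0)" by linarith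
    then show False using max[OF 3(1)] k0(3) by simp
  qed
  have beta1: "\<beta> s \<le> 1" if "s \<in> S" for s
  proof (rule ccontr)
    assume "\<not> \<beta> s \<le> 1"
    then have "\<beta> s > 1" by simp
    from beta[OF that this] obtain j3 k3 where 3: "(j3, k3) \<in> S" "j3 \<ge> 1" "int k3 \<ge> \<beta> s + int ((q - 1) * j3)" by blast
    have "q - 1 \<le> (q - 1) * j3" using 3(2) by simp
    then have "int ((q - 1) * j3) \<ge> int (q - 1)" by (simp only: zle_int)
    then have "int k3 \<ge> 2 + int (q - 1)" using 3(3) \<open>\<beta> s > 1\<close> by linarith
    then have "k3 \<ge> q + 1" using m by simp
    then have "(q - 1) * k3 \<ge> (q - 1) * (q + 1)" by (rule mult_le_mono2)
    moreover have "q * j3 \<ge> q" using 3(2) by simp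
    moreover have "(q - 1) * (q + 1) + q > q ^ 2" using m by (simp add: power2_eq_square algebra_simps)
    ultimately have "q * j3 + (q - 1) * k3 > q ^ 2" by linarith
    then have "\<alpha> (j3, k3) > q ^ 2" by (simp only: \<alpha>_def fst_conv snd_conv)
    then show False using alpha[OF 3(1)] by simp
  qed
  have a1: "q * j + (q - 1) * k \<le> q ^ 2" using alpha[OF jk] by (simp add: \<alpha>_def)
  have b1: "k \<le> (q - 1) * j + 1" using beta1[OF jk] unfolding \<beta>_def fst_conv snd_conv by linarith
  have k1: "k \<ge> 1" using range[OF jk] by simp
  show ?thesis
  proof (cases "j = 0")
    case True then show ?thesis using b1 k1 by simp
  next
    case False
    show ?thesis
    proof (cases "j + k \<le> q")
      case True then show ?thesis using False k1 by simp
    next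
      \<comment> \<open>Beyond the triangle j + k \<le> q, the bound on \<open>\<alpha>\<close>
        forces k \<ge> q and then j = 1 and k = q.\<close>
      case False2: False
      have "q * j + q * k \<le> q ^ 2 + k" using a1 m by (simp add: algebra_simps)
      moreover have "q * j + q * k \<ge> q ^ 2 + q"
      proof -
        have "q * (q + 1) \<le> q * (j + k)" using False2 by (intro mult_le_mono2) simp
        then show ?thesis by (simp add: power2_eq_square distrib_left)
      qed
      ultimately have "k \<ge> q" by simp
      then have "(q - 1) * k \<ge> (q - 1) * q" by (rule mult_le_mono2)
      moreover have "q ^ 2 = (q - 1) * q + q" using m by (simp add: power2_eq_square)
      ultimately have "q * j \<le> q * 1" using a1 by linarith
      then have "0 < q \<longrightarrow> j \<le> 1" by (simp only: mult_le_cancel1)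
      then have "j = 1" using False q by linarith
      then have "(q - 1) * k \<le> (q - 1) * q" using a1 \<open>q ^ 2 = (q - 1) * q + q\<close> unfolding \<open>j = 1\<close> by linarith
      then have "0 < q - 1 \<longrightarrow> k \<le> q" by (simp only: mult_le_cancel1)
      then have "k \<le> q" using q by linarith
      then show ?thesis using \<open>j = 1\<close> \<open>k \<ge> q\<close> by simp
    qed
  qed
qed

section \<open>Normality of the affine chart\<close>

context klein_curve
begin

text \<open>The chart $X_1 \neq 0$ is normal: a function on it that is regular at all points is a
  polynomial, since a denominator of least degree has no root. Over a root other than 0 there are
  \<open>q\<close> points, and over 0 there is only the point $(1:0:0)$, with local parameter \<open>y\<close>.\<close>

lemma polynomial_of_regular:
  assumes A: "tform A" and B: "tform B" "\<exists>x\<in>cone. B x \<noteq> 0"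
    and reg: "\<And>p. p \<in> cone \<Longrightarrow> \<exists>U W. tform U \<and> tform W \<and> W p \<noteq> 0 \<and> (\<forall>x\<in>cone. A x * W x = B x * U x)"
  shows "\<exists>r. \<forall>y z. aff y z \<longrightarrow> A (vector [1, y, z]) = B (vector [1, y, z]) * (\<Sum>j<q. poly (r j) z * y ^ j)"
proof -
  let ?x = "\<lambda>y z. vector [1, y, z] :: 'k ^ 3"
  let ?S = "\<lambda>r y z. \<Sum>j<q. poly (r j) z * y ^ j"
  define good where "good d \<longleftrightarrow> d \<noteq> 0 \<and> (\<exists>r. \<forall>y z. aff y z \<longrightarrow> poly d z * A (?x y z) = B (?x y z) * ?S r y z)" for d
  have exS: "expands (?S r) (\<Sum>j<q. at_zeta (r j) * fps_X ^ j)" for r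
    unfolding expands_def by blast
  have psiB: "psi B \<noteq> 0" using psi_zero_iff[OF B(1)] B(2) by blast
  obtain B' d0 where B': "tform B'" "d0 \<noteq> 0" and n: "\<forall>y z. aff y z \<longrightarrow> B (?x y z) * B' (?x y z) = poly d0 z"
    using norm_multiple[OF B] by metis
  have "good d0" unfolding good_def
  proof (intro conjI B')
    obtain r where r: "\<forall>y z. aff y z \<longrightarrow> B' (?x y z) * A (?x y z) = ?S r y z"
      using expands_form[OF tform_mult[OF B'(1) A]] unfolding expands_def by blast
    have "poly d0 z * A (?x y z) = B (?x y z) * ?S r y z" if "aff y z" for y z
      unfolding n[rule_format, OF that, symmetric] r[rule_format, OF that, symmetric] by (simp add: mult.assoc)
    then show "\<exists>r. \<forall>y z. aff y z \<longrightarrow> poly d0 z * A (?x y z) = B (?x y z) * ?S r y z" by blast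
  qed
  then obtain d where d: "good d" and least: "\<And>d'. good d' \<Longrightarrow> degree d \<le> degree d'"
    using ex_has_least_nat[of good d0 degree] by blast
  from d obtain r where d0: "d \<noteq> 0" and r: "\<And>y z. aff y z \<Longrightarrow> poly d z * A (?x y z) = B (?x y z) * ?S r y z"
    unfolding good_def by blast
  have "degree d = 0"
  proof (rule ccontr)
    assume "degree d \<noteq> 0"
    then obtain z0 where z0: "poly d z0 = 0" using alg_closed_imp_poly_has_root[of d] by auto
    then obtain d' where d': "d = [:- z0, 1:] * d'" by (metis dvdE poly_eq_0_iff_dvd)
    then have d'0: "d' \<noteq> 0" using d0 by auto
    have deg: "degree d = Suc (degree d')" unfolding d' using d'0 by (subst degree_mult_eq) auto
    have local: "\<exists>U W. tform U \<and> tform W \<and> W (?x y z) \<noteq> 0 \<and>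
        (\<forall>y z. aff y z \<longrightarrow> ?S r y z * W (?x y z) = poly d z * U (?x y z))" if yz: "aff y z" for y z
    proof -
      from reg[of "?x y z"] yz obtain U W where UW: "tform U" "tform W" "W (?x y z) \<noteq> 0"
        and eq: "\<forall>x\<in>cone. A x * W x = B x * U x" by (auto simp: cone_chart)
      have "?S r y z * W (?x y z) = poly d z * U (?x y z)" if yz: "aff y z" for y z
      proof (rule aff_cancel[OF expands_form[OF B(1)] psiB expands_mult[OF exS[of r] expands_form[OF UW(2)]]
          expands_poly_mult[OF expands_form[OF UW(1)]] _ yz])
        fix y z assume yz: "aff y z"
        then have "?x y z \<in> cone" by (simp add: cone_chart)
        have "B (?x y z) * (?S r y z * W (?x y z)) = (poly d z * A (?x y z)) * W (?x y z)"
          unfolding r[OF yz] by (simp only: mult.assoc)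
        also have "\<dots> = poly d z * (A (?x y z) * W (?x y z))" by (simp only: mult.assoc)
        finally show "B (?x y z) * (?S r y z * W (?x y z)) = B (?x y z) * (poly d z * U (?x y z))"
          unfolding bspec[OF eq \<open>?x y z \<in> cone\<close>] by (simp only: mult_ac)
      qed
      then show ?thesis using UW by blast
    qed
    \<comment> \<open>A root z0 of the minimal denominator is a root of every r_j, so it can be
      divided out, against minimality.\<close>
    have root: "poly (r j) z0 = 0" if j: "j < q" for j
    proof (cases "z0 = 0")
      case False
      show ?thesis
      proof (rule fibre_zero[OF False _ j, of "\<lambda>j. poly (r j) z0"])
        fix y assume y: "aff y z0"
        from local[OF y] obtain U W where "W (?x y z0) \<noteq> 0" "?S r y z0 * W (?x y z0) = poly d z0 * U (?x y z0)"
          using y by blast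
        then show "?S r y z0 = 0" using z0 by simp
      qed
    next
      \<comment> \<open>Over 0 there is one point instead of q. It carries the same information,
        because the first q coefficients of the expansion are the values r_j(0), and d(zeta) is
        divisible by X^q.\<close>
      case True
      then have "aff 0 z0" by (simp add: aff_0)
      from local[OF this] obtain U W where UW: "tform U" "tform W" "W (?x 0 0) \<noteq> 0"
        and eq: "\<forall>y z. aff y z \<longrightarrow> ?S r y z * W (?x y z) = poly d z * U (?x y z)" unfolding True by blast
      have "(\<Sum>j<q. at_zeta (r j) * fps_X ^ j) * psi W = at_zeta d * psi U"
        by (rule expands_unique[OF expands_cong[OF expands_mult[OF exS[of r] expands_form[OF UW(2)]]]
            expands_poly_mult[OF expands_form[OF UW(1)]]]) (use eq in blast)
      moreover have "at_zeta d = zeta * at_zeta d'" unfolding d' True by (simp add: at_zeta_pCons at_zeta_mult)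
      moreover have "fps_X ^ q dvd zeta" using zeta_below by (simp add: fps_X_power_dvd_iff)
      ultimately have "fps_X ^ q dvd (\<Sum>j<q. at_zeta (r j) * fps_X ^ j) * psi W" by (simp add: mult.assoc)
      moreover have "fps_nth (psi W) 0 \<noteq> 0" using UW psi_nth_0 by simp
      ultimately have "fps_X ^ q dvd (\<Sum>j<q. at_zeta (r j) * fps_X ^ j)" by (rule dvd_cancel_unit_fps)
      then show ?thesis using j reduced_fps_nth[OF j, of r] True by (simp add: fps_X_power_dvd_iff)
    qed
    then have "\<forall>j. \<exists>s. j < q \<longrightarrow> r j = [:- z0, 1:] * s" by (metis dvdE poly_eq_0_iff_dvd)
    then obtain s where s: "\<And>j. j < q \<Longrightarrow> r j = [:- z0, 1:] * s j" by metis
    have Srs: "?S r y z = (z - z0) * ?S s y z" for y z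
      unfolding sum_distrib_left
    proof (rule sum.cong[OF refl])
      fix j assume "j \<in> {..<q}"
      then have "poly (r j) z = (z - z0) * poly (s j) z" using s[of j] by (simp add: left_diff_distrib)
      then show "poly (r j) z * y ^ j = (z - z0) * (poly (s j) z * y ^ j)" by simp
    qed
    have "poly d' z * A (?x y z) = B (?x y z) * ?S s y z" if "aff y z" for y z
    proof -
      have m: "expands (\<lambda>y z. poly [:-1:] z * (B (?x y z) * ?S s y z)) (at_zeta [:-1:] * (psi B * (\<Sum>j<q. at_zeta (s j) * fps_X ^ j)))"
        by (intro expands_poly_mult expands_mult expands_form B exS)
      \<comment> \<open>Cancelling z - z0 works off the fibre over z0 and extends to it, as a
        function on the chart is determined off finitely many fibres.\<close>
      have "poly d' z * A (?x y z) + poly [:-1:] z * (B (?x y z) * ?S s y z) = 0"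
      proof (rule aff_cofinite_zero[OF expands_add[OF expands_poly_mult[OF expands_form[OF A]] m], of "{z0}"])
        fix y z assume yz: "aff y z" "z \<notin> {z0}"
        have "(z - z0) * (poly d' z * A (?x y z)) = (z - z0) * (B (?x y z) * ?S s y z)"
          using r[OF yz(1)] unfolding Srs by (simp add: d' algebra_simps)
        then show "poly d' z * A (?x y z) + poly [:-1:] z * (B (?x y z) * ?S s y z) = 0" using yz by simp
      qed (use that in auto)
      then show ?thesis by simp
    qed
    then have "good d'" using d'0 unfolding good_def by blast
    then show False using least[of d'] deg by simp
  qed
  then obtain k where k: "d = [:k:]" "k \<noteq> 0" using d0 by (metis degree_eq_zeroE pCons_0_0)
  have "A (?x y z) = B (?x y z) * ?S (\<lambda>j. smult (1 / k) (r j)) y z" if "aff y z" for y z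
  proof -
    have e: "?S (\<lambda>j. smult (1 / k) (r j)) y z = (1 / k) * ?S r y z" by (simp add: sum_distrib_left)
    have "k * A (?x y z) = B (?x y z) * ?S r y z" using r[OF that] k by simp
    then have "(1 / k) * (k * A (?x y z)) = (1 / k) * (B (?x y z) * ?S r y z)" by (simp only:)
    then show ?thesis unfolding e using k by (simp add: mult.left_commute)
  qed
  then show ?thesis by (intro exI[of _ "\<lambda>j. smult (1 / k) (r j)"] allI impI)
qed

end

section \<open>Orders at the vertices and the shape of the numerators\<close>

context klein_curve
begin

text \<open>The net spanned by the three monomials of the curve equation; the denominator E comes
  from it as well.\<close>

definition cyclic_form :: "'k \<Rightarrow> 'k \<Rightarrow> 'k \<Rightarrow> 'k ^ 3 \<Rightarrow> 'k" where
  "cyclic_form a' b' c' x = a' * x $ 1 * x $ 2 ^ q + b' * x $ 2 * x $ 3 ^ q + c' * x $ 3 * x $ 1 ^ q"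

lemma ternary_form_cyclic: "ternary_form (Suc q) (cyclic_form a' b' c')"
proof -
  have "ternary_form (Suc q) (\<lambda>x. k * x $ i * x $ j ^ q)" for k :: 'k and i j :: 3
    using ternary_form_mult[OF ternary_form_cmult[OF ternary_form_coord[of i], of k] ternary_form_power[OF ternary_form_coord[of j], of q]]
    by simp
  then show ?thesis unfolding cyclic_form_def by (intro ternary_form.add)
qed

lemma cyclic_form_rot: "cyclic_form a' b' c' (rot x) = cyclic_form b' c' a' x"
  by (simp add: cyclic_form_def)

text \<open>All three monomials have order at least q at (1:0:0), as z has order q.\<close>

lemma psi_cyclic_dvd: "fps_X ^ q dvd psi (cyclic_form a' b' c')"
proof -
  have t: "tform (\<lambda>x :: 'k ^ 3. k * x $ i * x $ j ^ q)" for k i j by (intro tform_intros)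
  have t2: "tform (\<lambda>x :: 'k ^ 3. a' * x $ 1 * x $ 2 ^ q + b' * x $ 2 * x $ 3 ^ q)"
  proof -
    have "ternary_form (Suc q) (\<lambda>x :: 'k ^ 3. k * x $ i * x $ j ^ q)" for k :: 'k and i j :: 3
      using ternary_form_mult[OF ternary_form_cmult[OF ternary_form_coord[of i], of k] ternary_form_power[OF ternary_form_coord[of j], of q]]
      by simp
    then show ?thesis by (intro tformI ternary_form.add)
  qed
  have "psi (cyclic_form a' b' c') = fps_const a' * fps_X ^ q + fps_const b' * fps_X * zeta ^ q + fps_const c' * zeta"
    unfolding cyclic_form_def psi_add[OF t2 t] psi_add[OF t t]
    by (simp add: psi_mult psi_power psi_const psi_coord tform_intros)
  moreover have "fps_X ^ q dvd zeta" using zeta_below by (simp add: fps_X_power_dvd_iff)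
  moreover from this have "fps_X ^ q dvd zeta ^ q" using q_pos by (metis dvd_power dvd_trans)
  ultimately show ?thesis by (simp add: dvd_add dvd_mult)
qed

lemma rot_chart_origin: "rot (vector [1, 0, 0] :: 'k ^ 3) = vector [0, 1, 0]"
  "rot (vector [0, 1, 0] :: 'k ^ 3) = vector [0, 0, 1]"
  by (simp_all add: vec3_eq_iff)

text \<open>P / (H E) is regular at the vertex, so the orders of \<open>H\<close> and
  \<open>E\<close> add up to a lower bound for that of \<open>P\<close>. \<open>H\<close> will be
  the power of x_1 introduced by homogenising.\<close>

lemma psi_vertex_dvd:
  assumes P: "tform P" and E: "tform E" and H: "tform H"
    and reg: "\<exists>U W. tform U \<and> tform W \<and> W (vector [1, 0, 0]) \<noteq> 0 \<and> (\<forall>x\<in>cone. P x * W x = H x * (E x * U x))"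
    and dvd: "fps_X ^ m dvd psi H" "fps_X ^ n dvd psi E"
  shows "fps_X ^ (m + n) dvd psi P"
proof -
  obtain U W where UW: "tform U" "tform W" "W (vector [1, 0, 0]) \<noteq> 0" and eq: "\<forall>x\<in>cone. P x * W x = H x * (E x * U x)"
    using reg by blast
  have "psi P * psi W = psi H * (psi E * psi U)"
  proof (rule expands_unique[OF expands_mult[OF expands_form[OF P] expands_form[OF UW(2)]]])
    show "expands (\<lambda>y z. P (vector [1, y, z]) * W (vector [1, y, z])) (psi H * (psi E * psi U))"
      by (rule expands_cong[OF expands_mult[OF expands_form[OF H] expands_mult[OF expands_form[OF E] expands_form[OF UW(1)]]]])
         (use eq in \<open>auto simp: cone_chart\<close>)
  qed
  then have "fps_X ^ (m + n) dvd psi P * psi W"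
    using mult_dvd_mono[OF dvd] by (simp add: power_add mult.assoc[symmetric])
  moreover have "fps_nth (psi W) 0 \<noteq> 0" using psi_nth_0[OF UW(2)] UW(3) by simp
  ultimately show ?thesis by (rule dvd_cancel_unit_fps)
qed

definition mono3 :: "nat \<Rightarrow> nat \<Rightarrow> nat \<Rightarrow> 'k ^ 3 \<Rightarrow> 'k" where
  "mono3 i j k x = x $ 1 ^ i * x $ 2 ^ j * x $ 3 ^ k"

lemma tform_mono3: "tform (mono3 i j k)"
  unfolding mono3_def by (intro tform_intros)

lemma mono3_rot: "mono3 i j k (rot x) = mono3 j k i x"
  by (simp add: mono3_def mult_ac)

lemma psi_mono3: "psi (mono3 i j k) = fps_X ^ j * zeta ^ k"
  unfolding mono3_def by (simp add: psi_mult psi_power psi_coord tform_intros)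

lemma psi_mono3_nz: "psi (mono3 i j k) \<noteq> 0"
  using zeta_nz by (simp add: psi_mono3)

lemma subdegree_psi_mono3: "subdegree (psi (mono3 i j k)) = j + q * k"
  unfolding psi_mono3 using zeta_nz by (subst subdegree_mult) (auto simp: subdegree_power subdegree_zeta)

lemma psi_mono3_sum:
  "tform (\<lambda>x. \<Sum>s\<in>S. g s * mono3 (i s) (j s) (k s) x) \<Longrightarrow>
   psi (\<lambda>x. \<Sum>s\<in>S. g s * mono3 (i s) (j s) (k s) x) = (\<Sum>s\<in>S. fps_const (g s) * psi (mono3 (i s) (j s) (k s)))"
  by (subst psi_sum) (auto intro: tform_intros tform_mono3 simp: psi_mult psi_const tform_const tform_mono3)

text \<open>A term of order below \<open>m\<close> has to be cancelled, which needs another term of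
  at most the same order.\<close>

lemma vertex_order_bound:
  assumes fin: "finite S" and g: "\<And>s. s \<in> S \<Longrightarrow> g s \<noteq> 0"
    and t: "tform (\<lambda>x. \<Sum>s\<in>S. g s * mono3 (i s) (j s) (k s) x)"
    and dvd: "fps_X ^ m dvd psi (\<lambda>x. \<Sum>s\<in>S. g s * mono3 (i s) (j s) (k s) x)"
    and s: "s \<in> S" "j s + q * k s < m"
  shows "\<exists>t\<in>S. t \<noteq> s \<and> j t + q * k t \<le> j s + q * k s"
proof (rule ccontr)
  assume "\<not> ?thesis"
  then have "\<And>t. t \<in> S \<Longrightarrow> t \<noteq> s \<Longrightarrow> subdegree (psi (mono3 (i s) (j s) (k s))) < subdegree (psi (mono3 (i t) (j t) (k t)))"
    by (auto simp: subdegree_psi_mono3)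
  from fps_sum_unique_least_order[of S s g "\<lambda>s. psi (mono3 (i s) (j s) (k s))", OF fin s(1) g[OF s(1)] psi_mono3_nz this
      dvd[unfolded psi_mono3_sum[OF t]]]
  show False using s(2) by (simp add: subdegree_psi_mono3)
qed

definition vertices :: "('k ^ 3) set" where
  "vertices = {vector [1, 0, 0], vector [0, 1, 0], vector [0, 0, 1]}"

lemma vertices_cone: "vertices \<subseteq> cone"
  using q_pos by (auto simp: vertices_def cone_def vec3_eq_iff zero_power)

text \<open>The exponent vectors of the monomials of degree \<open>q + 1\<close> that span the space of forms vanishing
  to order \<open>q\<close> at the three vertices, modulo the equation of the curve.\<close>

definition exponents :: "(nat \<times> nat) set" where
  "exponents = {(j, k). j \<ge> 1 \<and> k \<ge> 1 \<and> j + k \<le> q} \<union> {(0, 1), (1, q)}"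

lemma finite_exponents: "finite exponents"
proof -
  have "exponents \<subseteq> {..q} \<times> {..q}" using q_gt_2 by (auto simp: exponents_def)
  then show ?thesis by (rule finite_subset) simp
qed

lemma exponents_sum: "s \<in> exponents \<Longrightarrow> fst s + snd s \<le> Suc q"
  by (auto simp: exponents_def)

text \<open>For f = A / B: since f E is regular everywhere, it is a polynomial on the chart, and
  since f is regular at the vertices, f E inherits there the zero of E, of order at least q. These
  three lower bounds confine the monomials to \<open>exponents\<close>.\<close>

theorem numerator_form:
  assumes AB: "fpair A B"
    and reg: "\<And>p. p \<in> cone \<Longrightarrow> \<exists>U W. tform U \<and> tform W \<and> W p \<noteq> 0 \<and>
      (\<forall>x\<in>cone. A x * cyclic_form a' b' c' x * W x = B x * U x)"
    and vert: "\<And>p. p \<in> vertices \<Longrightarrow> \<exists>U W. tform U \<and> tform W \<and> W p \<noteq> 0 \<and> (\<forall>x\<in>cone. A x * W x = B x * U x)"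
  shows "\<exists>g. \<forall>x\<in>cone. x $ 1 \<noteq> 0 \<longrightarrow>
    A x * cyclic_form a' b' c' x = B x * (\<Sum>s\<in>exponents. g s * mono3 (Suc q - fst s - snd s) (fst s) (snd s) x)"
proof -
  interpret R: klein_curve q e b c a by (rule rotate)
  interpret R2: klein_curve q e c a b by (rule R.rotate)
  let ?E = "cyclic_form a' b' c'"
  let ?x = "\<lambda>y z. vector [1, y, z] :: 'k ^ 3"
  have E: "tform ?E" using ternary_form_cyclic tformI by blast
  note AB' = fpair_tform[OF AB]
  obtain r where r: "\<And>y z. aff y z \<Longrightarrow> A (?x y z) * ?E (?x y z) = B (?x y z) * (\<Sum>j<q. poly (r j) z * y ^ j)"
    using polynomial_of_regular[OF tform_mult[OF AB'(1) E] AB'(2,3) reg] by blast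
  define S where "S = {(j, k). j < q \<and> k \<le> degree (r j) \<and> Polynomial.coeff (r j) k \<noteq> 0}"
  define g where "g s = Polynomial.coeff (r (fst s)) (snd s)" for s
  have "S \<subseteq> (SIGMA j:{..<q}. {..degree (r j)})" by (auto simp: S_def)
  then have fin: "finite S" by (rule finite_subset) auto
  have g: "g s \<noteq> 0" if "s \<in> S" for s using that by (auto simp: S_def g_def)
  have rS: "(\<Sum>j<q. poly (r j) z * y ^ j) = (\<Sum>s\<in>S. g s * (y ^ fst s * z ^ snd s))" for y z
  proof -
    have "(\<Sum>j<q. poly (r j) z * y ^ j) = (\<Sum>j<q. \<Sum>k\<le>degree (r j). g (j, k) * (y ^ j * z ^ k))"
      by (simp add: poly_altdef sum_distrib_right sum_distrib_left g_def mult_ac)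
    also have "\<dots> = (\<Sum>s\<in>(SIGMA j:{..<q}. {..degree (r j)}). g s * (y ^ fst s * z ^ snd s))"
      by (subst sum.Sigma) (auto simp: case_prod_beta)
    also have "\<dots> = (\<Sum>s\<in>S. g s * (y ^ fst s * z ^ snd s))"
      by (rule sum.mono_neutral_right) (auto simp: S_def g_def)
    finally show ?thesis .
  qed
  \<comment> \<open>\<open>P\<close> stands for x_1^M A E / B. With this \<open>M\<close> every
    monomial of \<open>P\<close> keeps a positive power of x_1, so the identity is trivial on x_1 =
    0.\<close>
  define M where "M = Suc (\<Sum>s\<in>S. fst s + snd s)"
  define D where "D = M + Suc q"
  have sD: "fst s + snd s < D - q" if "s \<in> S" for s
    using member_le_sum[OF that, of "\<lambda>s. fst s + snd s"] fin by (simp add: D_def M_def)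
  define P where "P x = (\<Sum>s\<in>S. g s * mono3 (D - fst s - snd s) (fst s) (snd s) x)" for x
  then have P_eq: "P = (\<lambda>x. \<Sum>s\<in>S. g s * mono3 (D - fst s - snd s) (fst s) (snd s) x)" by (rule ext)
  have Pf: "ternary_form D P" unfolding P_def mono3_def
    by (intro ternary_form_sum ternary_form_cmult ternary_form_monomial) (use sD in fastforce)
  then have P: "tform P" by (rule tformI)
  obtain d where d: "ternary_form d A" "ternary_form d B" using AB by (auto simp: fpair_def)
  have main: "x $ 1 ^ M * (A x * ?E x) = B x * P x" if x: "x \<in> cone" for x
  proof (cases "x $ 1 = 0")
    case True
    have "P x = 0" unfolding P_def
    proof (rule sum.neutral, rule)
      fix s assume "s \<in> S"
      then have "D - fst s - snd s > 0" using sD[of s] by simp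
      then show "g s * mono3 (D - fst s - snd s) (fst s) (snd s) x = 0" using True by (simp add: mono3_def)
    qed
    then show ?thesis using True by (simp add: M_def)
  next
    case False
    obtain y z where yz: "aff y z" and xx: "x = x $ 1 *s ?x y z" using cone_chartE[OF x False] .
    define t where "t = x $ 1"
    have xx: "x = t *s ?x y z" using xx t_def by simp
    have Pyz: "P (?x y z) = (\<Sum>j<q. poly (r j) z * y ^ j)" by (simp add: rS P_def mono3_def)
    show ?thesis unfolding xx ternary_form_homogeneous[OF d(1)] ternary_form_homogeneous[OF d(2)]
      ternary_form_homogeneous[OF Pf] ternary_form_homogeneous[OF ternary_form_cyclic]
      using r[OF yz] by (simp add: Pyz D_def power_add mult_ac)
  qed
  have vertP: "\<exists>U W. tform U \<and> tform W \<and> W p \<noteq> 0 \<and> (\<forall>x\<in>cone. P x * W x = x $ 1 ^ M * (?E x * U x))"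
    if "p \<in> vertices" for p
  proof -
    from vert[OF that] obtain U W where UW: "tform U" "tform W" "W p \<noteq> 0" and eq: "\<forall>x\<in>cone. A x * W x = B x * U x" by blast
    have "P x * W x = x $ 1 ^ M * (?E x * U x)" if "x \<in> cone" for x
    proof (rule cone_cancel[OF AB'(2,3) _ _ _ that])
      show "tform (\<lambda>x. P x * W x)" "tform (\<lambda>x. x $ 1 ^ M * (?E x * U x))" by (intro tform_intros P UW E)+
      fix x assume x: "x \<in> cone"
      have "B x * (P x * W x) = (B x * P x) * W x" by (simp only: mult.assoc)
      also have "\<dots> = x $ 1 ^ M * ?E x * (A x * W x)" unfolding main[OF x, symmetric] by (simp only: mult_ac)
      finally show "B x * (P x * W x) = B x * (x $ 1 ^ M * (?E x * U x))" unfolding bspec[OF eq x] by (simp only: mult_ac)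
    qed
    then show ?thesis using UW by blast
  qed
  \<comment> \<open>The factor x_1^M has order 0, q M and M at the three vertices, where x_1 becomes
    x_1, x_3 and x_2 after rotation.\<close>
  have H: "tform (\<lambda>x :: 'k ^ 3. x $ i ^ M)" for i by (intro tform_intros)
  have v1: "fps_X ^ (0 + q) dvd psi P"
    by (rule psi_vertex_dvd[OF P E H vertP]) (auto simp: vertices_def psi_cyclic_dvd)
  have rP: "(\<lambda>x. P (rot x)) = (\<lambda>x. \<Sum>s\<in>S. g s * mono3 (fst s) (snd s) (D - fst s - snd s) x)"
    "(\<lambda>x. P (rot (rot x))) = (\<lambda>x. \<Sum>s\<in>S. g s * mono3 (snd s) (D - fst s - snd s) (fst s) x)"
    by (simp_all add: P_def mono3_rot)
  have v2: "fps_X ^ (q * M + q) dvd R.psi (\<lambda>x. P (rot x))"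
  proof (rule R.psi_vertex_dvd[OF tform_rot[OF P] tform_rot[OF E] H[of 3]])
    from vertP[of "vector [0, 1, 0]"] obtain U W where UW: "tform U" "tform W" "W (vector [0, 1, 0]) \<noteq> 0"
      and eq: "\<forall>x\<in>cone. P x * W x = x $ 1 ^ M * (?E x * U x)" by (auto simp: vertices_def)
    show "\<exists>U W. tform U \<and> tform W \<and> W (vector [1, 0, 0]) \<noteq> 0 \<and>
      (\<forall>x\<in>R.cone. P (rot x) * W x = x $ 3 ^ M * (?E (rot x) * U x))"
      using tform_rot[OF UW(1)] tform_rot[OF UW(2)] UW(3) eq rot_cone rot_chart_origin
      by (intro exI[of _ "\<lambda>x. U (rot x)"] exI[of _ "\<lambda>x. W (rot x)"]) auto
    have "fps_X ^ q dvd R.zeta" using R.zeta_below by (simp add: fps_X_power_dvd_iff)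
    then show "fps_X ^ (q * M) dvd R.psi (\<lambda>x. x $ 3 ^ M)"
      by (simp add: R.psi_power R.psi_coord tform_coord power_mult dvd_power_same)
    show "fps_X ^ q dvd R.psi (\<lambda>x. ?E (rot x))" unfolding cyclic_form_rot by (rule R.psi_cyclic_dvd)
  qed
  have v3: "fps_X ^ (M + q) dvd R2.psi (\<lambda>x. P (rot (rot x)))"
  proof (rule R2.psi_vertex_dvd[OF tform_rot[OF tform_rot[OF P]] tform_rot[OF tform_rot[OF E]] H[of 2]])
    from vertP[of "vector [0, 0, 1]"] obtain U W where UW: "tform U" "tform W" "W (vector [0, 0, 1]) \<noteq> 0"
      and eq: "\<forall>x\<in>cone. P x * W x = x $ 1 ^ M * (?E x * U x)" by (auto simp: vertices_def)
    show "\<exists>U W. tform U \<and> tform W \<and> W (vector [1, 0, 0]) \<noteq> 0 \<and>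
      (\<forall>x\<in>R2.cone. P (rot (rot x)) * W x = x $ 2 ^ M * (?E (rot (rot x)) * U x))"
      using tform_rot[OF tform_rot[OF UW(1)]] tform_rot[OF tform_rot[OF UW(2)]] UW(3) eq rot_rot_cone rot_chart_origin
      by (intro exI[of _ "\<lambda>x. U (rot (rot x))"] exI[of _ "\<lambda>x. W (rot (rot x))"]) auto
    show "fps_X ^ M dvd R2.psi (\<lambda>x. x $ 2 ^ M)" by (simp add: R2.psi_power R2.psi_coord tform_coord)
    show "fps_X ^ q dvd R2.psi (\<lambda>x. ?E (rot (rot x)))" unfolding cyclic_form_rot by (rule R2.psi_cyclic_dvd)
  qed
  have S_exp: "s \<in> exponents" if s: "s \<in> S" for s
  proof -
    obtain j k where jk: "s = (j, k)" by force
    have D1: "D = M + Suc q" by (rule D_def)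
    have "j \<ge> 1 \<and> k \<ge> 1 \<and> j + k \<le> q \<or> j = 0 \<and> k = 1 \<or> j = 1 \<and> k = q"
    proof (rule monomial_support[OF q_gt_2 fin, of j k])
      show "(j, k) \<in> S" using s jk by simp
    next
      fix j k assume s: "(j, k) \<in> S"
      \<comment> \<open>A pure power of y has order j < q at (1:0:0); the smallest one cannot be
        cancelled, because a factor z contributes order q.\<close>
      have "k \<noteq> 0"
      proof
        assume k: "k = 0"
        then obtain j0 where j0: "(j0, 0) \<in> S" and least: "\<And>j. (j, 0) \<in> S \<Longrightarrow> j0 \<le> j"
          using ex_has_least_nat[of "\<lambda>j. (j, 0) \<in> S" j "\<lambda>j. j"] s by auto
        have "j0 < q" using j0 by (simp add: S_def)
        have "\<exists>t\<in>S. t \<noteq> (j0, 0) \<and> fst t + q * snd t \<le> fst (j0, 0::nat) + q * snd (j0, 0::nat)"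
          by (rule vertex_order_bound[OF fin g P[unfolded P_eq] v1[unfolded P_eq]])
             (use j0 \<open>j0 < q\<close> in simp_all)
        then obtain t where t: "t \<in> S" "t \<noteq> (j0, 0)" "fst t + q * snd t \<le> j0" by auto
        then have "snd t = 0" using \<open>j0 < q\<close> by (cases "snd t") auto
        then show False using t least[of "fst t"] by (cases t) auto
      qed
      then show "j < q \<and> 1 \<le> k" using s by (auto simp: S_def)
    next
      fix j k assume s: "(j, k) \<in> S" and big: "q * j + (q - 1) * k > q ^ 2"
      \<comment> \<open>At (0:1:0) a monomial has order q M + q^2 + q - \<alpha> with \<alpha> = q j
        + (q-1) k, so the bound q M + q means \<alpha> \<le> q^2.\<close>
      have order: "int (l + q * (D - i - l)) = int (q * M) + int (q ^ 2) + int q - int (q * i + (q - 1) * l)"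
        if "(i, l) \<in> S" for i l
      proof -
        have "int (D - i - l) = int M + int q + 1 - int i - int l" using sD[OF that] by (simp add: D_def)
        moreover have "int (q - 1) = int q - 1" using q_pos by simp
        ultimately show ?thesis by (simp only: of_nat_add of_nat_mult of_nat_power) (simp add: algebra_simps power2_eq_square)
      qed
      have "int (k + q * (D - j - k)) < int (q * M + q)" using order[OF s] big by linarith
      then have lt: "k + q * (D - j - k) < q * M + q" by linarith
      have "\<exists>t\<in>S. t \<noteq> (j, k) \<and> snd t + q * (D - fst t - snd t) \<le> snd (j, k) + q * (D - fst (j, k) - snd (j, k))"
        by (rule R.vertex_order_bound[where i = fst and g = g and m = "q * M + q", OF fin g])
           (use tform_rot[OF P] v2 s lt in \<open>simp_all add: rP\<close>)
      then obtain j' k' where t: "(j', k') \<in> S" "(j', k') \<noteq> (j, k)" "k' + q * (D - j' - k') \<le> k + q * (D - j - k)"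
        by force
      have "int (q * j' + (q - 1) * k') \<ge> int (q * j + (q - 1) * k)"
        using order[OF s] order[OF t(1)] t(3) by linarith
      then have "q * j' + (q - 1) * k' \<ge> q * j + (q - 1) * k" by linarith
      then show "\<exists>j' k'. (j', k') \<in> S \<and> (j', k') \<noteq> (j, k) \<and> q * j' + (q - 1) * k' \<ge> q * j + (q - 1) * k"
        using t by blast
    next
      fix j k assume s: "(j, k) \<in> S" and big: "k > (q - 1) * j + 1"
      \<comment> \<open>At (0:0:1) the order is M + q + 1 - \<beta> with \<beta> = k - (q-1) j, so
        the bound M + q means \<beta> \<le> 1.\<close>
      have order: "int ((D - i - l) + q * i) = int M + int q + 1 - int l + int ((q - 1) * i)" if "(i, l) \<in> S" for i l
      proof -
        have "int (D - i - l) = int M + int q + 1 - int i - int l" using sD[OF that] by (simp add: D_def)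
        moreover have "int (q - 1) = int q - 1" using q_pos by simp
        ultimately show ?thesis by (simp only: of_nat_add of_nat_mult) (simp add: algebra_simps)
      qed
      have "int ((D - j - k) + q * j) < int (M + q)" using order[OF s] big by linarith
      then have lt: "(D - j - k) + q * j < M + q" by linarith
      have "\<exists>t\<in>S. t \<noteq> (j, k) \<and> (D - fst t - snd t) + q * fst t \<le> (D - fst (j, k) - snd (j, k)) + q * fst (j, k)"
        by (rule R2.vertex_order_bound[where i = snd and g = g and m = "M + q", OF fin g])
           (use tform_rot[OF tform_rot[OF P]] v3 s lt in \<open>simp_all add: rP\<close>)
      then obtain j' k' where t: "(j', k') \<in> S" "(j', k') \<noteq> (j, k)" "(D - j' - k') + q * j' \<le> (D - j - k) + q * j"
        by force
      have "int (k' + (q - 1) * j) \<ge> int (k + (q - 1) * j')"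
        using order[OF s] order[OF t(1)] t(3) by linarith
      then have "k' + (q - 1) * j \<ge> k + (q - 1) * j'" by linarith
      then show "\<exists>j' k'. (j', k') \<in> S \<and> (j', k') \<noteq> (j, k) \<and> k' + (q - 1) * j \<ge> k + (q - 1) * j'"
        using t by blast
    qed
    then show ?thesis by (auto simp: jk exponents_def)
  qed
  define g' where "g' s = (if s \<in> S then g s else 0)" for s
  have fin_sum: "(\<Sum>s\<in>exponents. g' s * h s) = (\<Sum>s\<in>S. g s * h s)" for h
    by (rule sum.mono_neutral_cong_right) (use finite_exponents S_exp in \<open>auto simp: g'_def\<close>)
  show ?thesis
  proof (intro exI[of _ g'] ballI impI)
    fix x assume x: "x \<in> cone" "x $ 1 \<noteq> 0"
    have "x $ 1 ^ M * (A x * ?E x) = x $ 1 ^ M * (B x * (\<Sum>s\<in>exponents. g' s * mono3 (Suc q - fst s - snd s) (fst s) (snd s) x))"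
    proof -
      have "P x = x $ 1 ^ M * (\<Sum>s\<in>S. g s * mono3 (Suc q - fst s - snd s) (fst s) (snd s) x)"
        unfolding P_def sum_distrib_left
      proof (rule sum.cong[OF refl])
        fix s assume "s \<in> S"
        then have "fst s + snd s \<le> Suc q" using exponents_sum S_exp by blast
        then have "D - fst s - snd s = M + (Suc q - fst s - snd s)" by (simp add: D_def)
        then show "g s * mono3 (D - fst s - snd s) (fst s) (snd s) x =
          x $ 1 ^ M * (g s * mono3 (Suc q - fst s - snd s) (fst s) (snd s) x)"
          by (simp add: mono3_def power_add mult_ac)
      qed
      then show ?thesis unfolding main[OF x(1)] fin_sum by (simp add: mult_ac)
    qed
    then show "A x * ?E x = B x * (\<Sum>s\<in>exponents. g' s * mono3 (Suc q - fst s - snd s) (fst s) (snd s) x)"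
      using x(2) by simp
  qed
qed

end

section \<open>Forms vanishing to order q at the vertices\<close>

context klein_curve
begin

text \<open>Membership in the ideal of x_3 and x_1 x_2^q, which ensures order at least q at (1:0:0).
  The cofactors are part of the definition so that the quotient by E can be written down.\<close>

definition vanishing_at_origin :: "('k ^ 3 \<Rightarrow> 'k) \<Rightarrow> bool" where
  "vanishing_at_origin F \<longleftrightarrow> (\<exists>F' u. ternary_form q F' \<and> (\<forall>x. F x = x $ 3 * F' x + u * x $ 1 * x $ 2 ^ q))"

definition adjoint_form :: "('k ^ 3 \<Rightarrow> 'k) \<Rightarrow> bool" where
  "adjoint_form F \<longleftrightarrow> vanishing_at_origin F \<and> vanishing_at_origin (\<lambda>x. F (rot x)) \<and>
     vanishing_at_origin (\<lambda>x. F (rot (rot x)))"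

lemma ternary_form_vanishing: "vanishing_at_origin F \<Longrightarrow> ternary_form (Suc q) F"
proof -
  assume "vanishing_at_origin F"
  then obtain F' u where F': "ternary_form q F'" and F: "\<And>x. F x = x $ 3 * F' x + u * x $ 1 * x $ 2 ^ q"
    unfolding vanishing_at_origin_def by blast
  have "ternary_form (Suc q) (\<lambda>x :: 'k ^ 3. u * x $ 1 * x $ 2 ^ q)"
    using ternary_form_mult[OF ternary_form_cmult[OF ternary_form_coord[of 1], of u] ternary_form_power[OF ternary_form_coord[of 2], of q]]
    by simp
  from ternary_form.add[OF ternary_form.coord[OF F', of 3] this] show ?thesis
    by (simp flip: F)
qed

lemma vanishing_add: "vanishing_at_origin F \<Longrightarrow> vanishing_at_origin G \<Longrightarrow> vanishing_at_origin (\<lambda>x. F x + G x)"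
proof -
  assume "vanishing_at_origin F" "vanishing_at_origin G"
  then obtain F' u G' v where "ternary_form q F'" "\<And>x. F x = x $ 3 * F' x + u * x $ 1 * x $ 2 ^ q"
    "ternary_form q G'" "\<And>x. G x = x $ 3 * G' x + v * x $ 1 * x $ 2 ^ q"
    unfolding vanishing_at_origin_def by blast
  then show ?thesis unfolding vanishing_at_origin_def
    by (intro exI[of _ "\<lambda>x. F' x + G' x"] exI[of _ "u + v"]) (auto intro: ternary_form.add simp: algebra_simps)
qed

lemma vanishing_cmult: "vanishing_at_origin F \<Longrightarrow> vanishing_at_origin (\<lambda>x. k * F x)"
proof -
  assume "vanishing_at_origin F"
  then obtain F' u where "ternary_form q F'" "\<And>x. F x = x $ 3 * F' x + u * x $ 1 * x $ 2 ^ q"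
    unfolding vanishing_at_origin_def by blast
  then show ?thesis unfolding vanishing_at_origin_def
    by (intro exI[of _ "\<lambda>x. k * F' x"] exI[of _ "k * u"]) (auto intro: ternary_form_cmult simp: algebra_simps)
qed

lemma adjoint_add: "adjoint_form F \<Longrightarrow> adjoint_form G \<Longrightarrow> adjoint_form (\<lambda>x. F x + G x)"
  by (simp add: adjoint_form_def vanishing_add)

lemma adjoint_cmult: "adjoint_form F \<Longrightarrow> adjoint_form (\<lambda>x. k * F x)"
  by (simp add: adjoint_form_def vanishing_cmult)

text \<open>The rotation-stable list, with all three monomials of the curve equation;
  \<open>exponents\<close> omits x_1 x_2^q, which the equation expresses by the other two.\<close>

definition adjoint_exponents :: "(nat \<times> nat \<times> nat) set" where
  "adjoint_exponents = {(i, j, k). i \<ge> 1 \<and> j \<ge> 1 \<and> k \<ge> 1 \<and> i + j + k = Suc q} \<union> {(1, q, 0), (0, 1, q), (q, 0, 1)}"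

lemma adjoint_exponents_rot: "(i, j, k) \<in> adjoint_exponents \<Longrightarrow> (j, k, i) \<in> adjoint_exponents"
  by (auto simp: adjoint_exponents_def)

lemma vanishing_mono3: "(i, j, k) \<in> adjoint_exponents \<Longrightarrow> vanishing_at_origin (mono3 i j k)"
proof -
  assume m: "(i, j, k) \<in> adjoint_exponents"
  show ?thesis
  proof (cases k)
    case 0
    then have "i = 1" "j = q" using m q_gt_2 by (auto simp: adjoint_exponents_def)
    then show ?thesis unfolding vanishing_at_origin_def
      using 0 by (intro exI[of _ "\<lambda>x. 0"] exI[of _ 1]) (auto simp: mono3_def intro: ternary_form_zero)
  next
    case (Suc k')
    have "q = i + j + k'" using m Suc by (auto simp: adjoint_exponents_def)
    from ternary_form_monomial[OF this] show ?thesis unfolding vanishing_at_origin_def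
      using Suc by (intro exI[of _ "\<lambda>x. x $ 1 ^ i * x $ 2 ^ j * x $ 3 ^ k'"] exI[of _ 0]) (auto simp: mono3_def)
  qed
qed

lemma adjoint_mono3:
  assumes "(i, j, k) \<in> adjoint_exponents"
  shows "adjoint_form (mono3 i j k)"
proof -
  note 1 = adjoint_exponents_rot[OF assms]
  note 2 = adjoint_exponents_rot[OF 1]
  show ?thesis unfolding adjoint_form_def mono3_rot
    using vanishing_mono3[OF assms] vanishing_mono3[OF 1] vanishing_mono3[OF 2] by simp
qed

text \<open>At $(1:0:0)$ both \<open>F\<close> and the cyclic form are multiples of \<open>X\<^sub>1 X\<^sub>2\<^sup>q\<close> in the local ring.\<close>

lemma vertex_regular:
  assumes F: "vanishing_at_origin F" and minor: "a' * c \<noteq> a * c'"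
  shows "\<exists>U V. ternary_form q U \<and> ternary_form q V \<and> V (vector [1, 0, 0]) \<noteq> 0 \<and>
    (\<forall>x\<in>cone. F x * V x = U x * cyclic_form a' b' c' x)"
proof -
  obtain F' u where F': "ternary_form q F'" and F: "\<And>x. F x = x $ 3 * F' x + u * x $ 1 * x $ 2 ^ q"
    using F unfolding vanishing_at_origin_def by blast
  \<comment> \<open>On the curve x_3 e1 = - a x_1 x_2^q, while the cyclic form is a' x_1 x_2^q + x_3
    e2. Multiplied by e1, \<open>F\<close> and the cyclic form become x_1 x_2^q U and x_1 x_2^q V,
    and V takes the value a' c - a c' at the vertex.\<close>
  define e1 where "e1 x = c * x $ 1 ^ q + b * (x $ 2 * x $ 3 ^ (q - 1))" for x :: "'k ^ 3"
  define e2 where "e2 x = c' * x $ 1 ^ q + b' * (x $ 2 * x $ 3 ^ (q - 1))" for x :: "'k ^ 3"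
  define V where "V x = a' * e1 x - a * e2 x" for x
  define U where "U x = u * e1 x - a * F' x" for x
  have f: "ternary_form q (\<lambda>x :: 'k ^ 3. k * x $ 1 ^ q + l * (x $ 2 * x $ 3 ^ (q - 1)))" for k l :: 'k
  proof (intro ternary_form.add ternary_form_cmult)
    show "ternary_form q (\<lambda>x :: 'k ^ 3. x $ 1 ^ q)" using ternary_form_power[OF ternary_form_coord[of 1], of q] by simp
    show "ternary_form q (\<lambda>x :: 'k ^ 3. x $ 2 * x $ 3 ^ (q - 1))"
      using ternary_form_mult[OF ternary_form_coord[of 2] ternary_form_power[OF ternary_form_coord[of 3], of "q - 1"]] q_pos by simp
  qed
  have e1f: "ternary_form q e1" and e2f: "ternary_form q e2" unfolding e1_def e2_def by (rule f)+
  have V: "ternary_form q V" and U: "ternary_form q U"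
    unfolding V_def U_def by (intro ternary_form_diff ternary_form_cmult e1f e2f F')+
  have V0: "V (vector [1, 0, 0]) \<noteq> 0" using minor q_gt_2 by (simp add: V_def e1_def e2_def)
  have p: "w * w ^ (q - 1) = w ^ q" for w :: 'k using q_pos by (simp flip: power_Suc)
  have X3: "x $ 3 * (k * x $ 1 ^ q + l * (x $ 2 * x $ 3 ^ (q - 1))) = k * x $ 3 * x $ 1 ^ q + l * x $ 2 * x $ 3 ^ q"
    for k l :: 'k and x :: "'k ^ 3"
  proof -
    have "x $ 3 * (k * x $ 1 ^ q + l * (x $ 2 * x $ 3 ^ (q - 1))) = k * x $ 3 * x $ 1 ^ q + l * x $ 2 * (x $ 3 * x $ 3 ^ (q - 1))"
      by (simp add: algebra_simps)
    then show ?thesis unfolding p .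
  qed
  have rel: "x $ 3 * e1 x = - (a * x $ 1 * x $ 2 ^ q)" if "x \<in> cone" for x
  proof -
    have "a * x $ 1 * x $ 2 ^ q + x $ 3 * e1 x = 0"
      unfolding e1_def X3 using that by (simp add: cone_def algebra_simps)
    then show ?thesis by (simp only: add_eq_0_iff)
  qed
  have E: "cyclic_form a' b' c' x = a' * x $ 1 * x $ 2 ^ q + x $ 3 * e2 x" for x
    unfolding e2_def X3 by (simp add: cyclic_form_def algebra_simps)
  have "F x * V x = U x * cyclic_form a' b' c' x" if "x \<in> cone" for x
  proof (rule cone_cancel[of e1 "\<lambda>x. F x * V x" "\<lambda>x. U x * cyclic_form a' b' c' x", OF _ _ _ _ _ that])
    show "tform e1" using e1f by (rule tformI)
    have "e1 (vector [1, 0, 0]) \<noteq> 0" using nz q_gt_2 by (simp add: e1_def)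
    moreover have "vector [1, 0, 0] \<in> cone" using vertices_cone by (auto simp: vertices_def)
    ultimately show "\<exists>x\<in>cone. e1 x \<noteq> 0" by blast
    have "tform F" using ternary_form_vanishing assms(1) tformI by blast
    then show "tform (\<lambda>x. F x * V x)" using V by (intro tform_mult) (auto intro: tformI)
    show "tform (\<lambda>x. U x * cyclic_form a' b' c' x)"
      using U ternary_form_cyclic by (intro tform_mult) (auto intro: tformI)
    fix x assume x: "x \<in> cone"
    have "e1 x * F x = F' x * (x $ 3 * e1 x) + u * e1 x * x $ 1 * x $ 2 ^ q" by (simp add: F algebra_simps)
    then have 1: "e1 x * F x = x $ 1 * x $ 2 ^ q * U x" unfolding rel[OF x] by (simp add: U_def algebra_simps)
    have "e1 x * cyclic_form a' b' c' x = a' * e1 x * x $ 1 * x $ 2 ^ q + e2 x * (x $ 3 * e1 x)" by (simp add: E algebra_simps)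
    then have 2: "e1 x * cyclic_form a' b' c' x = x $ 1 * x $ 2 ^ q * V x" unfolding rel[OF x] by (simp add: V_def algebra_simps)
    have "e1 x * (F x * V x) = (x $ 1 * x $ 2 ^ q * V x) * U x" using 1 by (simp flip: mult.assoc)
    also have "\<dots> = e1 x * (U x * cyclic_form a' b' c' x)" unfolding 2[symmetric] by (simp add: mult_ac)
    finally show "e1 x * (F x * V x) = e1 x * (U x * cyclic_form a' b' c' x)" .
  qed
  then show ?thesis using U V V0 by blast
qed

text \<open>The curves meet transversally: as q-th powers have derivative 0, the Jacobian of the two
  equations with respect to y and z is z0^q (b' c - b c') up to sign.\<close>

lemma simple_zero:
  assumes "aff y0 z0" "z0 \<noteq> 0" and minor: "b' * c \<noteq> b * c'" and zero: "cyclic_form a' b' c' (vector [1, y0, z0]) = 0"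
  shows "\<exists>U W. tform U \<and> tform W \<and> U (vector [1, y0, z0]) \<noteq> 0 \<and> W (vector [1, y0, z0]) \<noteq> 0 \<and>
    (\<forall>x\<in>cone. cyclic_form a' b' c' x * W x = (x $ 2 - y0 * x $ 1) ^ 1 * U x)"
proof -
  let ?p = "vector [1, y0, z0] :: 'k ^ 3"
  define Y Z where "Y x = x $ 2 - y0 * x $ 1" and "Z x = x $ 3 - z0 * x $ 1" for x :: "'k ^ 3"
  define S where "S k l x = k * x $ 1 * Y x ^ (q - 1) + l * x $ 3 ^ q" for k l x
  define V where "V k l x = l * y0 * x $ 1 * Z x ^ (q - 1) + k * x $ 1 ^ q" for k l x
  define U where "U x = S a' b' x * V c b x - S a b x * V c' b' x" for x
  have Yf: "ternary_form 1 Y" and Zf: "ternary_form 1 Z"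
    unfolding Y_def Z_def by (intro ternary_form_diff ternary_form_cmult ternary_form_coord)+
  have e: "ternary_form q (\<lambda>x. k * x $ 1 * S x ^ (q - 1))" if "ternary_form 1 S" for S and k :: 'k
    using ternary_form_mult[OF ternary_form_cmult[OF ternary_form_coord[of 1], of k] ternary_form_power[OF that, of "q - 1"]] q_pos
    by simp
  have f: "ternary_form q (\<lambda>x :: 'k ^ 3. k * x $ i ^ q)" for k :: 'k and i
    using ternary_form_cmult[OF ternary_form_power[OF ternary_form_coord[of i], of q], of k] by simp
  have Sf: "ternary_form q (S k l)" for k l unfolding S_def by (intro ternary_form.add e f Yf)
  have Vf: "ternary_form q (V k l)" for k l unfolding V_def by (intro ternary_form.add e f Zf)
  have Uf: "ternary_form (q + q) U" unfolding U_def by (intro ternary_form_diff ternary_form_mult Sf Vf)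
  have "Y ?p = 0" "Z ?p = 0" by (simp_all add: Y_def Z_def)
  then have "U ?p = z0 ^ q * (b' * c - b * c')" "V c b ?p = c"
    using q_gt_2 by (simp_all add: U_def S_def V_def zero_power algebra_simps)
  then have p: "U ?p \<noteq> 0" "V c b ?p \<noteq> 0" using assms(2) minor nz by simp_all
  have "cyclic_form a' b' c' x * V c b x = Y x ^ 1 * U x" if "x \<in> cone" for x
  proof -
    have z: "a' * y0 ^ q + b' * y0 * z0 ^ q + c' * z0 = 0" using zero by (simp add: cyclic_form_def)
    have h: "a * y0 ^ q + b * y0 * z0 ^ q + c * z0 = 0" using assms(1) by (simp add: aff_def)
    have H: "0 = Y x * S a b x + Z x * V c b x"
      using that curve_expansion[of a x b c y0 z0] unfolding h by (simp add: cone_def Y_def Z_def S_def V_def)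
    have E: "cyclic_form a' b' c' x = Y x * S a' b' x + Z x * V c' b' x"
      using curve_expansion[of a' x b' c' y0 z0] unfolding z by (simp add: cyclic_form_def Y_def Z_def S_def V_def)
    have ZV: "Z x * V c b x = - (Y x * S a b x)" using H by (metis add_eq_0_iff)
    have "cyclic_form a' b' c' x * V c b x = Y x * S a' b' x * V c b x + (Z x * V c b x) * V c' b' x"
      by (simp add: E algebra_simps)
    then show ?thesis unfolding ZV by (simp add: U_def algebra_simps)
  qed
  then show ?thesis using p Uf Vf[of c b] tformI unfolding Y_def by blast
qed

end

section \<open>The pencil spanned by the curve and a second cyclic form\<close>

text \<open>Each minor governs one vertex, where it makes every adjoint form locally a multiple of
  the second form; the one in b and c also gives transversality off the triangle.\<close>

locale klein_pencil = klein_curve q e a b c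
  for q e :: nat and a b c :: "'k::alg_closed_field" +
  fixes a' b' c' :: 'k
  assumes minors: "a' * c \<noteq> a * c'" "b' * c \<noteq> b * c'" "a' * b \<noteq> a * b'"
begin

abbreviation "E \<equiv> cyclic_form a' b' c'"

text \<open>The second form vanishes at the vertices too; those common zeros are left out, since the
  numerators cancel them.\<close>

definition base_points :: "'k point set" where
  "base_points = {pt p | p. p \<in> cone \<and> E p = 0 \<and> p $ 1 \<noteq> 0 \<and> p $ 2 \<noteq> 0 \<and> p $ 3 \<noteq> 0}"

lemma tform_E: "tform E" using ternary_form_cyclic by (rule tformI)

lemma pt_eq_iff: "pt p = pt p' \<longleftrightarrow> (\<exists>k. k \<noteq> 0 \<and> p' = k *s p)"
proof
  assume "pt p = pt p'"
  then have "p' \<in> pt p" using self_mem_pt[of p'] by simp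
  then show "\<exists>k. k \<noteq> 0 \<and> p' = k *s p" by (simp add: mem_pt)
next
  assume "\<exists>k. k \<noteq> 0 \<and> p' = k *s p"
  then obtain k where k: "k \<noteq> 0" "p' = k *s p" by blast
  show "pt p = pt p'"
  proof (intro subset_antisym subsetI)
    fix x assume "x \<in> pt p"
    then obtain l where "l \<noteq> 0" "x = l *s p" by (auto simp: mem_pt)
    then show "x \<in> pt p'" unfolding mem_pt k(2) using k(1) by (intro exI[of _ "l / k"]) (simp add: vec_eq_iff)
  next
    fix x assume "x \<in> pt p'"
    then obtain l where "l \<noteq> 0" "x = l *s p'" by (auto simp: mem_pt)
    then show "x \<in> pt p" unfolding mem_pt k(2) using k(1) by (intro exI[of _ "l * k"]) (simp add: vec_eq_iff)
  qed
qed

lemma base_points_iff: "p \<in> cone \<Longrightarrow> pt p \<in> base_points \<longleftrightarrow> E p = 0 \<and> p $ 1 \<noteq> 0 \<and> p $ 2 \<noteq> 0 \<and> p $ 3 \<noteq> 0"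
proof
  assume "pt p \<in> base_points"
  then obtain p' where p': "pt p' = pt p" "E p' = 0" "p' $ 1 \<noteq> 0" "p' $ 2 \<noteq> 0" "p' $ 3 \<noteq> 0"
    by (auto simp: base_points_def)
  then obtain k where "k \<noteq> 0" "p = k *s p'" using pt_eq_iff by blast
  then show "E p = 0 \<and> p $ 1 \<noteq> 0 \<and> p $ 2 \<noteq> 0 \<and> p $ 3 \<noteq> 0"
    using p' tform_scale_nz[OF tform_E] by simp
qed (auto simp: base_points_def)

text \<open>With one coordinate 0 a single monomial of the equation survives, so a second coordinate
  is 0 as well.\<close>

lemma cone_vertex:
  assumes "p \<in> cone" "p $ 1 = 0 \<or> p $ 2 = 0 \<or> p $ 3 = 0"
  obtains v where "v \<in> vertices" "pt p = pt v"
proof -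
  have h: "p \<noteq> 0" "a * p $ 1 * p $ 2 ^ q + b * p $ 2 * p $ 3 ^ q + c * p $ 3 * p $ 1 ^ q = 0"
    using assms(1) by (auto simp: cone_def)
  have "(p $ 1 = 0 \<and> p $ 2 = 0) \<or> (p $ 1 = 0 \<and> p $ 3 = 0) \<or> (p $ 2 = 0 \<and> p $ 3 = 0)"
    using h(2) assms(2) nz q_pos by (auto simp: zero_power)
  then have "\<exists>v\<in>vertices. \<exists>k. k \<noteq> 0 \<and> p = k *s v"
  proof (elim disjE)
    assume "p $ 1 = 0 \<and> p $ 2 = 0"
    then show ?thesis using h(1)
      by (intro bexI[of _ "vector [0, 0, 1]"] exI[of _ "p $ 3"]) (auto simp: vertices_def vec3_eq_iff)
  next
    assume "p $ 1 = 0 \<and> p $ 3 = 0"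
    then show ?thesis using h(1)
      by (intro bexI[of _ "vector [0, 1, 0]"] exI[of _ "p $ 2"]) (auto simp: vertices_def vec3_eq_iff)
  next
    assume "p $ 2 = 0 \<and> p $ 3 = 0"
    then show ?thesis using h(1)
      by (intro bexI[of _ "vector [1, 0, 0]"] exI[of _ "p $ 1"]) (auto simp: vertices_def vec3_eq_iff)
  qed
  then show ?thesis using that pt_eq_iff by metis
qed

text \<open>By \<open>vertex_regular\<close>, x_1 x_2^q V is a multiple of \<open>E\<close>; if
  \<open>E\<close> vanished on the curve, irreducibility would make x_1 x_2^q vanish there.\<close>

lemma E_nz: "\<exists>x\<in>cone. E x \<noteq> 0"
proof (rule ccontr)
  assume E0: "\<not> ?thesis"
  have F: "vanishing_at_origin (mono3 1 q 0)" by (rule vanishing_mono3) (simp add: adjoint_exponents_def)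
  obtain U V where V: "ternary_form q V" "V (vector [1, 0, 0]) \<noteq> 0"
    and eq: "\<forall>x\<in>cone. mono3 1 q 0 x * V x = U x * E x"
    using vertex_regular[OF F minors(1)] by blast
  have "(\<forall>x\<in>cone. mono3 1 q 0 x = 0) \<or> (\<forall>x\<in>cone. V x = 0)"
    by (rule cone_integral[OF tform_mono3 tformI[OF V(1)]]) (use eq E0 in auto)
  moreover have "vector [1, 0, 0] \<in> cone" using vertices_cone by (auto simp: vertices_def)
  ultimately have "\<forall>x\<in>cone. mono3 1 q 0 x = 0" using V(2) by blast
  then show False using psi_zero_iff[OF tform_mono3] psi_mono3_nz by blast
qed

lemma vertex_regular_all:
  assumes F: "adjoint_form F" and v: "v \<in> vertices"
  shows "\<exists>U V. ternary_form q U \<and> ternary_form q V \<and> V v \<noteq> 0 \<and> (\<forall>x\<in>cone. F x * V x = U x * E x)"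
proof -
  interpret R: klein_curve q e b c a by (rule rotate)
  interpret R2: klein_curve q e c a b by (rule R.rotate)
  note F = F[unfolded adjoint_form_def]
  consider "v = vector [1, 0, 0]" | "v = vector [0, 1, 0]" | "v = vector [0, 0, 1]" using v by (auto simp: vertices_def)
  then show ?thesis
  proof cases
    case 1
    then show ?thesis using vertex_regular[of F a' c' b'] F minors by blast
  next
    case 2
    have "b' * a \<noteq> b * a'" using minors(3) by (simp add: mult.commute)
    with F R.vertex_regular[of "\<lambda>x. F (rot x)" b' a' c'] obtain U V where
      UV: "ternary_form q U" "ternary_form q V" "V (vector [1, 0, 0]) \<noteq> 0"
      and eq: "\<forall>x\<in>R.cone. F (rot x) * V x = U x * cyclic_form b' c' a' x" by blast
    have "F x * V (rot (rot x)) = U (rot (rot x)) * E x" if "x \<in> cone" for x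
    proof -
      have "rot (rot x) \<in> R.cone" using that rot_cone[of "rot (rot x)"] by simp
      from bspec[OF eq this] show ?thesis using cyclic_form_rot[of a' b' c' "rot (rot x)"] by simp
    qed
    moreover have "V (rot (rot v)) \<noteq> 0" using UV(3) rot_chart_origin 2 by (metis rot_rot_rot)
    ultimately show ?thesis using ternary_form_rot[OF ternary_form_rot[OF UV(1)]] ternary_form_rot[OF ternary_form_rot[OF UV(2)]]
      by (intro exI[of _ "\<lambda>x. U (rot (rot x))"] exI[of _ "\<lambda>x. V (rot (rot x))"]) auto
  next
    case 3
    have "c' * b \<noteq> c * b'" using minors(2) by (simp add: mult.commute)
    with F R2.vertex_regular[of "\<lambda>x. F (rot (rot x))" c' b' a'] obtain U V where
      UV: "ternary_form q U" "ternary_form q V" "V (vector [1, 0, 0]) \<noteq> 0"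
      and eq: "\<forall>x\<in>R2.cone. F (rot (rot x)) * V x = U x * cyclic_form c' a' b' x" by blast
    have "F x * V (rot x) = U (rot x) * E x" if "x \<in> cone" for x
    proof -
      have "rot x \<in> R2.cone" using that rot_rot_cone[of "rot x"] by simp
      from bspec[OF eq this] show ?thesis
        using cyclic_form_rot[of a' b' c' "rot (rot x)"] cyclic_form_rot[of b' c' a' "rot x"] by simp
    qed
    moreover have "V (rot v) \<noteq> 0" using UV(3) rot_chart_origin 3 by (metis rot_rot_rot)
    ultimately show ?thesis using ternary_form_rot[OF UV(1)] ternary_form_rot[OF UV(2)]
      by (intro exI[of _ "\<lambda>x. U (rot x)"] exI[of _ "\<lambda>x. V (rot x)"]) auto
  qed
qed

lemma fpair_adjoint: "adjoint_form F \<Longrightarrow> fpair F E"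
  unfolding fpair_def adjoint_form_def using ternary_form_vanishing ternary_form_cyclic E_nz by blast

lemma simple_zero_at:
  assumes p: "p \<in> cone" "E p = 0" "p $ 1 \<noteq> 0" "p $ 3 \<noteq> 0"
  obtains T U W where "local_parameter p T" "tform U" "tform W" "U p \<noteq> 0" "W p \<noteq> 0"
    "\<And>x. x \<in> cone \<Longrightarrow> E x * W x = T x ^ 1 * U x"
proof -
  obtain y z where yz: "aff y z" and pe: "p = p $ 1 *s vector [1, y, z]" using cone_chartE[OF p(1,3)] .
  have "p $ 3 = p $ 1 * z" by (subst pe) simp
  then have z: "z \<noteq> 0" using p(4) by auto
  have nz: "A p \<noteq> 0 \<longleftrightarrow> A (vector [1, y, z]) \<noteq> 0" if "tform A" for A
    by (subst pe) (use tform_scale_nz[OF that p(3)] in simp)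
  have "E (vector [1, y, z]) = 0" using nz[OF tform_E] p(2) by simp
  from simple_zero[OF yz z minors(2) this] obtain U W where UW: "tform U" "tform W" "U (vector [1, y, z]) \<noteq> 0"
    "W (vector [1, y, z]) \<noteq> 0" and eq: "\<forall>x\<in>cone. E x * W x = (x $ 2 - y * x $ 1) ^ 1 * U x" by blast
  have T: "local_parameter p (\<lambda>x. x $ 2 - y * x $ 1)"
    by (subst pe) (rule local_parameter_scale[OF local_parameter_chart[OF yz] p(3)])
  show ?thesis by (rule that[OF T UW(1,2)]) (use UW eq nz in auto)
qed

text \<open>The zeros of \<open>E\<close> at the vertices are absorbed by \<open>F\<close>, and
  those at the base points are simple.\<close>

lemma section_order:
  assumes F: "adjoint_form F" and nzF: "\<exists>x\<in>cone. F x \<noteq> 0" and P: "P \<in> curve"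
  shows "ord_at curve P (fr F E) + point_sum base_points P \<ge> 0"
proof -
  obtain p where p: "p \<in> cone" "P = pt p" using P by (auto simp: curve_def)
  note FE = fpair_adjoint[OF F]
  obtain T where T: "local_parameter p T" using local_parameter_exists[OF p(1)] by blast
  consider "p $ 1 = 0 \<or> p $ 2 = 0 \<or> p $ 3 = 0" | "E p \<noteq> 0" | "E p = 0" "p $ 1 \<noteq> 0" "p $ 2 \<noteq> 0" "p $ 3 \<noteq> 0" by blast
  then show ?thesis
  proof cases
    case 1
    obtain v where v: "v \<in> vertices" "pt p = pt v" using cone_vertex[OF p(1) 1] .
    have vc: "v \<in> cone" using v(1) vertices_cone by blast
    obtain T' where T': "local_parameter v T'" using local_parameter_exists[OF vc] by blast
    obtain U V where UV: "ternary_form q U" "ternary_form q V" "V v \<noteq> 0" and eq: "\<forall>x\<in>cone. F x * V x = U x * E x"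
      using vertex_regular_all[OF F v(1)] by blast
    have UVp: "fpair U V" unfolding fpair_def using UV vc by blast
    have FU: "fr F E = fr U V" using eq by (simp add: fr_eq_iff[OF FE UVp])
    have "\<exists>x\<in>cone. U x \<noteq> 0"
    proof (rule ccontr)
      assume "\<not> ?thesis"
      then have "fr U V = \<zero>\<^bsub>FF\<^esub>" using fr_zero_iff[OF UVp] by blast
      then show False using FU fr_zero_iff[OF FE] nzF by auto
    qed
    from ord_at_ge[OF vc T' UVp this tformI[OF UV(2)] tform_const[of 1], of 0] UV(3)
    have "ord_at curve (pt v) (fr U V) \<ge> 0" by simp
    then show ?thesis unfolding FU p(2) v(2) by (simp add: point_sum_def)
  next
    case 2
    from ord_at_ge[OF p(1) T FE nzF tform_E tform_const[of 1], of 0] 2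
    have "ord_at curve (pt p) (fr F E) \<ge> 0" by simp
    then show ?thesis unfolding p(2) by (simp add: point_sum_def)
  next
    case 3
    then have b: "P \<in> base_points" using base_points_iff[OF p(1)] p(2) by simp
    obtain T' U W where T': "local_parameter p T'" and UW: "tform U" "tform W" "U p \<noteq> 0" "W p \<noteq> 0"
      and eq: "\<And>x. x \<in> cone \<Longrightarrow> E x * W x = T' x ^ 1 * U x"
      using simple_zero_at[OF p(1) 3(1,2,4)] by metis
    from ord_at_ge[OF p(1) T' FE nzF UW eq] have "ord_at curve (pt p) (fr F E) \<ge> - 1" by simp
    then show ?thesis using b unfolding p(2) by (simp add: point_sum_def)
  qed
qed

text \<open>The converse of \<open>section_order\<close>: a function with at most simple poles at
  the base points has a numerator from \<open>exponents\<close> over the denominator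
  \<open>E\<close>. It is phrased for values off the triangle and off the zeros of \<open>E\<close>,
  where the code evaluates.\<close>

lemma section_value:
  assumes f: "f \<in> carrier FF" and pos: "f = \<zero>\<^bsub>FF\<^esub> \<or> (\<forall>P\<in>curve. ord_at curve P f + point_sum base_points P \<ge> 0)"
  shows "\<exists>g. \<forall>p\<in>cone. p $ 1 \<noteq> 0 \<longrightarrow> E p \<noteq> 0 \<longrightarrow> p $ 2 \<noteq> 0 \<longrightarrow> p $ 3 \<noteq> 0 \<longrightarrow> value_at f (pt p) =
    (\<Sum>s\<in>exponents. g s * mono3 (Suc q - fst s - snd s) (fst s) (snd s) p) / E p"
proof (cases "f = \<zero>\<^bsub>FF\<^esub>")
  case True
  then show ?thesis
    using value_at_fr[OF fpair_const[OF one_neq_zero], of _ 0] by (intro exI[of _ "\<lambda>_. 0"]) (simp add: FF_simps)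
next
  case False
  obtain A B where AB: "fpair A B" "f = fr A B" using f by (auto simp: FF_simps)
  have nzA: "\<exists>x\<in>cone. A x \<noteq> 0" using False fr_zero_iff[OF AB(1)] AB(2) by blast
  have o: "ord_at curve (pt p) (fr A B) + point_sum base_points (pt p) \<ge> 0" if "p \<in> cone" for p
    using pos False AB(2) that by (auto simp: curve_def)
  have reg: "\<exists>U W. tform U \<and> tform W \<and> W p \<noteq> 0 \<and> (\<forall>x\<in>cone. A x * E x * W x = B x * U x)" if p: "p \<in> cone" for p
  proof -
    obtain T where T: "local_parameter p T" using local_parameter_exists[OF p] by blast
    have "ord_at curve (pt p) (fr A B) \<ge> 0 \<or> ord_at curve (pt p) (fr A B) \<ge> - 1 \<and> E p = 0"
      using o[OF p] base_points_iff[OF p] by (auto simp: point_sum_def split: if_splits)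
    from regular_of_ord[OF p T AB(1) nzA tform_E this] show ?thesis .
  qed
  have reg1: "\<exists>U W. tform U \<and> tform W \<and> W p \<noteq> 0 \<and> (\<forall>x\<in>cone. A x * W x = B x * U x)"
    if p: "p \<in> cone" and nb: "pt p \<notin> base_points" for p
  proof -
    obtain T where T: "local_parameter p T" using local_parameter_exists[OF p] by blast
    have "ord_at curve (pt p) (fr A B) \<ge> 0" using o[OF p] nb by (simp add: point_sum_def)
    from regular_of_ord[OF p T AB(1) nzA tform_const[of 1] disjI1[OF this]] show ?thesis by simp
  qed
  have vert: "pt p \<notin> base_points" "p \<in> cone" if "p \<in> vertices" for p
  proof -
    show p: "p \<in> cone" using that vertices_cone by blast
    show "pt p \<notin> base_points" unfolding base_points_iff[OF p] using that by (auto simp: vertices_def)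
  qed
  obtain g where g: "\<forall>x\<in>cone. x $ 1 \<noteq> 0 \<longrightarrow>
    A x * E x = B x * (\<Sum>s\<in>exponents. g s * mono3 (Suc q - fst s - snd s) (fst s) (snd s) x)"
    using numerator_form[OF AB(1) reg reg1[OF vert(2,1)]] by blast
  let ?F = "\<lambda>x. \<Sum>s\<in>exponents. g s * mono3 (Suc q - fst s - snd s) (fst s) (snd s) x"
  have Ff: "ternary_form (Suc q) ?F" unfolding mono3_def
    by (intro ternary_form_sum ternary_form_cmult ternary_form_monomial) (use exponents_sum in fastforce)
  show ?thesis
  proof (intro exI[of _ g] ballI impI)
    fix p assume p: "p \<in> cone" "p $ 1 \<noteq> 0" "E p \<noteq> 0"
    have "pt p \<notin> base_points" using p base_points_iff by simp
    from reg1[OF p(1) this] obtain U W where UW: "tform U" "tform W" "W p \<noteq> 0"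
      and eq: "\<forall>x\<in>cone. A x * W x = B x * U x" by blast
    obtain d where d: "ternary_form d A" "ternary_form d B" using AB(1) by (auto simp: fpair_def)
    obtain dU dW where dd: "ternary_form dU U" "ternary_form dW W" using UW by (auto simp: tform_def)
    have nzAW: "\<exists>x\<in>cone. A x * W x \<noteq> 0"
      using cone_mult_nz[OF tformI[OF d(1)] UW(2) nzA] UW(3) p(1) by blast
    have "d + dW = d + dU"
      by (rule form_degree_unique[OF ternary_form_mult[OF d(1) dd(2)] ternary_form_mult[OF d(2) dd(1)] bspec[OF eq] nzAW])
    then have "fpair U W" unfolding fpair_def using dd UW(3) p(1) by auto
    moreover from this have "f = fr U W" using eq fr_eq_iff[OF AB(1)] AB(2) by (simp add: mult.commute)
    ultimately have v: "value_at f (pt p) = U p / W p" using value_at_fr p(1) UW(3) by blast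
    \<comment> \<open>\<open>numerator_form\<close> speaks about x_1 \<noteq> 0; with an extra
      factor x_1 the identity holds on the whole cone, and \<open>B\<close> can be
      cancelled.\<close>
    have "p $ 1 * (U p * E p) = p $ 1 * (?F p * W p)"
    proof (rule cone_cancel[OF fpair_tform(2,3)[OF AB(1)] _ _ _ p(1)])
      show "tform (\<lambda>x. x $ 1 * (U x * E x))" "tform (\<lambda>x. x $ 1 * (?F x * W x))"
        by (intro tform_mult tform_coord UW tform_E tformI[OF Ff])+
      fix x assume x: "x \<in> cone"
      show "B x * (x $ 1 * (U x * E x)) = B x * (x $ 1 * (?F x * W x))"
      proof (cases "x $ 1 = 0")
        case False
        have "B x * (x $ 1 * (U x * E x)) = x $ 1 * ((B x * U x) * E x)" by (simp only: mult_ac)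
        also have "\<dots> = x $ 1 * W x * (A x * E x)" unfolding bspec[OF eq x, symmetric] by (simp only: mult_ac)
        also have "A x * E x = B x * ?F x" using g x False by blast
        finally show ?thesis by (simp only: mult_ac)
      qed simp
    qed
    then have "U p * E p = ?F p * W p" using p(2) by simp
    then show "value_at f (pt p) = ?F p / E p" unfolding v using p(3) UW(3) by (simp add: divide_simps)
  qed
qed

end

section \<open>Linear algebra over a subfield and dual codes\<close>

text \<open>An independent set is extended to a basis, whose vectors become the rows of an
  invertible matrix; \<open>J\<close> marks the rows from \<open>B\<close>. Orthogonality and change
  of field are then read off from the matrix.\<close>

lemma basis_matrix_exists:
  fixes B :: "('a::field ^ 'n::finite) set"
  assumes "vec.independent B"
  obtains R R' :: "'a ^ 'n ^ 'n" and J where "R ** R' = mat 1" "R' ** R = mat 1"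
    "(\<lambda>i. R $ i) ` J = B" "inj (\<lambda>i. R $ i)"
proof -
  obtain C where C: "B \<subseteq> C" "vec.independent C" "UNIV \<subseteq> vec.span C"
    by (rule vec.maximal_independent_subset_extend[OF subset_UNIV assms]) (rule that)
  have "card C = vec.dim (UNIV :: ('a ^ 'n) set)"
    using C by (intro vec.basis_card_eq_dim) auto
  then have cC: "card C = CARD('n)" by (simp only: vec_dim_card)
  have finC: "finite C" using C(2) by (rule vec.finiteI_independent)
  obtain f :: "'n \<Rightarrow> 'a ^ 'n" where f: "bij_betw f UNIV C"
    using finite_same_card_bij[of "UNIV :: 'n set" C] finC cC by auto
  define R :: "'a ^ 'n ^ 'n" where "R = (\<chi> i. f i)"
  have Ri: "R $ i = f i" for i by (simp add: R_def)
  have inj: "inj f" using f by (auto simp: bij_betw_def)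
  have "(\<forall>c. (\<Sum>i\<in>UNIV. c i *s row i R) = 0 \<longrightarrow> (\<forall>i. c i = 0))"
  proof (intro allI impI)
    fix c i assume 0: "(\<Sum>i\<in>UNIV. c i *s row i R) = 0"
    have "row i R = f i" for i by (simp add: row_def Ri vec_eq_iff)
    then have "(\<Sum>v\<in>C. c (the_inv f v) *s v) = 0"
      using 0 sum.reindex_bij_betw[OF f, of "\<lambda>v. c (the_inv f v) *s v"] by (simp add: the_inv_f_f[OF inj])
    moreover have "f i \<in> C" using f by (auto simp: bij_betw_def)
    moreover have "\<forall>u. \<not> ((\<exists>v\<in>C. u v \<noteq> 0) \<and> (\<Sum>v\<in>C. u v *s v) = 0)"
      using C(2) unfolding vec.dependent_finite[OF finC] not_ex .
    from spec[OF this, of "\<lambda>v. c (the_inv f v)"]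
    have "\<not> ((\<exists>v\<in>C. c (the_inv f v) \<noteq> 0) \<and> (\<Sum>v\<in>C. c (the_inv f v) *s v) = 0)" .
    ultimately have "c (the_inv f (f i)) = 0" by blast
    then show "c i = 0" by (simp add: the_inv_f_f[OF inj])
  qed
  then have "\<exists>R'. R ** R' = mat 1" unfolding matrix_right_invertible_independent_rows .
  then obtain R' where R': "R ** R' = mat 1" ..
  then have "R' ** R = mat 1" by (simp only: matrix_left_right_inverse)
  moreover have "(\<lambda>i. R $ i) ` (f -` B) = B"
    using C(1) f by (auto simp: Ri bij_betw_def)
  moreover have "inj (\<lambda>i. R $ i)" using inj by (simp add: Ri)
  ultimately show ?thesis using that R' by blast
qed

lemma dual_code_subspace: "vec.subspace (dual_code W)"
proof (rule vec.subspaceI)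
  show "0 \<in> dual_code W" by (simp add: dual_code_def)
  show "x + y \<in> dual_code W" if "x \<in> dual_code W" "y \<in> dual_code W" for x y
    using that by (simp add: dual_code_def distrib_right sum.distrib)
  show "c *s x \<in> dual_code W" if "x \<in> dual_code W" for c x
    using that by (simp add: dual_code_def mult.assoc flip: sum_distrib_left)
qed

lemma dual_code_span: "dual_code (vec.span W) = dual_code W"
proof
  show "dual_code (vec.span W) \<subseteq> dual_code W" by (auto simp: dual_code_def vec.span_base)
  show "dual_code W \<subseteq> dual_code (vec.span W)"
  proof
    fix v assume v: "v \<in> dual_code W"
    have "(\<Sum>i\<in>UNIV. v $ i * w $ i) = 0" if "w \<in> vec.span W" for w
      using that
    proof (induction rule: vec.span_induct_alt)
      case (step c x y)
      then show ?case using v by (simp add: dual_code_def distrib_left sum.distrib mult.left_commute flip: sum_distrib_left)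
    qed simp
    then show "v \<in> dual_code (vec.span W)" by (simp add: dual_code_def)
  qed
qed

text \<open>In the coordinates given by \<open>R\<close> the dual code is the subspace on which the
  entries at \<open>J\<close> vanish.\<close>

lemma dim_dual_code:
  fixes W :: "('a::field ^ 'n::finite) set"
  shows "vec.dim (dual_code W) + vec.dim W = CARD('n)"
proof -
  obtain B where B: "B \<subseteq> W" "vec.independent B" "W \<subseteq> vec.span B" "card B = vec.dim W"
    using vec.basis_exists by blast
  have "vec.span B = vec.span W"
    using B vec.span_mono[OF B(1)] vec.span_minimal[OF B(3) vec.subspace_span] by blast
  then have WB: "dual_code W = dual_code B" by (metis dual_code_span)
  obtain R R' :: "'a ^ 'n ^ 'n" and J where R: "R ** R' = mat 1" "R' ** R = mat 1"
    and J: "(\<lambda>i. R $ i) ` J = B" and inj: "inj (\<lambda>i. R $ i)"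
    using basis_matrix_exists[OF B(2)] by metis
  let ?U = "{u :: 'a ^ 'n. \<forall>i. i \<notin> - J \<longrightarrow> u $ i = 0}"
  have memB: "v \<in> dual_code B \<longleftrightarrow> R *v v \<in> ?U" for v
    unfolding J[symmetric] by (auto simp: dual_code_def matrix_vector_mult_def mult.commute)
  have "dual_code B = (\<lambda>u. R' *v u) ` ?U"
  proof (intro subset_antisym subsetI)
    fix v assume "v \<in> dual_code B"
    then have "R *v v \<in> ?U" using memB by blast
    moreover have "v = R' *v (R *v v)" by (simp add: matrix_vector_mul_assoc R)
    ultimately show "v \<in> (\<lambda>u. R' *v u) ` ?U" by blast
  next
    fix v assume "v \<in> (\<lambda>u. R' *v u) ` ?U"
    then obtain u where "u \<in> ?U" "v = R' *v u" by blast
    then show "v \<in> dual_code B" unfolding memB by (simp add: matrix_vector_mul_assoc R)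
  qed
  moreover have "vec.dim ((\<lambda>u. R' *v u) ` ?U) = vec.dim ?U"
  proof (rule vec.dim_image_eq)
    show "Vector_Spaces.linear (*s) (*s) ((*v) R')" by simp
    show "inj_on ((*v) R') (vec.span ?U)"
      by (rule inj_on_inverseI[of _ "(*v) R"]) (simp add: matrix_vector_mul_assoc R)
  qed
  ultimately have "vec.dim (dual_code W) = card (- J)" unfolding WB by (simp only: dim_substandard_cart)
  moreover have "card B = card J" unfolding J[symmetric] using inj by (intro card_image) (auto intro: inj_on_subset)
  moreover have "card J \<le> CARD('n)" by (intro card_mono) auto
  ultimately show ?thesis using B(4) by (simp add: Compl_eq_Diff_UNIV card_Diff_subset)
qed

section \<open>Words over the algebraic closure\<close>

definition ac_vec :: "'f::field ^ 'n::finite \<Rightarrow> 'f alg_closure ^ 'n" where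
  "ac_vec w = (\<chi> i. to_ac (w $ i))"

lemma ac_vec_nth [simp]: "ac_vec w $ i = to_ac (w $ i)"
  by (simp add: ac_vec_def)

lemma to_ac_eq_iff: "to_ac x = to_ac y \<longleftrightarrow> x = (y :: 'f::field)"
  using inj_to_ac by (auto dest: injD)

lemma ac_vec_inj: "inj ac_vec"
  by (rule injI) (simp add: vec_eq_iff to_ac_eq_iff)

text \<open>Independence is invertibility of a matrix, and a product equal to 1 stays so when the
  entries are embedded.\<close>

lemma independent_ac_vec:
  fixes B :: "('f::field ^ 'n::finite) set"
  assumes "vec.independent B"
  shows "vec.independent (ac_vec ` B)"
proof -
  obtain R R' :: "'f ^ 'n ^ 'n" and J where R: "R ** R' = mat 1" "R' ** R = mat 1"
    and J: "(\<lambda>i. R $ i) ` J = B" and inj: "inj (\<lambda>i. R $ i)"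
    using basis_matrix_exists[OF assms] by metis
  define S S' :: "'f alg_closure ^ 'n ^ 'n" where "S = (\<chi> i. ac_vec (R $ i))" and "S' = (\<chi> i. ac_vec (R' $ i))"
  have "S ** S' = mat 1"
  proof -
    have "(S ** S') $ i $ j = to_ac ((R ** R') $ i $ j)" for i j
      by (simp add: S_def S'_def matrix_matrix_mult_def to_ac_sum)
    then show ?thesis unfolding R by (simp add: vec_eq_iff mat_def)
  qed
  then have rows: "\<And>c. (\<Sum>i\<in>UNIV. c i *s row i S) = 0 \<Longrightarrow> (\<forall>i. c i = 0)"
    using matrix_right_invertible_independent_rows[of S] by blast
  have rowS: "row i S = ac_vec (R $ i)" for i by (simp add: row_def S_def vec_eq_iff)
  let ?g = "\<lambda>i. ac_vec (R $ i)"
  have injg: "inj ?g" using inj ac_vec_inj by (auto simp: inj_def)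
  have "vec.independent (range ?g)"
  proof
    assume "vec.dependent (range ?g)"
    then obtain u v where v: "v \<in> range ?g" "u v \<noteq> 0" "(\<Sum>v\<in>range ?g. u v *s v) = 0"
      using vec.dependent_finite[of "range ?g"] by auto
    then have "(\<Sum>i\<in>UNIV. u (?g i) *s row i S) = 0"
      by (simp add: rowS sum.reindex[OF injg] o_def)
    from rows[OF this] v show False by auto
  qed
  moreover have "ac_vec ` B \<subseteq> range ?g" using J by auto
  ultimately show ?thesis by (rule vec.independent_mono)
qed

text \<open>Allows the dimension of the code to be computed over the closure, where single monomials
  have words.\<close>

lemma dim_ac_vec:
  fixes W :: "('f::field ^ 'n::finite) set" and Y :: "('f alg_closure ^ 'n) set"
  assumes Y: "vec.independent Y" "ac_vec ` W \<subseteq> vec.span Y" "Y \<subseteq> vec.span (ac_vec ` W)"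
  shows "vec.dim W = card Y"
proof -
  obtain B where B: "B \<subseteq> W" "vec.independent B" "W \<subseteq> vec.span B" "card B = vec.dim W"
    using vec.basis_exists by blast
  have finB: "finite B" and finX: "finite Y" using B Y vec.finiteI_independent by blast+
  note iB = independent_ac_vec[OF B(2)]
  have cB: "card (ac_vec ` B) = card B" using ac_vec_inj by (intro card_image) (auto intro: inj_on_subset)
  have "ac_vec ` B \<subseteq> vec.span Y" using B Y by blast
  then have 1: "card B \<le> card Y" using vec.independent_span_bound[OF finX iB] cB by simp
  have "ac_vec w \<in> vec.span (ac_vec ` B)" if "w \<in> vec.span B" for w
    using that
  proof (induction rule: vec.span_induct_alt)
    case base
    have "ac_vec (0 :: 'f ^ 'n) = 0" by (simp add: vec_eq_iff)
    then show ?case by (simp add: vec.span_zero)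
  next
    case (step c x y)
    have "ac_vec (c *s x + y) = to_ac c *s ac_vec x + ac_vec y" by (simp add: vec_eq_iff)
    then show ?case using step by (simp add: vec.span_add vec.span_scale vec.span_base)
  qed
  then have "vec.span (ac_vec ` W) \<subseteq> vec.span (ac_vec ` B)"
    using B(3) by (intro vec.span_minimal) auto
  then have "Y \<subseteq> vec.span (ac_vec ` B)" using Y by blast
  then have "card Y \<le> card B" using vec.independent_span_bound[OF _ Y(1), of "ac_vec ` B"] finB cB by simp
  then show ?thesis using 1 B(4) by simp
qed

text \<open>The dual code and the words supported on \<open>S\<close> both lie in the hyperplane
  orthogonal to \<open>w0\<close>, of dimension n - 1, and their dimensions add up to at least n; so
  they meet. The word \<open>w0\<close> vanishing on \<open>S\<close> gains the one dimension that
  counting alone lacks.\<close>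

lemma dual_code_small_support:
  fixes W :: "('a::field ^ 'n::finite) set"
  assumes w0: "w0 \<in> W" "w0 \<noteq> 0" and S: "\<And>i. i \<in> S \<Longrightarrow> w0 $ i = 0" and card: "vec.dim W \<le> card S"
  obtains v where "v \<in> dual_code W" "v \<noteq> 0" "{i. v $ i \<noteq> 0} \<subseteq> S"
proof -
  let ?U = "{v :: 'a ^ 'n. \<forall>i. i \<notin> S \<longrightarrow> v $ i = 0}"
  let ?A = "dual_code W"
  have sU: "vec.subspace ?U" by (rule vec.subspaceI) auto
  have "vec.independent {w0}" using w0 vec.dependent_single by blast
  then have d1: "vec.dim {w0} = 1" using vec.dim_eq_card_independent by fastforce
  have "?U \<subseteq> dual_code {w0}"
  proof
    fix v assume "v \<in> ?U"
    then have "v $ i * w0 $ i = 0" for i using S by (cases "i \<in> S") auto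
    then have "(\<Sum>i\<in>UNIV. v $ i * w0 $ i) = 0" by (intro sum.neutral) blast
    then show "v \<in> dual_code {w0}" by (simp add: dual_code_def)
  qed
  moreover have "?A \<subseteq> dual_code {w0}" using w0 by (auto simp: dual_code_def)
  ultimately have "{x + y | x y. x \<in> ?A \<and> y \<in> ?U} \<subseteq> dual_code {w0}"
    using vec.subspace_add[OF dual_code_subspace] by blast
  then have "vec.dim {x + y | x y. x \<in> ?A \<and> y \<in> ?U} \<le> vec.dim (dual_code {w0})"
    by (rule vec.dim_subset)
  moreover have "vec.dim {x + y | x y. x \<in> ?A \<and> y \<in> ?U} + vec.dim (?A \<inter> ?U) = vec.dim ?A + vec.dim ?U"
    by (rule vec.dim_sums_Int[OF dual_code_subspace sU])
  ultimately have "vec.dim (?A \<inter> ?U) > 0"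
    using dim_dual_code[of W] dim_dual_code[of "{w0}"] card d1 by (simp add: dim_substandard_cart)
  moreover have "vec.dim (?A \<inter> ?U) = 0" if "?A \<inter> ?U \<subseteq> {0}"
    using vec.dim_le_card[of "?A \<inter> ?U" "{}"] that by simp
  ultimately have "\<not> ?A \<inter> ?U \<subseteq> {0}" by linarith
  then show ?thesis using that by blast
qed

lemma min_distance_bounds:
  fixes W :: "('a::field ^ 'n::finite) set"
  assumes W: "vec.subspace W" and low: "\<And>v. v \<in> W \<Longrightarrow> v \<noteq> 0 \<Longrightarrow> l \<le> card {i. v $ i \<noteq> 0}"
    and v: "v \<in> W" "v \<noteq> 0" "card {i. v $ i \<noteq> 0} \<le> u"
  shows "l \<le> min_distance W \<and> min_distance W \<le> u"
proof -
  let ?D = "{hamming_dist v w | v w. v \<in> W \<and> w \<in> W \<and> v \<noteq> w}"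
  have "?D \<subseteq> {..CARD('n)}" by (auto simp: hamming_dist_def intro!: card_mono)
  then have fin: "finite ?D" by (rule finite_subset) simp
  have "hamming_dist v 0 = card {i. v $ i \<noteq> 0}" by (simp add: hamming_dist_def)
  then have mem: "card {i. v $ i \<noteq> 0} \<in> ?D" using v vec.subspace_0[OF W]
    by (intro CollectI exI[of _ v] exI[of _ 0]) auto
  have "l \<le> x" if x: "x \<in> ?D" for x
  proof -
    obtain v w where vw: "x = hamming_dist v w" "v \<in> W" "w \<in> W" "v \<noteq> w" using x by blast
    then have "v - w \<in> W" "v - w \<noteq> 0" using vec.subspace_diff[OF W] by auto
    from low[OF this] show ?thesis using vw(1) by (simp add: hamming_dist_def)
  qed
  then have "l \<le> Min ?D" using fin mem by (intro Min.boundedI) auto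
  moreover have "Min ?D \<le> u" using Min_le[OF fin mem] v(3) by linarith
  ultimately show ?thesis by (simp add: min_distance_def)
qed

section \<open>The plane $\Pi$ and rationality\<close>

lemma finite_field_power_card:
  fixes x :: "'f::{field,finite}"
  shows "x ^ CARD('f) = x"
proof (cases "x = 0")
  case False
  have "(\<Prod>y\<in>UNIV - {0}. y) = (\<Prod>y\<in>UNIV - {0}. x * y)"
  proof (rule prod.reindex_bij_betw[symmetric])
    show "bij_betw (\<lambda>y. x * y) (UNIV - {0}) (UNIV - {0})"
      by (rule bij_betwI[of _ _ _ "\<lambda>y. y / x"]) (use False in auto)
  qed
  also have "\<dots> = x ^ card (UNIV - {0::'f}) * (\<Prod>y\<in>UNIV - {0}. y)" by (simp add: prod.distrib)
  finally have eq: "1 * (\<Prod>y\<in>UNIV - {0}. y) = x ^ card (UNIV - {0::'f}) * (\<Prod>y\<in>UNIV - {0}. y)"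
    by (simp only: mult_1_left)
  have "(\<Prod>y\<in>UNIV - {0::'f}. y) \<noteq> 0" by simp
  from iffD1[OF mult_right_cancel[OF this] eq] have "x ^ card (UNIV - {0::'f}) = 1" by (rule sym)
  moreover have "CARD('f) = Suc (card (UNIV - {0::'f}))" by (subst card.remove[of _ 0]) auto
  ultimately show ?thesis by (metis mult_1_right power_Suc)
qed (simp add: zero_power)

text \<open>With n elements in the small field, x^n - x has at most n roots, and the image of that
  field supplies n of them.\<close>

lemma GF_card_range:
  assumes "x \<in> (GF CARD('f) :: 'f::{field,finite} alg_closure set)"
  shows "\<exists>w. to_ac w = x"
proof -
  define p :: "'f alg_closure poly" where "p = Polynomial.monom 1 CARD('f) - [:0, 1:]"
  have n: "CARD('f) > 1"
  proof -
    have "card {0, 1 :: 'f} \<le> CARD('f)" by (intro card_mono) auto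
    then show ?thesis by simp
  qed
  have p: "poly p y = y ^ CARD('f) - y" for y by (simp add: p_def poly_monom)
  have "Polynomial.coeff p CARD('f) = 1" using n by (simp add: p_def coeff_pCons split: nat.split)
  then have p0: "p \<noteq> 0" by auto
  have "degree p \<le> CARD('f)"
    unfolding p_def using n by (intro degree_diff_le Polynomial.degree_monom_le) auto
  then have "card {y. poly p y = 0} \<le> CARD('f)" using card_poly_roots_bound[OF p0] by linarith
  moreover have "range (to_ac :: 'f \<Rightarrow> _) \<subseteq> {y. poly p y = 0}"
    using finite_field_power_card by (auto simp: p simp flip: to_ac_power)
  moreover have "card (range (to_ac :: 'f \<Rightarrow> _)) = CARD('f)" using inj_to_ac by (intro card_image)
  ultimately have "range (to_ac :: 'f \<Rightarrow> _) = {y. poly p y = 0}"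
    using poly_roots_finite[OF p0] by (intro card_seteq) auto
  moreover have "x \<in> {y. poly p y = 0}" using assms by (simp add: p GF_def)
  ultimately show ?thesis by (metis rangeE)
qed

section \<open>Frobenius, the conjugates of \<beta> and rational coordinates of \<Pi>\<close>

locale singer_setting =
  fixes q :: nat and \<tau> \<beta> :: "'f::{field,finite} alg_closure"
  assumes q_primepow: "primepow q" and q2: "q > 2" and card_f: "CARD('f) = q^2"
    and tau: "\<tau> ^ (q^2 + q + 1) = 1"
    and beta: "\<beta> ^ (q^2 - q + 1) = 1" and beta_order: "\<forall>m. 0 < m \<and> m < q^2 - q + 1 \<longrightarrow> \<beta> ^ m \<noteq> 1"
begin

definition expo :: nat where "expo = (SOME e. q = CHAR('f alg_closure) ^ e)"

lemma char_props: "prime CHAR('f alg_closure)" "q = CHAR('f alg_closure) ^ expo"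
proof -
  obtain p k where p: "prime p" "k > 0" "q = p ^ k" using q_primepow by (auto simp: primepow_def)
  have c: "CHAR('f alg_closure) = CHAR('f)" by (rule CHAR_alg_closure)
  have pr: "prime CHAR('f)"
    using prime_CHAR_semidom[where ?'a = 'f] finite_imp_CHAR_pos[where ?'a = 'f] by simp
  then show "prime CHAR('f alg_closure)" by simp
  have "CHAR('f) dvd CARD('f)" by (rule CHAR_dvd_CARD)
  then have "CHAR('f) dvd p ^ (k * 2)" by (simp add: card_f p(3) power_mult)
  then have "CHAR('f) dvd p" using pr by (rule prime_dvd_power[rotated])
  then have "CHAR('f) = p" using pr p(1) primes_dvd_imp_eq by blast
  then have "\<exists>e. q = CHAR('f alg_closure) ^ e" using p(3) c by metis
  then show "q = CHAR('f alg_closure) ^ expo" unfolding expo_def by (rule someI_ex)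
qed

abbreviation frob :: "'f alg_closure \<Rightarrow> 'f alg_closure" where "frob x \<equiv> x ^ (q^2)"

lemma q_add: "(x + y :: 'f alg_closure) ^ q = x ^ q + y ^ q"
  by (rule freshmans_dream'[OF char_props])

lemma frob_eq: "frob x = (x ^ q) ^ q" by (simp add: power2_eq_square power_mult)

lemma frob_add: "frob (x + y) = frob x + frob y" by (simp only: frob_eq q_add)

lemma frob_0: "frob 0 = 0" using q2 by (simp add: zero_power)

lemma frob_diff: "frob (x - y) = frob x - frob y"
  using frob_add[of "x - y" y] by (simp add: algebra_simps)

lemma frob_sum: "frob (\<Sum>i\<in>I. f i) = (\<Sum>i\<in>I. frob (f i))"
  by (induction I rule: infinite_finite_induct) (simp_all add: frob_0 frob_add)

lemma frob_inj: "frob x = frob y \<Longrightarrow> x = y"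
  using frob_diff[of x y] by simp

lemma q_inj: "x ^ q = y ^ q \<Longrightarrow> x = (y :: 'f alg_closure)"
  using frob_inj unfolding frob_eq by simp

lemma GF6_iff: "x \<in> GF (q^6) \<longleftrightarrow> frob (frob (frob x)) = x"
proof -
  have "q ^ 6 = q^2 * q^2 * q^2" by (simp flip: power_add)
  then have "x ^ (q ^ 6) = frob (frob (frob x))" by (simp only: power_mult)
  then show ?thesis by (simp add: GF_def)
qed

lemma N_pos: "q^2 - q + 1 > 0" "q < q^2" using q2 by (simp_all add: power2_eq_square)

lemma Q1_eq: "q^2 + 1 = (q^2 - q + 1) + q" using N_pos by simp

lemma beta_nz: "\<beta> \<noteq> 0" using beta N_pos by (auto simp: zero_power)

lemma beta_q2: "\<beta> ^ (q^2 + 1) = \<beta> ^ q"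
  by (subst Q1_eq, subst power_add) (simp only: beta mult_1_left)

lemma q3_eq: "q^3 + 1 = (q^2 - q + 1) * (q + 1)"
proof -
  obtain m where m: "q = Suc m" using q2 by (cases q) auto
  show ?thesis by (simp add: m power2_eq_square power3_eq_cube algebra_simps)
qed

lemma q421_eq: "q^4 + q^2 + 1 = (q^2 - q + 1) * (q^2 + q + 1)"
proof -
  obtain m where m: "q = Suc m" using q2 by (cases q) auto
  show ?thesis by (simp add: m power2_eq_square power4_eq_xxxx algebra_simps)
qed

text \<open>The exponent q^6 - 1 factors as (q^4 + q^2 + 1) (q^2 - 1).\<close>

lemma norm1_GF6:
  assumes "x ^ (q^4 + q^2 + 1) = 1"
  shows "frob (frob (frob x)) = (x :: 'f alg_closure)"
proof -
  have "q^2 * q^2 * q^2 = (q^4 + q^2 + 1) * (q^2 - 1) + 1"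
  proof -
    obtain m where m: "q^2 = Suc m" using q2 by (cases "q^2") auto
    have "q^4 = q^2 * q^2" by (simp flip: power_add)
    then show ?thesis by (simp add: m algebra_simps)
  qed
  then have "frob (frob (frob x)) = x ^ ((q^4 + q^2 + 1) * (q^2 - 1) + 1)"
    by (simp flip: power_mult)
  also have "\<dots> = (x ^ (q^4 + q^2 + 1)) ^ (q^2 - 1) * x" by (simp only: power_add power_mult power_one_right)
  finally show ?thesis unfolding assms by simp
qed

lemma beta_frob3: "frob (frob (frob \<beta>)) = \<beta>"
  by (rule norm1_GF6) (simp only: q421_eq power_mult beta power_one)

text \<open>Otherwise \<beta>^(q^2-1) = 1, and q^2 - 1 exceeds the order q^2 - q + 1 by q - 2, a
  positive number below the order. For q = 2 this number is 0, and \<beta> does lie in the field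
  with 4 elements.\<close>

lemma beta_frob: "frob \<beta> \<noteq> \<beta>"
proof
  assume e: "frob \<beta> = \<beta>"
  have "\<beta> * \<beta> ^ (q^2 - 1) = \<beta> * 1" using e q2 by (simp flip: power_Suc)
  then have 1: "\<beta> ^ (q^2 - 1) = 1" using beta_nz by simp
  have "q^2 - 1 = (q^2 - q + 1) + (q - 2)" using q2 N_pos by simp
  then have "\<beta> ^ ((q^2 - q + 1) + (q - 2)) = 1" using 1 by simp
  then have "\<beta> ^ (q - 2) = 1" by (subst (asm) power_add) (simp only: beta mult_1_left)
  moreover have "q * 2 \<le> q * q" using q2 by (intro mult_le_mono2) simp
  then have "0 < q - 2" "q - 2 < q^2 - q + 1" using q2 unfolding power2_eq_square by linarith+
  ultimately show False using beta_order by blast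
qed

lemma beta_distinct: "frob \<beta> \<noteq> \<beta>" "frob (frob \<beta>) \<noteq> \<beta>" "frob (frob \<beta>) \<noteq> frob \<beta>"
proof -
  show "frob \<beta> \<noteq> \<beta>" by (rule beta_frob)
  show "frob (frob \<beta>) \<noteq> frob \<beta>" using beta_frob frob_inj by blast
  show "frob (frob \<beta>) \<noteq> \<beta>" using beta_frob beta_frob3 by metis
qed

text \<open>A lift to vectors of the Frobenius collineation of \<Pi>.\<close>

definition phi :: "'f alg_closure ^ 3 \<Rightarrow> 'f alg_closure ^ 3" where
  "phi x = (\<chi> i. frob (rot x $ i))"

lemma phi_nth: "phi x $ 1 = frob (x $ 3)" "phi x $ 2 = frob (x $ 1)" "phi x $ 3 = frob (x $ 2)"
  by (simp_all add: phi_def)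

lemma phi_scale: "phi (k *s x) = frob k *s phi x"
  by (simp add: vec3_eq_iff phi_nth power_mult_distrib)

text \<open>\<open>coord_matrix\<close> maps the vectors over \<open>F\<^bsub>q\<^sup>2\<^esub>\<close> to the vectors
  $(u^{q^2}, u^{q^4}, u)$, \<open>u\<close> in \<open>F\<^bsub>q\<^sup>6\<^esub>\<close>, which are the fixed vectors of \<open>phi\<close>
  and represent the points of $\Pi$.\<close>

definition coord_matrix :: "'f alg_closure ^ 3 ^ 3" where
  "coord_matrix = vector [vector [1, frob \<beta>, frob \<beta> ^ 2],
     vector [1, frob (frob \<beta>), frob (frob \<beta>) ^ 2], vector [1, \<beta>, \<beta> ^ 2]]"

text \<open>A Vandermonde determinant in the three conjugates of \<beta>.\<close>

lemma det_coord: "det coord_matrix \<noteq> 0"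
proof -
  have "det coord_matrix = (frob (frob \<beta>) - frob \<beta>) * ((\<beta> - frob \<beta>) * (\<beta> - frob (frob \<beta>)))"
    by (simp add: det_3 coord_matrix_def power2_eq_square[of "frob _"] power2_eq_square[of \<beta>] algebra_simps)
  then show ?thesis using beta_distinct by simp
qed

definition inv_matrix :: "'f alg_closure ^ 3 ^ 3" where
  "inv_matrix = (SOME M. coord_matrix ** M = mat 1 \<and> M ** coord_matrix = mat 1)"

lemma inv_matrix: "inv_matrix ** coord_matrix = mat 1" "coord_matrix ** inv_matrix = mat 1"
proof -
  have "\<exists>M. coord_matrix ** M = mat 1 \<and> M ** coord_matrix = mat 1"
    using det_coord unfolding invertible_det_nz[symmetric] invertible_def .
  from someI_ex[OF this] show "inv_matrix ** coord_matrix = mat 1" "coord_matrix ** inv_matrix = mat 1"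
    unfolding inv_matrix_def by simp_all
qed

lemma coord_inv: "coord_matrix *v (inv_matrix *v x) = x" "inv_matrix *v (coord_matrix *v x) = x"
  by (simp_all add: matrix_vector_mul_assoc inv_matrix)

text \<open>Each row of the matrix holds the powers of one conjugate of \<beta>, and Frobenius
  permutes these rows cyclically, just as \<open>phi\<close> permutes the coordinates.\<close>

lemma coord_frob: "coord_matrix *v (\<chi> i. frob (v $ i)) = phi (coord_matrix *v v)"
proof -
  have e: "(x ^ 2) ^ (q^2) = (frob x) ^ 2" for x :: "'f alg_closure" by (simp add: mult.commute flip: power_mult)
  show ?thesis
    unfolding vec3_eq_iff phi_nth
    by (simp add: matrix_vector_mult_def sum_3 coord_matrix_def frob_add power_mult_distrib e beta_frob3)
qed

lemma frob_fixed_iff: "(\<forall>i. v $ i \<in> GF (q^2)) \<longleftrightarrow> phi (coord_matrix *v v) = coord_matrix *v v"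
proof -
  have "(\<forall>i. v $ i \<in> GF (q^2)) \<longleftrightarrow> (\<chi> i. frob (v $ i)) = v" by (simp add: GF_def vec_eq_iff)
  also have "\<dots> \<longleftrightarrow> coord_matrix *v (\<chi> i. frob (v $ i)) = coord_matrix *v v" by (metis coord_inv(2))
  finally show ?thesis unfolding coord_frob .
qed

text \<open>Three Frobenius steps fix the coordinate matrix, hence its unique inverse.\<close>

lemma inv_matrix_entries: "inv_matrix $ i $ j \<in> GF (q^6)"
proof -
  define M :: "'f alg_closure ^ 3 ^ 3" where "M = (\<chi> i j. frob (frob (frob (inv_matrix $ i $ j))))"
  have c: "frob (frob (frob (coord_matrix $ i $ j))) = coord_matrix $ i $ j" for i j
  proof -
    have e: "(x ^ 2) ^ (q^2) = (frob x) ^ 2" for x :: "'f alg_closure" by (simp add: mult.commute flip: power_mult)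
    show ?thesis using exhaust_3[of i] exhaust_3[of j]
      by (elim disjE) (simp_all add: coord_matrix_def e beta_frob3)
  qed
  have "M ** coord_matrix = mat 1"
  proof -
    have "(M ** coord_matrix) $ i $ j = frob (frob (frob ((inv_matrix ** coord_matrix) $ i $ j)))" for i j
      by (simp add: M_def matrix_matrix_mult_def frob_sum power_mult_distrib c)
    also have "frob (frob (frob ((inv_matrix ** coord_matrix) $ i $ j))) = (mat 1 :: 'f alg_closure ^ 3 ^ 3) $ i $ j" for i j
      unfolding inv_matrix using q2 by (simp add: mat_def zero_power)
    finally show ?thesis by (simp add: vec_eq_iff)
  qed
  then have "M = inv_matrix"
    by (metis inv_matrix(2) matrix_mul_assoc matrix_mul_lid matrix_mul_rid)
  then have "M $ i $ j = inv_matrix $ i $ j" by (simp only:)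
  then have "frob (frob (frob (inv_matrix $ i $ j))) = inv_matrix $ i $ j" by (simp only: M_def vec_lambda_beta)
  then show ?thesis by (simp add: GF6_iff)
qed

definition rep :: "'f alg_closure \<Rightarrow> 'f alg_closure ^ 3" where
  "rep \<gamma> = vector [\<gamma>, \<gamma> ^ (q^2 + 1), 1]"

lemma rep_nth [simp]: "rep \<gamma> $ 1 = \<gamma>" "rep \<gamma> $ 2 = \<gamma> ^ (q^2 + 1)" "rep \<gamma> $ 3 = 1"
  by (simp_all add: rep_def)

lemma singer_plane_eq: "singer_plane q = {pt (rep \<gamma>) | \<gamma>. \<gamma> ^ (q^4 + q^2 + 1) = 1}"
  unfolding singer_plane_def rep_def using norm1_GF6 GF6_iff by blast

lemma pt_scale:
  assumes k: "k \<noteq> 0"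
  shows "pt (k *s x) = pt (x :: 'f alg_closure ^ 3)"
proof (intro subset_antisym subsetI)
  fix y assume "y \<in> pt (k *s x)"
  then obtain c where c: "c \<noteq> 0" "y = c *s (k *s x)" unfolding mem_pt by blast
  have "y = (c * k) *s x" unfolding c(2) by (simp add: vec_eq_iff mult.assoc)
  then show "y \<in> pt x" unfolding mem_pt using c(1) k by (intro exI[of _ "c * k"]) simp
next
  fix y assume "y \<in> pt x"
  then obtain c where c: "c \<noteq> 0" "y = c *s x" unfolding mem_pt by blast
  have "y = (c / k) *s (k *s x)" unfolding c(2) using k by (simp add: vec_eq_iff)
  then show "y \<in> pt (k *s x)" unfolding mem_pt using c(1) k by (intro exI[of _ "c / k"]) simp
qed

lemma proj_map_pt: "proj_map M (pt x) = pt (M *v x)"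
  unfolding proj_map_def pt_def by (auto simp: image_def vector_scalar_commute)

lemma exp_Q: "\<gamma> ^ (q^2 + 1) = \<gamma> * frob \<gamma>" by (simp add: power_add)

lemma exp_Q2: "\<gamma> ^ (q^4 + q^2 + 1) = \<gamma> * frob \<gamma> * frob (frob \<gamma>)" for \<gamma> :: "'f alg_closure"
proof -
  have "q^4 = q^2 * q^2" by (simp flip: power_add)
  then show ?thesis by (simp only: power_add power_mult power_one_right mult_ac)
qed

lemma rep_phi:
  assumes "\<gamma> ^ (q^4 + q^2 + 1) = 1"
  shows "\<gamma> *s phi (rep \<gamma>) = rep \<gamma>"
  using assms unfolding exp_Q2 by (simp add: vec3_eq_iff phi_nth exp_Q power_mult_distrib mult_ac)

text \<open>Hilbert 90 in explicit form: for u^(q^2-1) = \<gamma>, the multiple of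
  \<open>rep \<gamma>\<close> by u is fixed by \<open>phi\<close>, and the norm condition on
  \<gamma> puts u into the field with q^6 elements.\<close>

lemma norm1_fixed_rep:
  assumes "\<gamma> ^ (q^4 + q^2 + 1) = 1"
  obtains u where "u \<noteq> 0" "phi (u *s rep \<gamma>) = u *s rep \<gamma>" "frob u = \<gamma> * u" "frob (frob (frob u)) = u"
proof -
  have g0: "\<gamma> \<noteq> 0" using assms by (auto simp: zero_power)
  have "q^2 - 1 > 0" using N_pos q2 by simp
  then obtain u where u: "u ^ (q^2 - 1) = \<gamma>" using nth_root_exists by blast
  then have u0: "u \<noteq> 0" using g0 \<open>q^2 - 1 > 0\<close> by (auto simp: zero_power)
  have "frob u = u ^ Suc (q^2 - 1)" using q2 by simp
  then have f: "frob u = \<gamma> * u" using u by (simp add: mult.commute)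
  have "phi (u *s rep \<gamma>) = u *s (\<gamma> *s phi (rep \<gamma>))" by (simp add: phi_scale f vector_smult_assoc mult.commute)
  then have p: "phi (u *s rep \<gamma>) = u *s rep \<gamma>" using rep_phi[OF assms] by simp
  have "frob (frob (frob u)) = (\<gamma> * frob \<gamma> * frob (frob \<gamma>)) * u"
    by (simp add: f power_mult_distrib mult_ac)
  then have "frob (frob (frob u)) = u" using assms unfolding exp_Q2 by simp
  then show ?thesis using that u0 p f by blast
qed

text \<open>Vectors fixed by \<open>phi\<close> correspond to vectors over the field with q^2
  elements. Each point of \<Pi> has a fixed representative, and a nonzero fixed vector is determined
  by its last entry u, with \<gamma> = u^(q^2-1).\<close>

lemma proj_map_plane: "proj_map inv_matrix ` singer_plane q = PG (GF (q^2))"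
proof (intro subset_antisym subsetI)
  fix P assume "P \<in> proj_map inv_matrix ` singer_plane q"
  then obtain \<gamma> where g: "\<gamma> ^ (q^4 + q^2 + 1) = 1" "P = pt (inv_matrix *v rep \<gamma>)"
    unfolding singer_plane_eq by (auto simp: proj_map_pt)
  obtain u where u: "u \<noteq> 0" "phi (u *s rep \<gamma>) = u *s rep \<gamma>" using norm1_fixed_rep[OF g(1)] by metis
  define v where "v = inv_matrix *v (u *s rep \<gamma>)"
  have cv: "coord_matrix *v v = u *s rep \<gamma>" by (simp add: v_def coord_inv)
  have "v \<noteq> 0"
  proof
    assume "v = 0"
    then have "u *s rep \<gamma> = 0" using cv by simp
    then show False using u(1) by (simp add: vec3_eq_iff)
  qed
  moreover have "\<forall>i. v $ i \<in> GF (q^2)" unfolding frob_fixed_iff cv by (rule u(2))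
  moreover have "P = pt v" unfolding g(2) v_def vector_scalar_commute pt_scale[OF u(1)] ..
  ultimately show "P \<in> PG (GF (q^2))" unfolding PG_def by blast
next
  fix P :: "('f alg_closure ^ 3) set" assume "P \<in> PG (GF (q^2))"
  then obtain v where v: "P = pt v" "v \<noteq> 0" "\<forall>i. v $ i \<in> GF (q^2)" unfolding PG_def by blast
  define x where "x = coord_matrix *v v"
  have x: "phi x = x" using v(3) unfolding frob_fixed_iff x_def .
  have vx: "v = inv_matrix *v x" by (simp add: x_def coord_inv)
  define u where "u = x $ 3"
  have x12: "x $ 1 = frob u" "x $ 2 = frob (frob u)" "frob (frob (frob u)) = u"
    using x unfolding vec3_eq_iff phi_nth by (simp_all add: u_def)
  have u0: "u \<noteq> 0"
  proof
    assume "u = 0"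
    then have "x = 0" using x12 by (simp add: vec3_eq_iff frob_0 u_def)
    then show False using vx v(2) by simp
  qed
  define \<gamma> where "\<gamma> = frob u / u"
  have g: "\<gamma> ^ (q^4 + q^2 + 1) = 1" unfolding exp_Q2 using u0 x12(3) by (simp add: \<gamma>_def power_divide)
  have "x = u *s rep \<gamma>" unfolding vec3_eq_iff using x12 u0
    by (simp add: exp_Q \<gamma>_def power_divide u_def[symmetric])
  then have "P = proj_map inv_matrix (pt (rep \<gamma>))"
    unfolding v(1) vx by (simp add: proj_map_pt vector_scalar_commute pt_scale[OF u0])
  then show "P \<in> proj_map inv_matrix ` singer_plane q" using g unfolding singer_plane_eq by blast
qed

text \<open>Galois descent: invariance under \<open>phi\<close> means that in the new coordinates
  the coefficients are fixed by Frobenius.\<close>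

lemma invariant_form_coeffs:
  assumes F: "ternary_form d F" and inv: "\<And>x. F (phi x) = frob (F x)"
  shows "(\<lambda>v. F (coord_matrix *v v)) \<in> forms (GF (q^2)) d"
proof -
  have "ternary_form d (\<lambda>v. F (coord_matrix *v v))"
    by (rule ternary_form_compose[OF F]) (rule ternary_form_linear)
  then have "(\<lambda>v. F (coord_matrix *v v)) \<in> forms UNIV d" by (simp add: forms_iff_ternary_form)
  then obtain c where c: "(\<lambda>v. F (coord_matrix *v v)) =
    (\<lambda>x. \<Sum>i\<le>d. \<Sum>j\<le>d - i. c i j * x $ 1 ^ i * x $ 2 ^ j * x $ 3 ^ (d - i - j))" by (auto simp: forms_def)
  have "frob (c i j) = c i j" if "i + j \<le> d" for i j
  proof -
    have "(\<Sum>i\<le>d. \<Sum>j\<le>d - i. (frob (c i j) - c i j) * x $ 1 ^ i * x $ 2 ^ j * x $ 3 ^ (d - i - j)) = 0" for x :: "'f alg_closure ^ 3"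
    proof -
      \<comment> \<open>Coefficients are compared at an arbitrary vector x, which is the Frobenius
        image of some v because roots exist.\<close>
      have "\<exists>y. frob y = x $ i" for i using nth_root_exists[of "q^2" "x $ i"] q2 by simp
      then have "\<exists>y. \<forall>i. frob (y i) = x $ i" by (intro choice allI)
      then obtain y where y: "\<And>i. frob (y i) = x $ i" by blast
      define v :: "'f alg_closure ^ 3" where "v = (\<chi> i. y i)"
      have x: "x = (\<chi> i. frob (v $ i))" by (simp add: v_def y)
      have pw: "(z ^ n) ^ (q^2) = (frob z) ^ n" for z :: "'f alg_closure" and n by (simp add: mult.commute flip: power_mult)
      have "frob (F (coord_matrix *v v)) = (\<Sum>i\<le>d. \<Sum>j\<le>d - i. frob (c i j) * x $ 1 ^ i * x $ 2 ^ j * x $ 3 ^ (d - i - j))"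
        unfolding fun_cong[OF c] frob_sum by (simp add: power_mult_distrib pw x)
      moreover have "frob (F (coord_matrix *v v)) = F (coord_matrix *v x)" unfolding x coord_frob inv ..
      ultimately show ?thesis unfolding fun_cong[OF c] by (simp add: sum_subtractf left_diff_distrib)
    qed
    from form_coeffs_zero[OF this that] show ?thesis by simp
  qed
  \<comment> \<open>\<open>forms\<close> constrains the whole coefficient array, so the entries
    beyond degree d are reset to 0.\<close>
  then have "\<forall>i j. (if i + j \<le> d then c i j else 0) \<in> GF (q^2)" by (simp add: GF_def frob_0)
  moreover have "(\<lambda>v. F (coord_matrix *v v)) =
    (\<lambda>x. \<Sum>i\<le>d. \<Sum>j\<le>d - i. (if i + j \<le> d then c i j else 0) * x $ 1 ^ i * x $ 2 ^ j * x $ 3 ^ (d - i - j))"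
    unfolding c by (intro ext sum.cong refl) auto
  ultimately show ?thesis unfolding forms_def by (intro CollectI exI conjI)
qed

lemma defined_over_plane_invariant:
  assumes "ternary_form d F" "\<And>x. F (phi x) = frob (F x)" "ternary_form d E" "\<And>x. E (phi x) = frob (E x)"
    and "x \<in> \<Union>C" "E x \<noteq> 0"
  shows "defined_over_plane q C (frac C F E)"
  unfolding defined_over_plane_def
proof (intro exI[of _ inv_matrix] conjI allI)
  show "invertible inv_matrix" unfolding invertible_def using inv_matrix by blast
  show "inv_matrix $ i $ j \<in> GF (q^6)" for i j by (rule inv_matrix_entries)
  show "proj_map inv_matrix ` singer_plane q = PG (GF (q^2))" by (rule proj_map_plane)
  let ?A = "\<lambda>v. F (coord_matrix *v v)" and ?B = "\<lambda>v. E (coord_matrix *v v)"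
  obtain P where P: "P \<in> C" "x \<in> P" using assms(5) by blast
  have "inv_matrix *v x \<in> \<Union>(proj_map inv_matrix ` C)" using P by (auto simp: proj_map_def)
  moreover have "?B (inv_matrix *v x) \<noteq> 0" using assms(6) by (simp add: coord_inv)
  ultimately have "(?A, ?B) \<in> fractions (GF (q^2)) (proj_map inv_matrix ` C)"
    using invariant_form_coeffs[OF assms(1,2)] invariant_form_coeffs[OF assms(3,4)]
    unfolding fractions_def by blast
  moreover have "frac C F E = frac C (\<lambda>x. ?A (inv_matrix *v x)) (\<lambda>x. ?B (inv_matrix *v x))"
    by (simp add: coord_inv)
  ultimately show "\<exists>(A, B)\<in>fractions (GF (q^2)) (proj_map inv_matrix ` C).
      frac C F E = frac C (\<lambda>x. A (inv_matrix *v x)) (\<lambda>x. B (inv_matrix *v x))"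
    by (intro bexI[of _ "(?A, ?B)"]) (simp only: prod.case)
qed

end

section \<open>The Singer orbits on the Hermitian curve\<close>

context singer_setting
begin

lemma tau_nz: "\<tau> \<noteq> 0" using tau by (auto simp: zero_power)

sublocale C: klein_curve q expo \<tau> "\<tau> ^ (q^2 + 1)" 1
  using char_props q2 tau_nz by unfold_locales auto

lemma hermitian_curve_eq: "hermitian_curve q \<tau> = C.curve"
  by (simp only: hermitian_curve_def C.curve_def C.cone_def mem_Collect_eq mult_1_left)

abbreviation N :: nat where "N \<equiv> q^2 - q + 1"

text \<open>At a point of \<Pi> a cyclic form is \<gamma>^q times a trinomial in \<gamma>^N, since
  q^3 + 1 = N (q + 1) and q^2 + 1 = N + q. The group multiplies \<gamma> by N-th roots of unity, so
  \<gamma>^N labels the Singer orbits.\<close>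

lemma cyclic_rep:
  "C.cyclic_form A B D (rep \<gamma>) = \<gamma> ^ q * (A * (\<gamma> ^ N) ^ (q + 1) + B * \<gamma> ^ N + D)"
proof -
  have "\<gamma> * (\<gamma> ^ (q^2 + 1)) ^ q = \<gamma> ^ ((q^2 + 1) * q + 1)" by (simp flip: power_mult power_Suc)
  also have "(q^2 + 1) * q + 1 = q + N * (q + 1)"
    using q3_eq by (simp add: power2_eq_square power3_eq_cube algebra_simps)
  also have "\<gamma> ^ (q + N * (q + 1)) = \<gamma> ^ q * (\<gamma> ^ N) ^ (q + 1)" by (simp only: power_add[of \<gamma> q "N * (q + 1)"] power_mult)
  finally have 1: "\<gamma> * (\<gamma> ^ (q^2 + 1)) ^ q = \<gamma> ^ q * (\<gamma> ^ N) ^ (q + 1)" .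
  have 2: "\<gamma> ^ (q^2 + 1) = \<gamma> ^ q * \<gamma> ^ N" unfolding Q1_eq power_add[of \<gamma> N q] by (rule mult.commute)
  have "C.cyclic_form A B D (rep \<gamma>) = A * (\<gamma> * (\<gamma> ^ (q^2 + 1)) ^ q) + B * \<gamma> ^ (q^2 + 1) + D * \<gamma> ^ q"
    by (simp only: C.cyclic_form_def rep_nth power_one mult_1_right mult.assoc)
  then show ?thesis unfolding 1 unfolding 2 by (simp only: distrib_left mult_ac)
qed

text \<open>The trinomial of the curve itself; its roots label the q + 1 orbits on the
  curve.\<close>

definition h :: "'f alg_closure \<Rightarrow> 'f alg_closure" where
  "h \<delta> = \<tau> * \<delta> ^ (q + 1) + \<tau> ^ (q^2 + 1) * \<delta> + 1"

lemma cone_iff: "x \<in> C.cone \<longleftrightarrow> x \<noteq> 0 \<and> C.cyclic_form \<tau> (\<tau> ^ (q^2 + 1)) 1 x = 0"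
  by (simp only: C.cone_def C.cyclic_form_def mem_Collect_eq)

lemma rep_nonzero: "rep \<gamma> \<noteq> 0" by (simp add: vec3_eq_iff)

lemma rep_cone: "\<gamma> \<noteq> 0 \<Longrightarrow> rep \<gamma> \<in> C.cone \<longleftrightarrow> h (\<gamma> ^ N) = 0"
  unfolding cone_iff cyclic_rep using rep_nonzero by (simp only: h_def mult_eq_0_iff power_eq_0_iff) simp

lemma h_root_nz: "h \<delta> = 0 \<Longrightarrow> \<delta> \<noteq> 0" by (auto simp: h_def)

lemma tau_q3: "\<tau> ^ (q^3) = \<tau>"
proof -
  obtain m where m: "q = Suc m" using q2 by (cases q) auto
  have "q^3 = (q^2 + q + 1) * (q - 1) + 1"
    by (simp add: m power2_eq_square power3_eq_cube algebra_simps)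
  then have "\<tau> ^ (q^3) = (\<tau> ^ (q^2 + q + 1)) ^ (q - 1) * \<tau>" by (simp only: power_add[of \<tau> _ 1] power_mult power_one_right)
  then show ?thesis unfolding tau by simp
qed

text \<open>Raising h(\<delta>) = 0 to the power q, multiplying by \<delta> and eliminating \<tau>
  \<delta>^(q+1) by the same equation leaves \<tau>^q (\<delta>^(q^2+q+1) - 1) = 0. So every N-th
  root of \<delta> gives a point of \<Pi>.\<close>

lemma h_root_norm:
  assumes h: "h \<delta> = 0"
  shows "\<delta> ^ (q^2 + q + 1) = 1"
proof -
  have "0 = (h \<delta>) ^ q * \<delta>" using h q2 by (simp add: zero_power)
  also have "\<dots> = (\<tau> ^ q * (\<delta> ^ (q + 1)) ^ q + (\<tau> ^ (q^2 + 1)) ^ q * \<delta> ^ q + 1) * \<delta>"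
    by (simp only: h_def q_add power_mult_distrib power_one)
  also have "\<dots> = \<tau> ^ q * ((\<delta> ^ (q + 1)) ^ q * \<delta>) + (\<tau> ^ (q^2 + 1)) ^ q * (\<delta> ^ q * \<delta>) + \<delta>"
    by (simp only: distrib_right mult_1_left mult.assoc)
  also have "(\<delta> ^ (q + 1)) ^ q * \<delta> = \<delta> ^ (q^2 + q + 1)"
  proof -
    have "q^2 + q + 1 = Suc ((q + 1) * q)" by (simp add: power2_eq_square)
    then show ?thesis by (simp only: power_mult power_Suc2)
  qed
  also have "(\<tau> ^ (q^2 + 1)) ^ q = \<tau> ^ q * \<tau>"
  proof -
    have "(q^2 + 1) * q = q + q^3" by (simp add: power2_eq_square power3_eq_cube)
    then have "(\<tau> ^ (q^2 + 1)) ^ q = \<tau> ^ (q + q^3)" by (simp only: power_mult[symmetric])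
    then show ?thesis by (simp only: power_add[of \<tau> q "q^3"] tau_q3)
  qed
  also have "\<tau> ^ q * \<tau> * (\<delta> ^ q * \<delta>) = \<tau> ^ q * (\<tau> * \<delta> ^ (q + 1))" by (simp add: mult_ac)
  also have "\<tau> * \<delta> ^ (q + 1) = - (\<tau> ^ (q^2 + 1) * \<delta>) - 1"
  proof -
    have "\<tau> * \<delta> ^ (q + 1) = h \<delta> - \<tau> ^ (q^2 + 1) * \<delta> - 1" unfolding h_def by simp
    then show ?thesis unfolding h by simp
  qed
  also have "\<tau> ^ q * (- (\<tau> ^ (q^2 + 1) * \<delta>) - 1) = - (\<tau> ^ (q^2 + q + 1) * \<delta>) - \<tau> ^ q"
    by (simp add: right_diff_distrib power_add mult_ac)
  finally have "\<tau> ^ q * (\<delta> ^ (q^2 + q + 1) - 1) = 0" unfolding tau by (simp add: algebra_simps)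
  then show ?thesis using tau_nz by simp
qed

text \<open>The trinomial is separable, because h(x) = x h'(x) + 1 in this characteristic.\<close>

lemma card_h_roots: "card {\<delta>. h \<delta> = 0} = q + 1" "finite {\<delta>. h \<delta> = 0}"
proof -
  define p where "p = Polynomial.monom \<tau> (q + 1) + [:1, \<tau> ^ (q^2 + 1):]"
  have p: "poly p x = h x" for x unfolding p_def h_def by (simp add: poly_monom algebra_simps)
  have d: "degree p = q + 1"
    unfolding p_def using q2 tau_nz by (subst degree_add_eq_left) (auto simp: Polynomial.degree_monom_eq)
  have "pderiv p = Polynomial.monom \<tau> q + [:\<tau> ^ (q^2 + 1):]"
    unfolding p_def using C.of_nat_q by (simp add: pderiv_add pderiv_monom pderiv_pCons)
  then have p': "poly (pderiv p) x = \<tau> * x ^ q + \<tau> ^ (q^2 + 1)" for x by (simp add: poly_monom)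
  have "h x = x * poly (pderiv p) x + 1" for x unfolding p' h_def by (simp add: algebra_simps)
  then have "poly (pderiv p) x \<noteq> 0" if "poly p x = 0" for x using that unfolding p by auto
  moreover have p0: "p \<noteq> 0" using d by auto
  ultimately show "card {\<delta>. h \<delta> = 0} = q + 1" using card_roots_separable[of p] by (simp add: p d)
  show "finite {\<delta>. h \<delta> = 0}" using poly_roots_finite[OF p0] by (simp add: p)
qed

text \<open>The multiples by \<beta>^l are distinct, as \<beta> has order N, and they exhaust the
  roots of a polynomial of degree N.\<close>

lemma fibre_N:
  assumes "\<gamma>1 \<noteq> 0"
  shows "{\<gamma>. \<gamma> ^ N = \<gamma>1 ^ N} = (\<lambda>l. \<beta> ^ l * \<gamma>1) ` {..<N}" "inj_on (\<lambda>l. \<beta> ^ l * \<gamma>1) {..<N}"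
    "card {\<gamma>. \<gamma> ^ N = \<gamma>1 ^ N} = N" "finite {\<gamma>. \<gamma> ^ N = \<gamma>1 ^ N}"
proof -
  have lt: "\<beta> ^ l \<noteq> \<beta> ^ l'" if "l < l'" "l' < N" for l l'
  proof
    assume e: "\<beta> ^ l = \<beta> ^ l'"
    have "\<beta> ^ l' = \<beta> ^ l * \<beta> ^ (l' - l)" using that by (simp flip: power_add)
    then have "\<beta> ^ (l' - l) = 1" using e beta_nz by simp
    then show False using beta_order that by (metis diff_is_0_eq less_imp_diff_less not_gr_zero not_le)
  qed
  show inj: "inj_on (\<lambda>l. \<beta> ^ l * \<gamma>1) {..<N}"
  proof (rule inj_onI)
    fix l l' assume "l \<in> {..<N}" "l' \<in> {..<N}" "\<beta> ^ l * \<gamma>1 = \<beta> ^ l' * \<gamma>1"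
    then show "l = l'" using lt[of l l'] lt[of l' l] assms by (metis lessThan_iff linorder_neqE_nat mult_right_cancel)
  qed
  define p where "p = Polynomial.monom 1 N - [:\<gamma>1 ^ N:]"
  have p: "poly p y = y ^ N - \<gamma>1 ^ N" for y by (simp only: p_def poly_diff poly_monom mult_1_left poly_pCons poly_0 mult_zero_right add_0_right)
  have "Polynomial.coeff p N = 1" using N_pos by (simp add: p_def coeff_pCons)
  then have p0: "p \<noteq> 0" by auto
  have "degree p \<le> N" unfolding p_def by (intro degree_diff_le Polynomial.degree_monom_le) simp
  then have le: "card {\<gamma>. \<gamma> ^ N = \<gamma>1 ^ N} \<le> N" and fin: "finite {\<gamma>. \<gamma> ^ N = \<gamma>1 ^ N}"
    using card_poly_roots_bound[OF p0] poly_roots_finite[OF p0] unfolding p by (simp_all only: right_minus_eq)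
  have sub: "(\<lambda>l. \<beta> ^ l * \<gamma>1) ` {..<N} \<subseteq> {\<gamma>. \<gamma> ^ N = \<gamma>1 ^ N}"
  proof clarify
    fix l
    have "(\<beta> ^ l * \<gamma>1) ^ N = (\<beta> ^ N) ^ l * \<gamma>1 ^ N" by (simp only: power_mult_distrib power_mult[symmetric] mult.commute)
    then show "(\<beta> ^ l * \<gamma>1) ^ N = \<gamma>1 ^ N" unfolding beta by simp
  qed
  have "card ((\<lambda>l. \<beta> ^ l * \<gamma>1) ` {..<N}) = N" using inj by (simp only: card_image card_lessThan)
  then show eq: "{\<gamma>. \<gamma> ^ N = \<gamma>1 ^ N} = (\<lambda>l. \<beta> ^ l * \<gamma>1) ` {..<N}"
    using card_seteq[OF fin sub] le by simp
  show "card {\<gamma>. \<gamma> ^ N = \<gamma>1 ^ N} = N" unfolding eq using inj by (simp only: card_image card_lessThan)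
  show "finite {\<gamma>. \<gamma> ^ N = \<gamma>1 ^ N}" by (rule fin)
qed

lemma h_root_norm1: "h (\<gamma> ^ N) = 0 \<Longrightarrow> \<gamma> ^ (q^4 + q^2 + 1) = 1"
  using h_root_norm[of "\<gamma> ^ N"] by (simp only: q421_eq power_mult)

lemma h_root_gamma_nz: "h (\<gamma> ^ N) = 0 \<Longrightarrow> \<gamma> \<noteq> 0"
  using h_root_nz N_pos by (metis power_eq_0_iff)

lemma pt_rep_inj: "pt (rep \<gamma>) = pt (rep \<gamma>') \<Longrightarrow> \<gamma> = \<gamma>'"
proof -
  assume "pt (rep \<gamma>) = pt (rep \<gamma>')"
  then have "rep \<gamma>' \<in> pt (rep \<gamma>)" using self_mem_pt by simp
  then obtain k where "rep \<gamma>' = k *s rep \<gamma>" by (auto simp: mem_pt)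
  then show ?thesis by (simp add: vec3_eq_iff)
qed

lemma curve_plane: "hermitian_curve q \<tau> \<inter> singer_plane q = (\<lambda>\<gamma>. pt (rep \<gamma>)) ` {\<gamma>. h (\<gamma> ^ N) = 0}"
proof (intro subset_antisym subsetI)
  fix P assume P: "P \<in> hermitian_curve q \<tau> \<inter> singer_plane q"
  then obtain \<gamma> where g: "\<gamma> ^ (q^4 + q^2 + 1) = 1" "P = pt (rep \<gamma>)" unfolding singer_plane_eq by blast
  have "P \<subseteq> C.cone" using P unfolding hermitian_curve_eq C.Union_curve[symmetric] by blast
  then have "rep \<gamma> \<in> C.cone" unfolding g(2) using self_mem_pt by blast
  moreover have "\<gamma> \<noteq> 0" using g(1) by (auto simp: zero_power)
  ultimately show "P \<in> (\<lambda>\<gamma>. pt (rep \<gamma>)) ` {\<gamma>. h (\<gamma> ^ N) = 0}" using rep_cone g(2) by blast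
next
  fix P assume "P \<in> (\<lambda>\<gamma>. pt (rep \<gamma>)) ` {\<gamma>. h (\<gamma> ^ N) = 0}"
  then obtain \<gamma> where g: "h (\<gamma> ^ N) = 0" "P = pt (rep \<gamma>)" by blast
  then have "rep \<gamma> \<in> C.cone" using rep_cone h_root_gamma_nz by blast
  then show "P \<in> hermitian_curve q \<tau> \<inter> singer_plane q"
    using h_root_norm1[OF g(1)] g(2) unfolding singer_plane_eq hermitian_curve_eq C.curve_def by blast
qed

text \<open>The generator multiplies the parameter \<gamma> by \<beta>, because \<beta>^(q^2+1) =
  \<beta>^q.\<close>

lemma orbit_eq:
  assumes "\<gamma>0 \<noteq> 0"
  shows "singer_orbit q \<beta> (pt (rep \<gamma>0)) = (\<lambda>\<gamma>. pt (rep \<gamma>)) ` {\<gamma>. \<gamma> ^ N = \<gamma>0 ^ N}"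
proof -
  let ?D = "vector [vector [\<beta>, 0, 0], vector [0, \<beta> ^ q, 0], vector [0, 0, 1]] :: 'f alg_closure ^ 3 ^ 3"
  have D: "?D *v rep \<gamma> = rep (\<beta> * \<gamma>)" for \<gamma>
  proof -
    have "(\<beta> * \<gamma>) ^ (q^2 + 1) = \<beta> ^ q * \<gamma> ^ (q^2 + 1)" by (simp only: power_mult_distrib beta_q2)
    then show ?thesis unfolding vec3_eq_iff rep_nth by (simp only:) (simp add: matrix_vector_mult_def sum_3)
  qed
  have it: "(proj_map ?D ^^ i) (pt (rep \<gamma>0)) = pt (rep (\<beta> ^ i * \<gamma>0))" for i
    by (induction i) (simp_all add: proj_map_pt D mult.assoc)
  have "singer_orbit q \<beta> (pt (rep \<gamma>0)) = range (\<lambda>i. pt (rep (\<beta> ^ i * \<gamma>0)))"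
    unfolding singer_orbit_def singer_group_def by (auto simp flip: it)
  also have "\<dots> = (\<lambda>\<gamma>. pt (rep \<gamma>)) ` range (\<lambda>i. \<beta> ^ i * \<gamma>0)" by blast
  also have "range (\<lambda>i. \<beta> ^ i * \<gamma>0) = {\<gamma>. \<gamma> ^ N = \<gamma>0 ^ N}"
  proof (intro subset_antisym)
    show "range (\<lambda>i. \<beta> ^ i * \<gamma>0) \<subseteq> {\<gamma>. \<gamma> ^ N = \<gamma>0 ^ N}"
    proof clarify
      fix l
      have "(\<beta> ^ l * \<gamma>0) ^ N = (\<beta> ^ N) ^ l * \<gamma>0 ^ N" by (simp only: power_mult_distrib power_mult[symmetric] mult.commute)
      then show "(\<beta> ^ l * \<gamma>0) ^ N = \<gamma>0 ^ N" unfolding beta by simp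
    qed
    show "{\<gamma>. \<gamma> ^ N = \<gamma>0 ^ N} \<subseteq> range (\<lambda>i. \<beta> ^ i * \<gamma>0)" unfolding fibre_N(1)[OF assms] by blast
  qed
  finally show ?thesis .
qed

definition off_orbit :: "'f alg_closure \<Rightarrow> 'f alg_closure set" where
  "off_orbit \<delta>0 = {\<gamma>. h (\<gamma> ^ N) = 0 \<and> \<gamma> ^ N \<noteq> \<delta>0}"

lemma card_off_orbit:
  assumes "h \<delta>0 = 0"
  shows "card (off_orbit \<delta>0) = q * N"
proof -
  let ?R = "{\<delta>. h \<delta> = 0} - {\<delta>0}"
  have cR: "card ?R = q" using card_h_roots assms by (simp add: card_Diff_singleton)
  have fib: "card {\<gamma>. \<gamma> ^ N = \<delta>} = N \<and> finite {\<gamma>. \<gamma> ^ N = \<delta>}" if "\<delta> \<in> ?R" for \<delta>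
  proof -
    obtain \<gamma>1 where g: "\<gamma>1 ^ N = \<delta>" using nth_root_exists[OF N_pos(1)] by blast
    then have "\<gamma>1 \<noteq> 0" using that h_root_gamma_nz[of \<gamma>1] by auto
    from fibre_N[OF this] g show ?thesis by simp
  qed
  have "off_orbit \<delta>0 = (\<Union>\<delta>\<in>?R. {\<gamma>. \<gamma> ^ N = \<delta>})" by (auto simp: off_orbit_def)
  moreover have "card (\<Union>\<delta>\<in>?R. {\<gamma>. \<gamma> ^ N = \<delta>}) = (\<Sum>\<delta>\<in>?R. card {\<gamma>. \<gamma> ^ N = \<delta>})"
    by (rule card_UN_disjoint) (use card_h_roots(2) fib in auto)
  ultimately show ?thesis using fib cR by simp
qed

section \<open>A second invariant form through a given orbit\<close>

text \<open>The form with coefficients c, c^(q^2), c^(q^4) is invariant under the Frobenius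
  collineation, and it is proportional to the curve equation exactly if c^(q^2) = \<tau>^(q^2) c. At
  a fixed vector y its value is the trace of c \<kappa> with \<kappa> = y_1 y_2^q, and c = (w^(q^2)
  - w) / \<kappa> makes this trace telescope to 0.\<close>

lemma pencil_parameter:
  assumes h: "h (\<gamma>1 ^ N) = 0"
  obtains c where "frob (frob (frob c)) = c" "frob c \<noteq> frob \<tau> * c"
    "c * (\<gamma>1 ^ N) ^ (q + 1) + frob c * \<gamma>1 ^ N + frob (frob c) = 0"
proof -
  obtain u where u: "u \<noteq> 0" "phi (u *s rep \<gamma>1) = u *s rep \<gamma>1"
    using norm1_fixed_rep[OF h_root_norm1[OF h]] by metis
  define y where "y = u *s rep \<gamma>1"
  have y: "frob (y $ 3) = y $ 1" "frob (y $ 1) = y $ 2" "frob (y $ 2) = y $ 3"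
    using u(2) unfolding y_def[symmetric] vec3_eq_iff phi_nth by simp_all
  have g: "\<gamma>1 \<noteq> 0" using h by (rule h_root_gamma_nz)
  define \<kappa> where "\<kappa> = y $ 1 * (y $ 2) ^ q"
  have pw: "frob (z ^ q) = (frob z) ^ q" for z :: "'f alg_closure" by (simp add: mult.commute flip: power_mult)
  have k: "frob \<kappa> = y $ 2 * (y $ 3) ^ q" "frob (frob \<kappa>) = y $ 3 * (y $ 1) ^ q"
    by (simp_all add: \<kappa>_def power_mult_distrib pw y)
  then have k3: "frob (frob (frob \<kappa>)) = \<kappa>" by (simp add: \<kappa>_def power_mult_distrib pw y)
  have k0: "\<kappa> \<noteq> 0" using u(1) g by (simp add: \<kappa>_def y_def)
  \<comment> \<open>In terms of w, the excluded equation \<open>frob c = frob \<tau> * c\<close>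
    says that \<open>frob (frob w) - frob w\<close> is \<rho> times
    \<open>frob w - w\<close>.\<close>
  define \<rho> where "\<rho> = frob \<tau> * frob \<kappa> / \<kappa>"
  define cc where "cc w = (frob w - w) / \<kappa>" for w
  have c3: "frob (frob (frob (cc w))) = cc w" if "frob (frob (frob w)) = w" for w
    using that by (simp add: cc_def power_divide frob_diff k3)
  have zero: "cc w * (\<gamma>1 ^ N) ^ (q + 1) + frob (cc w) * \<gamma>1 ^ N + frob (frob (cc w)) = 0"
    if "frob (frob (frob w)) = w" for w
  proof -
    have "C.cyclic_form (cc w) (frob (cc w)) (frob (frob (cc w))) y =
      cc w * \<kappa> + frob (cc w) * frob \<kappa> + frob (frob (cc w)) * frob (frob \<kappa>)"
      unfolding k(2) unfolding k(1) C.cyclic_form_def by (simp add: \<kappa>_def mult.assoc)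
    also have "\<dots> = cc w * \<kappa> + frob (cc w * \<kappa>) + frob (frob (cc w * \<kappa>))" by (simp only: power_mult_distrib)
    also have "cc w * \<kappa> = frob w - w" using k0 by (simp add: cc_def)
    also have "frob w - w + frob (frob w - w) + frob (frob (frob w - w)) = 0" using that by (simp add: frob_diff)
    finally have "C.cyclic_form (cc w) (frob (cc w)) (frob (frob (cc w))) (rep \<gamma>1) = 0"
      unfolding y_def ternary_form_homogeneous[OF C.ternary_form_cyclic] using u(1) by simp
    then show ?thesis unfolding cyclic_rep using g by (simp only: mult_eq_0_iff power_eq_0_iff) simp
  qed
  have ne: "frob (cc w) \<noteq> frob \<tau> * cc w" if "frob (frob w) - frob w \<noteq> \<rho> * (frob w - w)" for w
  proof
    assume e: "frob (cc w) = frob \<tau> * cc w"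
    have kn: "frob \<kappa> \<noteq> 0" using k0 by simp
    have "frob (cc w) = (frob (frob w) - frob w) / frob \<kappa>" by (simp add: cc_def power_divide frob_diff)
    then have "frob (frob w) - frob w = frob \<kappa> * (frob \<tau> * cc w)" using e kn by simp
    also have "\<dots> = \<rho> * (frob w - w)" by (simp add: \<rho>_def cc_def mult_ac)
    finally show False using that by simp
  qed
  have fsq: "frob (x ^ 2) = (frob x) ^ 2" for x :: "'f alg_closure" by (simp add: mult.commute flip: power_mult)
  have sq: "frob (frob (frob (\<beta> ^ 2))) = \<beta> ^ 2" by (simp only: fsq beta_frob3)
  \<comment> \<open>The choices w = \<beta> and w = \<beta>^2 cannot both fail: comparing the two
    relations would give \<beta>^(q^4) = \<beta>.\<close>
  have "frob (frob \<beta>) - frob \<beta> \<noteq> \<rho> * (frob \<beta> - \<beta>) \<or>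
    frob (frob (\<beta> ^ 2)) - frob (\<beta> ^ 2) \<noteq> \<rho> * (frob (\<beta> ^ 2) - \<beta> ^ 2)"
  proof (rule ccontr)
    define v w where "v = frob (frob \<beta>)" and "w = frob \<beta>"
    assume "\<not> ?thesis"
    then have 1: "v - w = \<rho> * (w - \<beta>)" and 2: "v ^ 2 - w ^ 2 = \<rho> * (w ^ 2 - \<beta> ^ 2)"
      unfolding fsq v_def w_def by blast+
    have "(v - w) * (v + w) = (\<rho> * (w - \<beta>)) * (w + \<beta>)" using 2 by (simp add: power2_eq_square algebra_simps)
    then have "(v - w) * (v + w) = (v - w) * (w + \<beta>)" unfolding 1[symmetric] .
    moreover have "v - w \<noteq> 0" using beta_distinct(3) by (simp add: v_def w_def)
    ultimately have "v + w = w + \<beta>" by simp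
    then have "v = \<beta>" by (simp add: add.commute)
    then show False using beta_distinct(2) by (simp add: v_def)
  qed
  then show ?thesis using that c3[OF beta_frob3] zero[OF beta_frob3] ne[of \<beta>] c3[OF sq] zero[OF sq] ne[of "\<beta> ^ 2"] by blast
qed

lemma tau_norm: "\<tau> * frob \<tau> * frob (frob \<tau>) = 1"
proof -
  have "\<tau> ^ (q^4 + q^2 + 1) = (\<tau> ^ (q^2 + q + 1)) ^ N" by (simp only: q421_eq power_mult[symmetric] mult.commute)
  then show ?thesis unfolding exp_Q2 tau by simp
qed

text \<open>By Frobenius and the norm 1 of \<tau>, each of the three minors reduces to the single
  condition on \<open>c\<close>.\<close>

lemma pencil:
  assumes c3: "frob (frob (frob c)) = c" and ne: "frob c \<noteq> frob \<tau> * c"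
  shows "klein_pencil q expo \<tau> (\<tau> ^ (q^2 + 1)) 1 c (frob c) (frob (frob c))"
proof (unfold_locales)
  show "c * 1 \<noteq> \<tau> * frob (frob c)"
  proof
    assume "c * 1 = \<tau> * frob (frob c)"
    then have "frob c = frob (\<tau> * frob (frob c))" by simp
    then show False using ne c3 by (simp add: power_mult_distrib)
  qed
  show "frob c * 1 \<noteq> \<tau> ^ (q^2 + 1) * frob (frob c)"
  proof
    assume e: "frob c * 1 = \<tau> ^ (q^2 + 1) * frob (frob c)"
    then have e1: "frob c = \<tau> * frob \<tau> * frob (frob c)" by (simp only: exp_Q mult_1_right)
    then have "frob (frob c) = frob (\<tau> * frob \<tau> * frob (frob c))" by simp
    also have "\<dots> = frob \<tau> * frob (frob \<tau>) * c" by (simp add: power_mult_distrib c3)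
    finally have "frob c = (\<tau> * frob \<tau> * frob (frob \<tau>)) * (frob \<tau> * c)" using e1 by (simp add: mult_ac)
    then show False using ne unfolding tau_norm by simp
  qed
  show "c * \<tau> ^ (q^2 + 1) \<noteq> \<tau> * frob c"
  proof
    assume "c * \<tau> ^ (q^2 + 1) = \<tau> * frob c"
    then have "\<tau> * (frob \<tau> * c) = \<tau> * frob c" by (simp only: exp_Q mult_ac)
    then show False using ne tau_nz by simp
  qed
qed

lemma common_root:
  assumes "h \<delta> = 0" "c * \<delta> ^ (q + 1) + c' * \<delta> + c'' = 0"
  shows "(c - \<tau> * c'') * \<delta> ^ q + (c' - \<tau> ^ (q^2 + 1) * c'') = 0"
proof -
  have "\<delta> * ((c - \<tau> * c'') * \<delta> ^ q + (c' - \<tau> ^ (q^2 + 1) * c'')) =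
    (c * \<delta> ^ (q + 1) + c' * \<delta> + c'') - c'' * h \<delta>"
    unfolding h_def by (simp add: algebra_simps)
  then show ?thesis using assms h_root_nz[OF assms(1)] by simp
qed

text \<open>Eliminating the constant term from two trinomials leaves a linear equation in
  \<delta>^q, and the q-th power is injective; so two such curves share at most one orbit in
  \<Pi>.\<close>

lemma common_root_unique:
  assumes A: "c \<noteq> \<tau> * c''" and d: "h \<delta> = 0" "c * \<delta> ^ (q + 1) + c' * \<delta> + c'' = 0"
    and d': "h \<delta>' = 0" "c * \<delta>' ^ (q + 1) + c' * \<delta>' + c'' = 0"
  shows "\<delta> = \<delta>'"
proof -
  have "(c - \<tau> * c'') * \<delta> ^ q = (c - \<tau> * c'') * \<delta>' ^ q"
    using common_root[OF d] common_root[OF d'] by (metis add_right_cancel)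
  then have "\<delta> ^ q = \<delta>' ^ q" using A by simp
  then show ?thesis by (rule q_inj)
qed

text \<open>A base point (\<gamma>:y:1) may a priori lie outside \<Pi>; that y = \<gamma>^(q^2+1)
  and \<gamma>^N = \<gamma>0^N has to follow from the two equations.\<close>

lemma base_points_orbit:
  assumes P: "klein_pencil q expo \<tau> (\<tau> ^ (q^2 + 1)) 1 c c' c''"
    and h0: "h (\<gamma>0 ^ N) = 0" and z0: "c * (\<gamma>0 ^ N) ^ (q + 1) + c' * \<gamma>0 ^ N + c'' = 0"
  shows "klein_pencil.base_points q \<tau> (\<tau> ^ (q^2 + 1)) 1 c c' c'' = singer_orbit q \<beta> (pt (rep \<gamma>0))"
proof -
  interpret P: klein_pencil q expo \<tau> "\<tau> ^ (q^2 + 1)" 1 c c' c'' by (rule P)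
  let ?\<delta> = "\<gamma>0 ^ N" and ?A = "c - \<tau> * c''" and ?B = "c' - \<tau> ^ (q^2 + 1) * c''"
  have A: "?A \<noteq> 0" using P.minors(1) by simp
  have d0: "?\<delta> \<noteq> 0" by (rule h_root_nz[OF h0])
  show ?thesis unfolding orbit_eq[OF h_root_gamma_nz[OF h0]]
  proof (intro subset_antisym subsetI)
    fix R assume "R \<in> P.base_points"
    then obtain p where p: "R = pt p" "p \<in> C.cone" "P.E p = 0" "p $ 1 \<noteq> 0" "p $ 2 \<noteq> 0" "p $ 3 \<noteq> 0"
      unfolding P.base_points_def by blast
    define \<gamma> y where "\<gamma> = p $ 1 / p $ 3" and "y = p $ 2 / p $ 3"
    define x :: "'f alg_closure ^ 3" where "x = vector [\<gamma>, y, 1]"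
    have px: "p = p $ 3 *s x" using p by (simp add: vec3_eq_iff x_def \<gamma>_def y_def)
    have xc: "x \<in> C.cone" using C.cone_scale[OF p(6)] p(2) px by metis
    have xE: "P.E x = 0" using tform_scale_nz[OF P.tform_E p(6)] p(3) px by metis
    have g: "\<gamma> \<noteq> 0" and y: "y \<noteq> 0" using p by (simp_all add: \<gamma>_def y_def)
    have e1: "\<tau> * \<gamma> * y ^ q + \<tau> ^ (q^2 + 1) * y + \<gamma> ^ q = 0"
      using xc unfolding cone_iff by (simp add: C.cyclic_form_def x_def)
    have e2: "c * \<gamma> * y ^ q + c' * y + c'' * \<gamma> ^ q = 0" using xE by (simp add: C.cyclic_form_def x_def)
    obtain m where m: "q = Suc m" using q2 by (cases q) auto
    \<comment> \<open>The same elimination as for the known common root \<delta>, which yields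
      \<gamma> y^(q-1) = \<delta>^q.\<close>
    have "y * (?A * \<gamma> * y ^ m + ?B) = (c * \<gamma> * y ^ q + c' * y + c'' * \<gamma> ^ q) - c'' * (\<tau> * \<gamma> * y ^ q + \<tau> ^ (q^2 + 1) * y + \<gamma> ^ q)"
      using m by (simp add: algebra_simps)
    then have "?A * \<gamma> * y ^ m + ?B = 0" using e1 e2 y by simp
    moreover have "?A * ?\<delta> ^ q + ?B = 0" by (rule common_root[OF h0 z0])
    ultimately have "?A * (\<gamma> * y ^ m) = ?A * ?\<delta> ^ q" by (metis add_right_cancel mult.assoc)
    then have gy: "\<gamma> * y ^ m = ?\<delta> ^ q" using A by simp
    \<comment> \<open>In terms of v = y / \<gamma>^q the curve equation becomes linear, and \<delta>
      solves the same linear equation.\<close>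
    define v where "v = y / \<gamma> ^ q"
    have yv: "y = v * \<gamma> ^ q" using g by (simp add: v_def)
    have "\<gamma> * y ^ q = ?\<delta> ^ q * y" using gy m by (metis mult.assoc mult.commute power_Suc)
    then have "\<gamma> ^ q * (\<tau> * ?\<delta> ^ q * v + \<tau> ^ (q^2 + 1) * v + 1) = 0"
      using e1 unfolding mult.assoc[of \<tau>] yv by (simp add: algebra_simps)
    then have v1: "\<tau> * ?\<delta> ^ q * v + \<tau> ^ (q^2 + 1) * v + 1 = 0" using g by simp
    have v2: "\<tau> * ?\<delta> ^ q * ?\<delta> + \<tau> ^ (q^2 + 1) * ?\<delta> + 1 = 0" using h0 unfolding h_def by (simp add: mult_ac)
    have "(v - ?\<delta>) * (\<tau> * ?\<delta> ^ q + \<tau> ^ (q^2 + 1)) = (\<tau> * ?\<delta> ^ q * v + \<tau> ^ (q^2 + 1) * v + 1) - (\<tau> * ?\<delta> ^ q * ?\<delta> + \<tau> ^ (q^2 + 1) * ?\<delta> + 1)"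
      by (simp only: algebra_simps)
    then have "(v - ?\<delta>) * (\<tau> * ?\<delta> ^ q + \<tau> ^ (q^2 + 1)) = 0" unfolding v1 v2 by simp
    moreover have "\<tau> * ?\<delta> ^ q + \<tau> ^ (q^2 + 1) \<noteq> 0"
    proof
      assume "\<tau> * ?\<delta> ^ q + \<tau> ^ (q^2 + 1) = 0"
      then have "(\<tau> * ?\<delta> ^ q + \<tau> ^ (q^2 + 1)) * ?\<delta> + 1 = 1" by simp
      then have "(0 :: 'f alg_closure) = 1" using v2 by (simp only: distrib_right)
      then show False by simp
    qed
    ultimately have v: "v = ?\<delta>" by simp
    have "N = 1 + q * m" using m by (simp add: power2_eq_square)
    then have gN: "\<gamma> ^ N = \<gamma> * (\<gamma> ^ q) ^ m" by (simp only: power_add power_mult power_one_right)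
    have "\<gamma> ^ N * ?\<delta> ^ m = ?\<delta> ^ m * ?\<delta>"
      unfolding gN using gy m unfolding yv v by (simp add: power_mult_distrib mult_ac)
    then have gd: "\<gamma> ^ N = ?\<delta>" using d0 by simp
    have "y = \<gamma> ^ (q^2 + 1)" unfolding Q1_eq power_add[of \<gamma> N q] gd by (simp only: yv v)
    then have "x = rep \<gamma>" by (simp add: x_def rep_def)
    then have "R = pt (rep \<gamma>)" unfolding p(1) using px pt_scale[OF p(6)] by metis
    then show "R \<in> (\<lambda>\<gamma>. pt (rep \<gamma>)) ` {\<gamma>. \<gamma> ^ N = \<gamma>0 ^ N}" using gd by blast
  next
    fix R assume "R \<in> (\<lambda>\<gamma>. pt (rep \<gamma>)) ` {\<gamma>. \<gamma> ^ N = \<gamma>0 ^ N}"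
    then obtain \<gamma> where g: "\<gamma> ^ N = ?\<delta>" "R = pt (rep \<gamma>)" by blast
    have gh: "h (\<gamma> ^ N) = 0" unfolding g(1) by (rule h0)
    then have g0: "\<gamma> \<noteq> 0" by (rule h_root_gamma_nz)
    then have rc: "rep \<gamma> \<in> C.cone" using rep_cone gh by blast
    have "P.E (rep \<gamma>) = 0" unfolding cyclic_rep g(1) z0 by simp
    then show "R \<in> P.base_points" unfolding g(2) P.base_points_iff[OF rc] using g0 by simp
  qed
qed

end

section \<open>The Hermitian Singer codes\<close>

lemma card_exponent_triangle: "2 * card {(j, k). 1 \<le> j \<and> 1 \<le> k \<and> j + k \<le> (n::nat)} = n * (n - 1)"
proof -
  have "{(j, k). 1 \<le> j \<and> 1 \<le> k \<and> j + k \<le> n} = (SIGMA j:{1..<n}. {1..n - j})" by auto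
  then have "card {(j, k). 1 \<le> j \<and> 1 \<le> k \<and> j + k \<le> n} = (\<Sum>j\<in>{1..<n}. n - j)" by simp
  moreover have "2 * (\<Sum>j\<in>{1..<n}. n - j) = n * (n - 1)"
  proof (induction n)
    case (Suc n)
    show ?case
    proof (cases "n = 0")
      case False
      have "(\<Sum>j\<in>{1..<Suc n}. Suc n - j) = (\<Sum>j\<in>{1..<n}. Suc (n - j)) + 1"
        using False by (simp add: Suc_diff_le)
      also have "\<dots> = (\<Sum>j\<in>{1..<n}. n - j) + n" using False by (simp add: sum_Suc)
      finally have "2 * (\<Sum>j\<in>{1..<Suc n}. Suc n - j) = n * (n - 1) + 2 * n" using Suc.IH by simp
      moreover obtain m where "n = Suc m" using False by (cases n) auto
      ultimately show ?thesis by simp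
    qed simp
  qed simp
  ultimately show ?thesis by simp
qed

section \<open>The functional code and its dimension\<close>

text \<open>The coefficient \<open>c\<close> of the denominator is fixed as supplied by
  \<open>pencil_parameter\<close>; \<open>gam\<close> enumerates the parameters \<gamma> of the
  evaluation points.\<close>

locale singer_code = singer_setting q \<tau> \<beta> for q :: nat and \<tau> \<beta> :: "'f::{field,finite} alg_closure" +
  fixes \<gamma>0 c :: "'f alg_closure" and gam :: "'n::finite \<Rightarrow> 'f alg_closure"
  assumes h0: "h (\<gamma>0 ^ N) = 0" and gam: "bij_betw gam UNIV (off_orbit (\<gamma>0 ^ N))"
    and c3: "frob (frob (frob c)) = c" and c_ne: "frob c \<noteq> frob \<tau> * c"
    and c0: "c * (\<gamma>0 ^ N) ^ (q + 1) + frob c * \<gamma>0 ^ N + frob (frob c) = 0"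
begin

sublocale P: klein_pencil q expo \<tau> "\<tau> ^ (q^2 + 1)" 1 c "frob c" "frob (frob c)"
  by (rule pencil[OF c3 c_ne])

lemma gam_props: "h (gam i ^ N) = 0" "gam i ^ N \<noteq> \<gamma>0 ^ N" "gam i \<noteq> 0" "rep (gam i) \<in> C.cone"
proof -
  have "gam i \<in> off_orbit (\<gamma>0 ^ N)" using gam by (auto simp: bij_betw_def)
  then have a: "h (gam i ^ N) = 0 \<and> gam i ^ N \<noteq> \<gamma>0 ^ N" unfolding off_orbit_def by blast
  show 1: "h (gam i ^ N) = 0" by (rule conjunct1[OF a])
  show "gam i ^ N \<noteq> \<gamma>0 ^ N" by (rule conjunct2[OF a])
  show 2: "gam i \<noteq> 0" using 1 by (rule h_root_gamma_nz)
  show "rep (gam i) \<in> C.cone" using rep_cone[OF 2] 1 by blast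
qed

lemma E_gam: "P.E (rep (gam i)) \<noteq> 0"
proof
  assume "P.E (rep (gam i)) = 0"
  then have "c * (gam i ^ N) ^ (q + 1) + frob c * gam i ^ N + frob (frob c) = 0"
    unfolding cyclic_rep using gam_props(3) by (simp only: mult_eq_0_iff power_eq_0_iff) simp
  moreover have "c \<noteq> \<tau> * frob (frob c)" using P.minors(1) by simp
  ultimately show False using common_root_unique[OF _ gam_props(1) _ h0 c0] gam_props(2) by blast
qed

text \<open>Entries are taken in the closure, since a single monomial over E is not invariant under
  the Frobenius collineation.\<close>

definition chi :: "nat \<times> nat \<Rightarrow> 'f alg_closure ^ 'n" where
  "chi s = (\<chi> i. C.mono3 (Suc q - fst s - snd s) (fst s) (snd s) (rep (gam i)) / P.E (rep (gam i)))"

definition W :: "('f ^ 'n) set" where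
  "W = functional_code q C.curve (\<lambda>i. pt (rep (gam i))) (point_sum P.base_points)"

lemma W_span_chi: "ac_vec ` W \<subseteq> vec.span (chi ` C.exponents)"
proof clarify
  fix w assume "w \<in> W"
  then obtain f where f: "f \<in> riemann_roch_space q C.curve (point_sum P.base_points)"
    and w: "\<And>i. to_ac (w $ i) = value_at f (pt (rep (gam i)))"
    unfolding W_def functional_code_def by blast
  have "f \<in> carrier C.FF" "f = \<zero>\<^bsub>C.FF\<^esub> \<or> (\<forall>R\<in>C.curve. ord_at C.curve R f + point_sum P.base_points R \<ge> 0)"
    using f unfolding riemann_roch_space_def principal_divisor_def by blast+
  from P.section_value[OF this] obtain g where g: "\<And>p. p \<in> C.cone \<Longrightarrow> p $ 1 \<noteq> 0 \<Longrightarrow> P.E p \<noteq> 0 \<Longrightarrow> p $ 2 \<noteq> 0 \<Longrightarrow> p $ 3 \<noteq> 0 \<Longrightarrow>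
    value_at f (pt p) = (\<Sum>s\<in>C.exponents. g s * C.mono3 (Suc q - fst s - snd s) (fst s) (snd s) p) / P.E p" by blast
  have "ac_vec w = (\<Sum>s\<in>C.exponents. g s *s chi s)"
    unfolding vec_eq_iff
  proof
    fix i
    have "to_ac (w $ i) = (\<Sum>s\<in>C.exponents. g s * C.mono3 (Suc q - fst s - snd s) (fst s) (snd s) (rep (gam i))) / P.E (rep (gam i))"
      unfolding w by (rule g) (use gam_props E_gam in \<open>simp_all only: rep_nth power_eq_0_iff one_neq_zero not_False_eq_True simp_thms\<close>)
    then show "ac_vec w $ i = (\<Sum>s\<in>C.exponents. g s *s chi s) $ i"
      by (simp add: chi_def sum_divide_distrib)
  qed
  then show "ac_vec w \<in> vec.span (chi ` C.exponents)"
    by (simp add: vec.span_sum vec.span_scale vec.span_base)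
qed

text \<open>The sum of k times a monomial over its three Frobenius conjugates, invariant for k in
  the field with q^6 elements. The denominator is the case of x_1 x_2^q and k = c.\<close>

definition trace_form :: "'f alg_closure \<Rightarrow> nat \<Rightarrow> nat \<Rightarrow> nat \<Rightarrow> 'f alg_closure ^ 3 \<Rightarrow> 'f alg_closure" where
  "trace_form k i j l x = k * C.mono3 i j l x + frob k * C.mono3 l i j x + frob (frob k) * C.mono3 j l i x"

lemma mono3_phi: "C.mono3 i j l (phi x) = frob (C.mono3 j l i x)"
proof -
  have e: "frob (y ^ n) = (frob y) ^ n" for y :: "'f alg_closure" and n by (simp add: mult.commute flip: power_mult)
  show ?thesis by (simp add: C.mono3_def phi_nth power_mult_distrib e mult_ac)
qed

lemma trace_form_phi: "frob (frob (frob k)) = k \<Longrightarrow> trace_form k i j l (phi x) = frob (trace_form k i j l x)"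
  unfolding trace_form_def mono3_phi frob_add by (simp add: power_mult_distrib add_ac)

lemma E_trace_form: "P.E = trace_form c 1 q 0"
  by (simp add: fun_eq_iff trace_form_def C.cyclic_form_def C.mono3_def mult_ac)

lemma adjoint_trace_form:
  assumes "(i, j, l) \<in> C.adjoint_exponents"
  shows "C.adjoint_form (trace_form k i j l)"
proof -
  note 1 = C.adjoint_exponents_rot[OF assms]
  note 2 = C.adjoint_exponents_rot[OF 1]
  show ?thesis unfolding trace_form_def[abs_def]
    by (intro C.adjoint_add C.adjoint_cmult C.adjoint_mono3 assms 1 2)
qed

text \<open>Invariance of numerator and denominator puts the quotient into the Riemann-Roch space
  over the small field. Its values lie there too: a representative satisfies x = \<gamma> phi(x), so
  both forms acquire the same factor \<gamma>^(q+1).\<close>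

lemma trace_form_code:
  assumes k: "frob (frob (frob k)) = k" and ex: "(i, j, l) \<in> C.adjoint_exponents"
  shows "\<exists>w\<in>W. \<forall>n. to_ac (w $ n) = trace_form k i j l (rep (gam n)) / P.E (rep (gam n))"
proof -
  let ?F = "trace_form k i j l"
  let ?f = "C.fr ?F P.E"
  note adj = adjoint_trace_form[OF ex, of k]
  note FE = P.fpair_adjoint[OF adj]
  have Ff: "ternary_form (Suc q) ?F" using adj C.ternary_form_vanishing unfolding C.adjoint_form_def by blast
  have Einv: "P.E (phi x) = frob (P.E x)" for x unfolding E_trace_form by (rule trace_form_phi[OF c3])
  have val: "value_at ?f (pt (rep (gam n))) = ?F (rep (gam n)) / P.E (rep (gam n))" for n
    by (rule C.value_at_fr[OF FE gam_props(4) E_gam])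
  have "?f \<in> carrier C.FF" unfolding C.FF_simps using FE by blast
  moreover have "defined_over_plane q C.curve ?f"
    by (rule defined_over_plane_invariant[OF Ff trace_form_phi[OF k] C.ternary_form_cyclic Einv, of "rep (gam undefined)"])
       (use gam_props(4) E_gam in \<open>simp_all only: C.Union_curve not_False_eq_True\<close>)
  moreover have "?f = \<zero>\<^bsub>C.FF\<^esub> \<or> (\<forall>R\<in>C.curve. principal_divisor C.curve ?f R + point_sum P.base_points R \<ge> 0)"
    unfolding principal_divisor_def using P.section_order[OF adj] C.fr_zero_iff[OF FE] by blast
  ultimately have f: "?f \<in> riemann_roch_space q C.curve (point_sum P.base_points)"
    unfolding riemann_roch_space_def by blast
  have "\<exists>w. to_ac w = ?F (rep (gam n)) / P.E (rep (gam n))" for n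
  proof (rule GF_card_range)
    let ?x = "rep (gam n)"
    have x: "?x = gam n *s phi ?x" using rep_phi[OF h_root_norm1[OF gam_props(1)]] by simp
    have "?F ?x = gam n ^ Suc q * frob (?F ?x)"
      using ternary_form_homogeneous[OF Ff, where c = "gam n" and x = "phi ?x"] unfolding x[symmetric] trace_form_phi[OF k] .
    moreover have "P.E ?x = gam n ^ Suc q * frob (P.E ?x)"
      using ternary_form_homogeneous[OF C.ternary_form_cyclic[of c "frob c" "frob (frob c)"], where c = "gam n" and x = "phi ?x"]
      unfolding x[symmetric] Einv .
    ultimately have "?F ?x / P.E ?x = frob (?F ?x) / frob (P.E ?x)"
      using gam_props(3) by (metis mult_divide_mult_cancel_left power_not_zero)
    then have "frob (?F ?x / P.E ?x) = ?F ?x / P.E ?x" unfolding power_divide by (rule sym)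
    then show "?F ?x / P.E ?x \<in> GF CARD('f)" by (simp only: GF_def card_f mem_Collect_eq)
  qed
  then obtain w where w: "\<And>n. to_ac (w n) = ?F (rep (gam n)) / P.E (rep (gam n))" by metis
  have "(\<chi> n. w n) \<in> W" unfolding W_def functional_code_def mem_Collect_eq vec_lambda_beta w
    by (rule bexI[OF _ f]) (simp only: val simp_thms)
  then show ?thesis using w by (intro bexI[of _ "\<chi> n. w n"]) auto
qed

lemma exponents_adjoint: "s \<in> C.exponents \<Longrightarrow> (Suc q - fst s - snd s, fst s, snd s) \<in> C.adjoint_exponents"
  by (auto simp: C.exponents_def C.adjoint_exponents_def)

text \<open>The trace forms for k = 1, \<beta>, \<beta>^2 combine three conjugate monomials by an
  invertible Vandermonde matrix, so each monomial is recovered over the closure.\<close>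

lemma chi_span_W: "chi ` C.exponents \<subseteq> vec.span (ac_vec ` W)"
proof clarify
  fix j l assume ex: "(j, l) \<in> C.exponents"
  define i where "i = Suc q - j - l"
  have adj: "(i, j, l) \<in> C.adjoint_exponents" using exponents_adjoint[OF ex] by (simp add: i_def)
  \<comment> \<open>The last row (1, \<beta>, \<beta>^2) of the coordinate matrix belongs to the
    monomial itself and the other rows to its conjugates; hence the third axis vector.\<close>
  define a where "a = inv_matrix *v axis 3 1"
  have a: "coord_matrix *v a = axis 3 1" unfolding a_def by (rule coord_inv)
  have a1: "a $ 1 + frob \<beta> * a $ 2 + frob \<beta> ^ 2 * a $ 3 = 0"
    and a2: "a $ 1 + frob (frob \<beta>) * a $ 2 + frob (frob \<beta>) ^ 2 * a $ 3 = 0"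
    and a3: "a $ 1 + \<beta> * a $ 2 + \<beta> ^ 2 * a $ 3 = 1"
    using a unfolding vec3_eq_iff by (simp_all add: matrix_vector_mult_def sum_3 coord_matrix_def axis_def)
  have fsq: "frob (x ^ 2) = (frob x) ^ 2" for x :: "'f alg_closure" by (simp add: mult.commute flip: power_mult)
  have b2: "frob (frob (frob (\<beta> ^ 2))) = \<beta> ^ 2" by (simp only: fsq beta_frob3)
  have b0: "frob (frob (frob 1)) = (1 :: 'f alg_closure)" by simp
  obtain w1 where w1: "w1 \<in> W" "\<And>n. to_ac (w1 $ n) = trace_form 1 i j l (rep (gam n)) / P.E (rep (gam n))"
    using trace_form_code[OF b0 adj] by blast
  obtain w2 where w2: "w2 \<in> W" "\<And>n. to_ac (w2 $ n) = trace_form \<beta> i j l (rep (gam n)) / P.E (rep (gam n))"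
    using trace_form_code[OF beta_frob3 adj] by blast
  obtain w3 where w3: "w3 \<in> W" "\<And>n. to_ac (w3 $ n) = trace_form (\<beta> ^ 2) i j l (rep (gam n)) / P.E (rep (gam n))"
    using trace_form_code[OF b2 adj] by blast
  have m: "C.mono3 i j l x = a $ 1 * trace_form 1 i j l x + a $ 2 * trace_form \<beta> i j l x + a $ 3 * trace_form (\<beta> ^ 2) i j l x" for x
  proof -
    have "a $ 1 * trace_form 1 i j l x + a $ 2 * trace_form \<beta> i j l x + a $ 3 * trace_form (\<beta> ^ 2) i j l x =
      (a $ 1 + \<beta> * a $ 2 + \<beta> ^ 2 * a $ 3) * C.mono3 i j l x
      + (a $ 1 + frob \<beta> * a $ 2 + frob \<beta> ^ 2 * a $ 3) * C.mono3 l i j x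
      + (a $ 1 + frob (frob \<beta>) * a $ 2 + frob (frob \<beta>) ^ 2 * a $ 3) * C.mono3 j l i x"
      unfolding trace_form_def fsq by (simp only: power_one mult_1_left algebra_simps)
    then show ?thesis unfolding a1 a2 a3 by simp
  qed
  have "chi (j, l) = a $ 1 *s ac_vec w1 + a $ 2 *s ac_vec w2 + a $ 3 *s ac_vec w3"
    unfolding vec_eq_iff
  proof
    fix n
    have "chi (j, l) $ n = C.mono3 i j l (rep (gam n)) / P.E (rep (gam n))" unfolding chi_def i_def by simp
    then show "chi (j, l) $ n = (a $ 1 *s ac_vec w1 + a $ 2 *s ac_vec w2 + a $ 3 *s ac_vec w3) $ n"
      by (simp add: m w1 w2 w3 add_divide_distrib)
  qed
  then show "chi (j, l) \<in> vec.span (ac_vec ` W)"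
    using w1 w2 w3 by (simp add: vec.span_add vec.span_scale vec.span_base)
qed

lemma mono3_rep: "C.mono3 i j l (rep \<gamma>) = \<gamma> ^ (i + q * j) * (\<gamma> ^ N) ^ j"
proof -
  have "(\<gamma> ^ (q^2 + 1)) ^ j = (\<gamma> ^ N) ^ j * \<gamma> ^ (q * j)"
    unfolding Q1_eq power_add[of \<gamma> N q] power_mult_distrib by (simp only: power_mult)
  then show ?thesis unfolding C.mono3_def rep_nth by (simp only: power_add power_one mult_1_right mult_1_left mult_ac)
qed

text \<open>The exponent i + q j of \<gamma> on a fibre of \<gamma>^N, lowered by its least value q
  so that the range stays below N.\<close>

definition residue :: "nat \<times> nat \<Rightarrow> nat" where
  "residue s = (Suc q - fst s - snd s) + q * fst s - q"

lemma residue_bounds: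
  assumes "s \<in> C.exponents"
  shows "(Suc q - fst s - snd s) + q * fst s = residue s + q" "residue s < N"
proof -
  obtain j k where s: "s = (j, k)" by force
  consider "j \<ge> 1" "k \<ge> 1" "j + k \<le> q" | "j = 0" "k = 1" | "j = 1" "k = q"
    using assms by (auto simp: s C.exponents_def)
  then have "(Suc q - j - k) + q * j \<ge> q \<and> (Suc q - j - k) + q * j < N + q"
  proof cases
    case 1
    have "q * 1 \<le> q * j" using 1 by (intro mult_le_mono2)
    moreover have "q * j + q \<le> q * q"
    proof -
      have "q * (j + 1) \<le> q * q" using 1 by (intro mult_le_mono2) simp
      then show ?thesis by (simp add: distrib_left)
    qed
    moreover have "Suc q - j - k \<le> q" using 1 by simp
    ultimately show ?thesis using N_pos unfolding power2_eq_square by linarith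
  next
    case 2 then show ?thesis using N_pos by simp
  next
    case 3 then show ?thesis using N_pos by simp
  qed
  then show "(Suc q - fst s - snd s) + q * fst s = residue s + q" "residue s < N"
    unfolding s residue_def fst_conv snd_conv by linarith+
qed

text \<open>For 1 \<le> i < q the numbers i and j are recovered from i + q j by division by q; the
  two exceptional monomials both give i + q j = q, with remainder 0.\<close>

lemma residue_inj:
  assumes "s \<in> C.exponents" "s' \<in> C.exponents" "residue s = residue s'" "s \<notin> {(0, 1), (1, q)}"
  shows "s = s'"
proof -
  obtain j k where s: "s = (j, k)" by force
  obtain j' k' where s': "s' = (j', k')" by force
  have 1: "j \<ge> 1" "k \<ge> 1" "j + k \<le> q" using assms(1,4) by (auto simp: s C.exponents_def)
  define i where "i = Suc q - j - k"
  define i' where "i' = Suc q - j' - k'"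
  have i: "1 \<le> i" "i < q" using 1 by (auto simp: i_def)
  have eq: "i + q * j = i' + q * j'"
    using residue_bounds(1)[OF assms(1)] residue_bounds(1)[OF assms(2)] assms(3) by (simp add: s s' i_def i'_def)
  have m: "(i + q * j) mod q = i" "(i + q * j) div q = j" using i by simp_all
  consider "j' \<ge> 1" "k' \<ge> 1" "j' + k' \<le> q" | "j' = 0" "k' = 1" | "j' = 1" "k' = q"
    using assms(2) by (auto simp: s' C.exponents_def)
  then show ?thesis
  proof cases
    case A: 1
    then have i': "i' < q" by (auto simp: i'_def)
    then have "(i' + q * j') mod q = i'" "(i' + q * j') div q = j'" by simp_all
    then have "i = i'" "j = j'" using m eq by simp_all
    then show ?thesis using 1 A by (simp add: s s' i_def i'_def)
  next
    case 2
    then have "(i' + q * j') mod q = 0" by (simp add: i'_def)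
    then show ?thesis using m eq i by simp
  next
    case 3
    then have "(i' + q * j') mod q = 0" by (simp add: i'_def)
    then show ?thesis using m eq i by simp
  qed
qed

lemma h_root_avoiding:
  assumes "finite Z" "card Z < q + 1"
  obtains \<delta> where "h \<delta> = 0" "\<delta> \<notin> Z"
proof -
  have "\<not> {\<delta>. h \<delta> = 0} \<subseteq> Z" using card_mono[OF assms(1), of "{\<delta>. h \<delta> = 0}"] card_h_roots(1) assms(2) by auto
  then show ?thesis using that by blast
qed

text \<open>On the points over one root of \<open>h\<close> the monomials restrict to powers of \<open>\<gamma>\<close> whose
  exponents differ modulo \<open>N\<close>, except for the two that are not divisible by \<open>X\<^sub>0 X\<^sub>1 X\<^sub>2\<close>.\<close>

lemma monomials_independent:
  assumes zero: "\<And>\<gamma>. \<gamma> \<in> off_orbit (\<gamma>0 ^ N) \<Longrightarrow>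
    (\<Sum>s\<in>C.exponents. a s * C.mono3 (Suc q - fst s - snd s) (fst s) (snd s) (rep \<gamma>)) = 0"
    and s0: "s0 \<in> C.exponents"
  shows "a s0 = 0"
proof -
  have coeff: "(\<Sum>s\<in>C.exponents. if residue s = t then a s * \<delta> ^ fst s else 0) = 0"
    if d: "h \<delta> = 0" "\<delta> \<noteq> \<gamma>0 ^ N" for \<delta> t
  proof -
    obtain \<gamma>1 where g1: "\<gamma>1 ^ N = \<delta>" using nth_root_exists[OF N_pos(1)] by blast
    then have g10: "\<gamma>1 \<noteq> 0" using d h_root_gamma_nz[of \<gamma>1] by simp
    \<comment> \<open>Over a fixed root \<delta> the relation is a polynomial in \<gamma> of degree
      below N with N roots, so its coefficient vanishes for each residue separately.\<close>
    define p where "p = (\<Sum>s\<in>C.exponents. Polynomial.monom (a s * \<delta> ^ fst s) (residue s))"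
    have "degree p \<le> N - 1" unfolding p_def
      by (rule degree_sum_le[OF C.finite_exponents])
         (use residue_bounds(2) in \<open>fastforce intro: order.trans[OF Polynomial.degree_monom_le]\<close>)
    then have deg: "degree p < N" using N_pos by linarith
    have root: "poly p \<gamma> = 0" if g: "\<gamma> ^ N = \<delta>" for \<gamma>
    proof -
      have "\<gamma> \<in> off_orbit (\<gamma>0 ^ N)" using d g by (simp only: off_orbit_def mem_Collect_eq) simp
      from zero[OF this] have "0 = (\<Sum>s\<in>C.exponents. a s * (\<gamma> ^ (residue s + q) * \<delta> ^ fst s))"
        unfolding mono3_rep g using residue_bounds(1) by simp
      also have "\<dots> = \<gamma> ^ q * poly p \<gamma>"
        unfolding p_def by (simp add: poly_sum poly_monom sum_distrib_left power_add mult_ac)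
      finally show ?thesis using g d h_root_gamma_nz[of \<gamma>] by simp
    qed
    have "p = 0"
    proof (rule ccontr)
      assume p0: "p \<noteq> 0"
      have "card {\<gamma>. \<gamma> ^ N = \<gamma>1 ^ N} \<le> card {\<gamma>. poly p \<gamma> = 0}"
        using root poly_roots_finite[OF p0] unfolding g1 by (intro card_mono) auto
      also have "\<dots> \<le> degree p" using p0 by (rule card_poly_roots_bound)
      finally show False using deg unfolding fibre_N(3)[OF g10] by simp
    qed
    then have "Polynomial.coeff p t = 0" by simp
    then show ?thesis unfolding p_def coeff_sum by simp
  qed
  show ?thesis
  proof (cases "s0 \<in> {(0, 1), (1, q)}")
    case False
    obtain \<delta> where d: "h \<delta> = 0" "\<delta> \<noteq> \<gamma>0 ^ N" using h_root_avoiding[of "{\<gamma>0 ^ N}"] q2 by auto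
    have "(\<Sum>s\<in>C.exponents. if residue s = residue s0 then a s * \<delta> ^ fst s else 0) =
      (\<Sum>s\<in>C.exponents. if s = s0 then a s * \<delta> ^ fst s else 0)"
    proof (rule sum.cong[OF refl])
      fix s assume s: "s \<in> C.exponents"
      have "residue s = residue s0 \<longleftrightarrow> s = s0" using residue_inj[OF s0 s _ False] by auto
      then show "(if residue s = residue s0 then a s * \<delta> ^ fst s else 0) = (if s = s0 then a s * \<delta> ^ fst s else 0)" by simp
    qed
    then have "a s0 * \<delta> ^ fst s0 = 0" using coeff[OF d, of "residue s0"] s0 C.finite_exponents by simp
    then show ?thesis using h_root_nz[OF d(1)] by simp
  next
    case True
    \<comment> \<open>The two exceptional monomials share the residue 0 and differ by the factor
      \<delta>; two different roots \<delta> separate them.\<close>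
    have r: "residue (0, 1) = 0" "residue (1, q) = 0" by (simp_all add: residue_def)
    have mem: "(0, 1) \<in> C.exponents" "(1, q) \<in> C.exponents" by (auto simp: C.exponents_def)
    have two: "a (0, 1) + a (1, q) * \<delta> = 0" if d: "h \<delta> = 0" "\<delta> \<noteq> \<gamma>0 ^ N" for \<delta>
    proof -
      have "(\<Sum>s\<in>C.exponents. if residue s = 0 then a s * \<delta> ^ fst s else 0) =
        (\<Sum>s\<in>{(0, 1), (1, q)}. if residue s = 0 then a s * \<delta> ^ fst s else 0)"
      proof (rule sum.mono_neutral_right[OF C.finite_exponents])
        show "{(0, 1), (1, q)} \<subseteq> C.exponents" using mem by simp
        show "\<forall>s\<in>C.exponents - {(0, 1), (1, q)}. (if residue s = 0 then a s * \<delta> ^ fst s else 0) = 0"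
        proof
          fix s assume s: "s \<in> C.exponents - {(0, 1), (1, q)}"
          then have "residue s \<noteq> 0" using residue_inj[of s "(0, 1)"] mem r by auto
          then show "(if residue s = 0 then a s * \<delta> ^ fst s else 0) = 0" by simp
        qed
      qed
      then show ?thesis using coeff[OF d, of 0] r by simp
    qed
    obtain \<delta> where d: "h \<delta> = 0" "\<delta> \<noteq> \<gamma>0 ^ N" using h_root_avoiding[of "{\<gamma>0 ^ N}"] q2 by auto
    have "card {\<gamma>0 ^ N, \<delta>} < q + 1" using q2 card_insert_le_m1[of 2 "{\<delta>}" "\<gamma>0 ^ N"] by simp
    then obtain \<delta>' where d': "h \<delta>' = 0" "\<delta>' \<noteq> \<gamma>0 ^ N" "\<delta>' \<noteq> \<delta>" using h_root_avoiding[of "{\<gamma>0 ^ N, \<delta>}"] by auto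
    have "a (1, q) * (\<delta> - \<delta>') = (a (0, 1) + a (1, q) * \<delta>) - (a (0, 1) + a (1, q) * \<delta>')" by (simp add: algebra_simps)
    then have "a (1, q) = 0" unfolding two[OF d] two[OF d'(1,2)] using d'(3) by simp
    then show ?thesis using two[OF d] True by auto
  qed
qed

lemma chi_independent:
  assumes "(\<Sum>s\<in>C.exponents. a s *s chi s) = 0" "s0 \<in> C.exponents"
  shows "a s0 = 0"
proof (rule monomials_independent[OF _ assms(2)])
  fix \<gamma> assume "\<gamma> \<in> off_orbit (\<gamma>0 ^ N)"
  then have "\<gamma> \<in> range gam" using gam by (simp only: bij_betw_def)
  then obtain i where i: "\<gamma> = gam i" by auto
  have "(\<Sum>s\<in>C.exponents. a s *s chi s) $ i = 0" using assms(1) by simp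
  then have "(\<Sum>s\<in>C.exponents. a s * C.mono3 (Suc q - fst s - snd s) (fst s) (snd s) (rep \<gamma>)) / P.E (rep \<gamma>) = 0"
    by (simp add: chi_def i sum_divide_distrib)
  then show "(\<Sum>s\<in>C.exponents. a s * C.mono3 (Suc q - fst s - snd s) (fst s) (snd s) (rep \<gamma>)) = 0"
    using E_gam i by simp
qed

lemma chi_inj: "inj_on chi C.exponents"
proof (rule inj_onI, rule ccontr)
  fix s s' assume s: "s \<in> C.exponents" "s' \<in> C.exponents" "chi s = chi s'" "s \<noteq> s'"
  have "(\<Sum>t\<in>C.exponents. ((if t = s then 1 else 0) - (if t = s' then 1 else 0)) *s chi t) =
    (\<Sum>t\<in>C.exponents. if t = s then chi t else 0) - (\<Sum>t\<in>C.exponents. if t = s' then chi t else 0)"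
    unfolding sum_subtractf[symmetric] by (intro sum.cong) auto
  also have "\<dots> = 0" using s C.finite_exponents by simp
  finally show False using chi_independent[of "\<lambda>t. (if t = s then 1 else 0) - (if t = s' then 1 else 0)" s] s by simp
qed

lemma independent_chi: "vec.independent (chi ` C.exponents)"
proof
  assume "vec.dependent (chi ` C.exponents)"
  then obtain u v where "v \<in> chi ` C.exponents" "u v \<noteq> 0" "(\<Sum>v\<in>chi ` C.exponents. u v *s v) = 0"
    using vec.dependent_finite[of "chi ` C.exponents"] C.finite_exponents by auto
  then show False using chi_independent[of "\<lambda>s. u (chi s)"] by (auto simp: sum.reindex[OF chi_inj] o_def)
qed

lemma dim_W: "vec.dim W = card C.exponents"
  using dim_ac_vec[OF independent_chi W_span_chi chi_span_W] card_image[OF chi_inj] by simp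

lemma card_exponents: "2 * card C.exponents = q * (q - 1) + 4"
proof -
  have f: "finite {(j, k). 1 \<le> j \<and> 1 \<le> k \<and> j + k \<le> q}"
    using C.finite_exponents by (rule rev_finite_subset) (auto simp: C.exponents_def)
  have "C.exponents = {(j, k). 1 \<le> j \<and> 1 \<le> k \<and> j + k \<le> q} \<union> {(0, 1), (1, q)}" unfolding C.exponents_def by (rule refl)
  moreover have "card ({(j, k). 1 \<le> j \<and> 1 \<le> k \<and> j + k \<le> q} \<union> {(0, 1), (1, q)}) =
    card {(j, k). 1 \<le> j \<and> 1 \<le> k \<and> j + k \<le> q} + card {(0, 1 :: nat), (1 :: nat, q)}"
    using f by (intro card_Un_disjoint) auto
  ultimately show ?thesis using card_exponent_triangle[of q] by simp
qed

section \<open>Words of the dual code and its minimum distance\<close>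

text \<open>Orthogonality passes to the span over the closure, which contains the monomial
  words.\<close>

lemma dual_W_chi:
  assumes v: "v \<in> dual_code W" and s: "s \<in> C.exponents"
  shows "(\<Sum>i\<in>UNIV. to_ac (v $ i) * chi s $ i) = 0"
proof -
  have "ac_vec v \<in> dual_code (ac_vec ` W)"
    unfolding dual_code_def
  proof clarify
    fix w assume "w \<in> W"
    then have "(\<Sum>i\<in>UNIV. v $ i * w $ i) = 0" using v by (simp add: dual_code_def)
    then have "to_ac (\<Sum>i\<in>UNIV. v $ i * w $ i) = 0" by simp
    then show "(\<Sum>i\<in>UNIV. ac_vec v $ i * ac_vec w $ i) = 0" by (simp add: to_ac_sum)
  qed
  then have "ac_vec v \<in> dual_code (vec.span (ac_vec ` W))" by (simp only: dual_code_span)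
  moreover have "chi s \<in> vec.span (ac_vec ` W)" using chi_span_W s by blast
  ultimately show ?thesis by (simp add: dual_code_def)
qed

lemma gam_inj: "gam i = gam j \<Longrightarrow> i = j"
  using gam by (auto simp: bij_betw_def inj_def)

lemma dual_weight:
  assumes v: "v \<in> dual_code W" "v \<noteq> 0"
  shows "3 \<le> card {i. v $ i \<noteq> 0}"
proof (rule ccontr)
  assume small: "\<not> 3 \<le> card {i. v $ i \<noteq> 0}"
  \<comment> \<open>The exponent q - 2 is admissible because q > 2. For weight 2 the two
    orthogonality relations form an invertible Vandermonde system.\<close>
  let ?s = "(1, q - 1)" and ?s' = "(1, q - 2)"
  have mem: "?s \<in> C.exponents" "?s' \<in> C.exponents" using q2 by (auto simp: C.exponents_def)
  define \<alpha> where "\<alpha> i = to_ac (v $ i) * chi ?s $ i" for i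
  have chi': "chi ?s' $ i = chi ?s $ i * gam i" for i
  proof -
    have "Suc q - 1 - (q - 1) = 1" "Suc q - 1 - (q - 2) = 2" using q2 by auto
    then show ?thesis by (simp add: chi_def C.mono3_def power2_eq_square)
  qed
  have chi0: "chi ?s $ i \<noteq> 0" for i
    using gam_props(3)[of i] E_gam[of i] by (simp add: chi_def C.mono3_def)
  have sup: "\<alpha> i = 0 \<longleftrightarrow> v $ i = 0" for i using chi0[of i] by (simp add: \<alpha>_def)
  have s1: "(\<Sum>i\<in>{i. v $ i \<noteq> 0}. \<alpha> i) = 0"
  proof -
    have "(\<Sum>i\<in>{i. v $ i \<noteq> 0}. \<alpha> i) = (\<Sum>i\<in>UNIV. \<alpha> i)" by (rule sum.mono_neutral_left) (auto simp: sup)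
    then show ?thesis using dual_W_chi[OF v(1) mem(1)] by (simp add: \<alpha>_def)
  qed
  have s2: "(\<Sum>i\<in>{i. v $ i \<noteq> 0}. \<alpha> i * gam i) = 0"
  proof -
    have "(\<Sum>i\<in>{i. v $ i \<noteq> 0}. \<alpha> i * gam i) = (\<Sum>i\<in>UNIV. \<alpha> i * gam i)" by (rule sum.mono_neutral_left) (auto simp: sup)
    also have "\<dots> = (\<Sum>i\<in>UNIV. to_ac (v $ i) * chi ?s' $ i)"
      unfolding \<alpha>_def chi' by (simp only: mult.assoc)
    finally show ?thesis unfolding dual_W_chi[OF v(1) mem(2)] .
  qed
  have "{i. v $ i \<noteq> 0} \<noteq> {}" using v(2) by (auto simp: vec_eq_iff)
  then have "card {i. v $ i \<noteq> 0} = 1 \<or> card {i. v $ i \<noteq> 0} = 2"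
    using small card_gt_0_iff[of "{i. v $ i \<noteq> 0}"] by auto
  then show False
  proof
    assume "card {i. v $ i \<noteq> 0} = 1"
    then obtain i where i: "{i. v $ i \<noteq> 0} = {i}" by (rule card_1_singletonE)
    then have "\<alpha> i = 0" using s1 by simp
    then show False using i sup by blast
  next
    assume "card {i. v $ i \<noteq> 0} = 2"
    then obtain i j where ij: "{i. v $ i \<noteq> 0} = {i, j}" "i \<noteq> j" by (auto simp: card_2_iff)
    have 1: "\<alpha> i + \<alpha> j = 0" "\<alpha> i * gam i + \<alpha> j * gam j = 0" using s1 s2 ij by simp_all
    have "\<alpha> i * (gam i - gam j) = (\<alpha> i * gam i + \<alpha> j * gam j) - (\<alpha> i + \<alpha> j) * gam j" by (simp add: algebra_simps)
    then have "\<alpha> i = 0" using 1 gam_inj ij(2) by auto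
    then show False using ij sup by blast
  qed
qed

lemma trace_form_rep:
  "trace_form k 1 q 0 (rep \<gamma>) = \<gamma> ^ q * (k * (\<gamma> ^ N) ^ (q + 1) + frob k * \<gamma> ^ N + frob (frob k))"
proof -
  have "trace_form k 1 q 0 (rep \<gamma>) = C.cyclic_form k (frob k) (frob (frob k)) (rep \<gamma>)"
    by (simp add: trace_form_def C.cyclic_form_def C.mono3_def mult_ac)
  then show ?thesis unfolding cyclic_rep .
qed

text \<open>A second curve of the pencil meets the curve in another orbit; this gives a word of the
  functional code vanishing there, so the dual code contains a word supported in that orbit.\<close>

lemma dual_small_word:
  obtains v where "v \<in> dual_code W" "v \<noteq> 0" "card {i. v $ i \<noteq> 0} \<le> card C.exponents"
proof -
  obtain \<delta>1 where d1: "h \<delta>1 = 0" "\<delta>1 \<noteq> \<gamma>0 ^ N" using h_root_avoiding[of "{\<gamma>0 ^ N}"] q2 by auto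
  have "card {\<gamma>0 ^ N, \<delta>1} < q + 1" using q2 card_insert_le_m1[of 2 "{\<delta>1}" "\<gamma>0 ^ N"] by simp
  \<comment> \<open>A third orbit witnesses that \<open>w0\<close> is not zero: among the orbits on
    the curve, the form with parameter \<open>k\<close> vanishes on that of \<delta>1 only.\<close>
  then obtain \<delta>2 where d2: "h \<delta>2 = 0" "\<delta>2 \<noteq> \<gamma>0 ^ N" "\<delta>2 \<noteq> \<delta>1" using h_root_avoiding[of "{\<gamma>0 ^ N, \<delta>1}"] by auto
  obtain \<gamma>1 where g1: "\<gamma>1 ^ N = \<delta>1" using nth_root_exists[OF N_pos(1)] by blast
  obtain \<gamma>2 where g2: "\<gamma>2 ^ N = \<delta>2" using nth_root_exists[OF N_pos(1)] by blast
  have h1: "h (\<gamma>1 ^ N) = 0" using g1 d1 by (simp only:)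
  obtain k where k: "frob (frob (frob k)) = k" "frob k \<noteq> frob \<tau> * k"
    "k * (\<gamma>1 ^ N) ^ (q + 1) + frob k * \<gamma>1 ^ N + frob (frob k) = 0" by (rule pencil_parameter[OF h1])
  have k1: "k * \<delta>1 ^ (q + 1) + frob k * \<delta>1 + frob (frob k) = 0" using k(3) unfolding g1 .
  interpret K: klein_pencil q expo \<tau> "\<tau> ^ (q^2 + 1)" 1 k "frob k" "frob (frob k)" by (rule pencil[OF k(1,2)])
  have "(1, q, 0) \<in> C.adjoint_exponents" by (simp add: C.adjoint_exponents_def)
  from trace_form_code[OF k(1) this] obtain w0 where w0: "w0 \<in> W"
    and val: "\<And>n. to_ac (w0 $ n) = trace_form k 1 q 0 (rep (gam n)) / P.E (rep (gam n))" by blast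
  let ?O = "{n. gam n ^ N = \<delta>1}"
  have O0: "w0 $ n = 0" if "n \<in> ?O" for n
  proof -
    have "gam n ^ N = \<delta>1" using that by simp
    then have "trace_form k 1 q 0 (rep (gam n)) = 0" unfolding trace_form_rep by (simp only: k1 mult_zero_right)
    then have "to_ac (w0 $ n) = to_ac 0" using val by simp
    then show ?thesis by (simp only: to_ac_eq_iff)
  qed
  have "w0 \<noteq> 0"
  proof
    assume z: "w0 = 0"
    have "\<gamma>2 \<in> off_orbit (\<gamma>0 ^ N)" using d2 unfolding off_orbit_def mem_Collect_eq g2 by blast
    then have "\<gamma>2 \<in> range gam" using gam by (simp only: bij_betw_def)
    then obtain n where n: "gam n = \<gamma>2" by auto
    have "to_ac (w0 $ n) = 0" using z by simp
    then have "trace_form k 1 q 0 (rep \<gamma>2) = 0" using val[of n] E_gam[of n] n by simp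
    then have "k * \<delta>2 ^ (q + 1) + frob k * \<delta>2 + frob (frob k) = 0"
      unfolding trace_form_rep g2 using gam_props(3)[of n] n by (simp only: mult_eq_0_iff power_eq_0_iff) simp
    moreover have "k \<noteq> \<tau> * frob (frob k)" using K.minors(1) by simp
    ultimately show False using common_root_unique[OF _ d2(1) _ d1(1) k1] d2(3) by blast
  qed
  have cO: "card ?O = N"
  proof -
    have "gam ` ?O = {\<gamma>. \<gamma> ^ N = \<gamma>1 ^ N}"
    proof (intro subset_antisym subsetI)
      fix \<gamma> assume "\<gamma> \<in> {\<gamma>. \<gamma> ^ N = \<gamma>1 ^ N}"
      then have g: "\<gamma> ^ N = \<delta>1" using g1 by simp
      then have "\<gamma> \<in> off_orbit (\<gamma>0 ^ N)" using d1 unfolding off_orbit_def mem_Collect_eq g by blast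
      then have "\<gamma> \<in> range gam" using gam by (simp only: bij_betw_def)
      then obtain n where "gam n = \<gamma>" by auto
      then show "\<gamma> \<in> gam ` ?O" using g by auto
    qed (use g1 in auto)
    moreover have "card (gam ` ?O) = card ?O" using gam_inj by (intro card_image) (auto simp: inj_on_def)
    ultimately show ?thesis using fibre_N(3)[OF h_root_gamma_nz[OF h1]] by simp
  qed
  \<comment> \<open>The dimension of the functional code does not exceed the size of an orbit, so a
    support of that size fits into one.\<close>
  have "card C.exponents \<le> N"
  proof -
    obtain m where m: "q = Suc (Suc (Suc m))" using q2 by (metis add_2_eq_Suc less_imp_Suc_add)
    have "2 * card C.exponents \<le> 2 * N" unfolding card_exponents by (simp add: m power2_eq_square)
    then show ?thesis by simp
  qed
  then obtain S where S: "S \<subseteq> ?O" "card S = card C.exponents" using cO obtain_subset_with_card_n by metis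
  obtain v where "v \<in> dual_code W" "v \<noteq> 0" "{i. v $ i \<noteq> 0} \<subseteq> S"
    by (rule dual_code_small_support[OF w0 \<open>w0 \<noteq> 0\<close>, of S]) (use O0 S dim_W in auto)
  moreover have "card {i. v $ i \<noteq> 0} \<le> card S" if "{i. v $ i \<noteq> 0} \<subseteq> S" for v :: "'f ^ 'n"
    using that by (intro card_mono) auto
  ultimately show ?thesis using that S(2) by metis
qed

lemma dual_code_parameters:
  "vec.subspace (dual_code W) \<and> CARD('n) = q * N \<and>
   real (vec.dim (dual_code W)) = real q ^ 3 - 3/2 * real q ^ 2 + 3/2 * real q - 2 \<and>
   3 \<le> min_distance (dual_code W) \<and> real (min_distance (dual_code W)) \<le> 1/2 * (real q ^ 2 - real q) + 2"
proof -
  have n: "CARD('n) = q * N" using bij_betw_same_card[OF gam] card_off_orbit[OF h0] by simp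
  have rN: "real N = real q ^ 2 - real q + 1" using N_pos by (simp add: of_nat_diff)
  have rk: "2 * real (card C.exponents) = real q ^ 2 - real q + 4"
  proof -
    have "2 * real (card C.exponents) = real (q * (q - 1)) + 4"
      using card_exponents[THEN arg_cong[where f = real]] by (simp only: of_nat_add of_nat_mult of_nat_numeral)
    moreover have "real (q * (q - 1)) = real q * (real q - 1)" using q2 by (simp add: of_nat_diff)
    ultimately show ?thesis by (simp add: algebra_simps power2_eq_square)
  qed
  have "real (vec.dim (dual_code W)) + real (card C.exponents) = real q * real N"
    using dim_dual_code[of W] unfolding dim_W n by (simp only: of_nat_add[symmetric] of_nat_mult[symmetric])
  then have dim: "real (vec.dim (dual_code W)) = real q ^ 3 - 3/2 * real q ^ 2 + 3/2 * real q - 2"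
    using rk unfolding rN by (simp add: algebra_simps power2_eq_square power3_eq_cube)
  obtain v where v: "v \<in> dual_code W" "v \<noteq> 0" "card {i. v $ i \<noteq> 0} \<le> card C.exponents" by (rule dual_small_word)
  have "3 \<le> min_distance (dual_code W) \<and> min_distance (dual_code W) \<le> card C.exponents"
    by (rule min_distance_bounds[OF dual_code_subspace dual_weight v])
  moreover from this have "real (min_distance (dual_code W)) \<le> real (card C.exponents)" by simp
  ultimately show ?thesis using dual_code_subspace[of W] n dim rk by (intro conjI) (simp_all add: field_simps)
qed

end

theorem theorem4p4:
  fixes q :: nat
    and \<tau> \<beta> :: "'f::{field,finite} alg_closure"
    and P0 :: "'f alg_closure point"
    and Q :: "'n::finite \<Rightarrow> 'f alg_closure point"
  defines "code \<equiv> hermitian_singer_differential_code q \<tau> \<beta> P0 Q"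
  assumes "primepow q" and "q > 2" and "CARD('f) = q^2"
    and "\<tau> ^ (q^2 + q + 1) = 1"
    and "\<beta> ^ (q^2 - q + 1) = 1" and "\<forall>m. 0 < m \<and> m < q^2 - q + 1 \<longrightarrow> \<beta> ^ m \<noteq> 1"
    and "P0 \<in> hermitian_curve q \<tau> \<inter> singer_plane q"
    and "bij_betw Q UNIV (hermitian_curve q \<tau> \<inter> singer_plane q - singer_orbit q \<beta> P0)"
  shows "vec.subspace code \<and>
    CARD('n) = q * (q^2 - q + 1) \<and>
    real (vec.dim code) = real q ^ 3 - 3/2 * real q ^ 2 + 3/2 * real q - 2 \<and>
    3 \<le> min_distance code \<and>
    real (min_distance code) \<le> 1/2 * (real q ^ 2 - real q) + 2"
proof -
  interpret singer_setting q \<tau> \<beta> using assms by unfold_locales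
  obtain \<gamma>0 where g0: "h (\<gamma>0 ^ N) = 0" "P0 = pt (rep \<gamma>0)"
    using assms(8) unfolding curve_plane by blast
  obtain c where c: "frob (frob (frob c)) = c" "frob c \<noteq> frob \<tau> * c"
    "c * (\<gamma>0 ^ N) ^ (q + 1) + frob c * \<gamma>0 ^ N + frob (frob c) = 0" by (rule pencil_parameter[OF g0(1)])
  let ?O = "off_orbit (\<gamma>0 ^ N)" and ?p = "\<lambda>\<gamma>. pt (rep \<gamma>)"
  have inj: "inj_on ?p A" for A using pt_rep_inj by (auto simp: inj_on_def)
  have "hermitian_curve q \<tau> \<inter> singer_plane q - singer_orbit q \<beta> P0 = ?p ` ?O"
    unfolding curve_plane g0(2) orbit_eq[OF h_root_gamma_nz[OF g0(1)]] off_orbit_def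
    using pt_rep_inj by blast
  then have Q: "bij_betw Q UNIV (?p ` ?O)" using assms(9) by simp
  \<comment> \<open>The evaluation points are replaced by their parameters \<gamma>, in the order
    given by \<open>Q\<close>.\<close>
  define gam where "gam = inv_into ?O ?p \<circ> Q"
  have gam: "bij_betw gam UNIV ?O"
    unfolding gam_def by (rule bij_betw_trans[OF Q bij_betw_inv_into[OF inj_on_imp_bij_betw[OF inj]]])
  have Qmem: "Q i \<in> ?p ` ?O" for i using Q unfolding bij_betw_def by blast
  have "Q i = pt (rep (gam i))" for i
    using f_inv_into_f[OF Qmem[of i]] by (simp only: gam_def comp_apply)
  then have Qg: "Q = (\<lambda>i. pt (rep (gam i)))" by (rule ext)
  interpret singer_code q \<tau> \<beta> \<gamma>0 c gam
    using g0(1) gam c by unfold_locales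
  have "code = dual_code W"
    unfolding code_def hermitian_singer_differential_code_def W_def hermitian_curve_eq Qg[symmetric]
      base_points_orbit[OF pencil[OF c(1,2)] g0(1) c(3)] g0(2) ..
  then show ?thesis using dual_code_parameters by simp
qed

end
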